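(* Let $d\ge 2$ and $(\mathbf a,\mathbf p)\in\Omega$. If $\mathbf a$ is $\beta$-Diophantine (with $\beta>0$) and $R$ is a real number with $$2\left(R-\tfrac12\right)\beta<1,$$ then $$\lim_{n\to\infty} n^R\left[\mathbb P_{\mathbf a,\mathbf p}\left(\frac{S_n}{\sigma\sqrt n}\le z\right)-\mathcal E_{d-1}(z)\right]=0$$ uniformly in $z\in\mathbb R$.
   Context: Fix an integer $d\ge2$. $\Omega$ is the set of pairs $(\mathbf a,\mathbf p)$, $\mathbf a=(a_1,\dots,a_{d+1})\in\mathbb R^{d+1}$, $\mathbf p=(p_1,\dots,p_{d+1})\in\mathbb R^{d+1}$, with $p_i>0$, $\sum_i p_i=1$, $\sum_i p_ia_i=0$. For $(\mathbf a,\mathbf p)\in\Omega$, $X$ is a random variable taking value $a_j$ with probability $p_j$, $\sigma^2$ is its variance, $S_n=X_1+\dots+X_n$ where the $X_j$ are i.i.d. copies of $X$, and $\mathbb P_{\mathbf a,\mathbf p}$ is the corresponding probability. Diophantine condition: let $b_j=a_j-a_1$ for $j=2,\dots,d+1$ and $d(s)=\max_{2\le j\le d+1}\mathrm{dist}(b_js,2\pi\mathbb Z)$. The vector $\mathbf a$ is $\beta$-Diophantine if there is a constant $K>0$ such that $d(s)\ge K|s|^{-\beta}$ for all $|s|>1$. Edgeworth series: $\mathfrak n(y)=\frac1{\sqrt{2\pi}}e^{-y^2/2}$, $\mathfrak N(z)=\int_{-\infty}^z\mathfrak n(y)\,dy$. The order $r$ Edgeworth series of $S_n$ is $\mathcal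 E_r(z)=\mathfrak N(z)+\mathfrak n(z)\sum_{k=1}^r n^{-k/2}P_k(z)$, where the $P_k$ are the polynomials (not depending on $n$) such that, with $\phi(t)=\mathbb E(e^{itX})$ and $\hat{\mathcal E}_r(t)=\int e^{itz}\,d\mathcal E_r(z)$, one has $\phi\left(\frac{t}{\sigma\sqrt n}\right)^n-\hat{\mathcal E}_r(t)=o(n^{-r/2})$ as $n\to\infty$ for each $t$. *)

theory Defs
  imports "HOL-Probability.Probability" "HOL-Computational_Algebra.Polynomial"
    "HOL-Library.Landau_Symbols"
begin

text \<open>A vector of \<open>\<real>\<^sup>d\<^sup>+\<^sup>1\<close> is a function on \<open>nat\<close> of which only the values on \<open>{1..d+1}\<close> are used.\<close>

definition Omega :: "nat \<Rightarrow> ((nat \<Rightarrow> real) \<times> (nat \<Rightarrow> real)) set" where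
  "Omega d = {(a, p). (\<forall>i\<in>{1..d+1}. p i > 0) \<and> (\<Sum>i=1..d+1. p i) = 1 \<and> (\<Sum>i=1..d+1. p i * a i) = 0}"

text \<open>The \<open>a j\<close> need not be distinct: as a pushforward, the law adds up the weights of equal values.\<close>

definition step_law :: "nat \<Rightarrow> (nat \<Rightarrow> real) \<Rightarrow> (nat \<Rightarrow> real) \<Rightarrow> real measure" where
  "step_law d a p = distr (point_measure {1..d+1} (\<lambda>j. ennreal (p j))) borel a"

definition dioph_dist :: "nat \<Rightarrow> (nat \<Rightarrow> real) \<Rightarrow> real \<Rightarrow> real" where
  "dioph_dist d a s =
     (MAX j\<in>{2..d+1}. infdist ((a j - a 1) * s) (range (\<lambda>k::int. 2 * pi * of_int k)))"

definition diophantine :: "nat \<Rightarrow> real \<Rightarrow> (nat \<Rightarrow> real) \<Rightarrow> bool" where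
  "diophantine d \<beta> a \<longleftrightarrow>
     (\<exists>K>0. \<forall>s. \<bar>s\<bar> > 1 \<longrightarrow> dioph_dist d a s \<ge> K * \<bar>s\<bar> powr (- \<beta>))"

definition std_dev :: "real measure \<Rightarrow> real" where
  "std_dev \<mu> = sqrt (prob_space.variance \<mu> (\<lambda>x. x))"

definition normal_cdf :: "real \<Rightarrow> real" where
  "normal_cdf z = (LBINT y:{..z}. std_normal_density y)"

definition edgeworth_of :: "(nat \<Rightarrow> real poly) \<Rightarrow> nat \<Rightarrow> nat \<Rightarrow> real \<Rightarrow> real" where
  "edgeworth_of P r n z =
     normal_cdf z + std_normal_density z * (\<Sum>k=1..r. real n powr (- real k / 2) * poly (P k) z)"

text \<open>The Fourier--Stieltjes transform \<open>\<integral> e\<^sup>i\<^sup>t\<^sup>z dF(z)\<close> of a smooth function \<open>F\<close> with integrable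
  derivative. As \<open>F\<close> need not be monotone, \<open>dF\<close> is in general a signed measure; it has the
  density \<open>F'\<close>.\<close>

definition fourier_stieltjes :: "(real \<Rightarrow> real) \<Rightarrow> real \<Rightarrow> complex" where
  "fourier_stieltjes F t = (CLBINT z. iexp (t * z) * complex_of_real (deriv F z))"

definition edgeworth_expansion :: "real measure \<Rightarrow> nat \<Rightarrow> (nat \<Rightarrow> real poly) \<Rightarrow> bool" where
  "edgeworth_expansion \<mu> r P \<longleftrightarrow>
     (\<forall>t. (\<lambda>n. norm (char \<mu> (t / (std_dev \<mu> * sqrt (real n))) ^ n
                     - fourier_stieltjes (edgeworth_of P r n) t))
          \<in> o(\<lambda>n. real n powr (- real r / 2)))"

text \<open>The expansion only constrains \<open>P 1, \<dots>, P r\<close>; the condition outside \<open>{1..r}\<close> makes \<open>P\<close> unique.\<close>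

definition edgeworth_polys :: "real measure \<Rightarrow> nat \<Rightarrow> nat \<Rightarrow> real poly" where
  "edgeworth_polys \<mu> r = (THE P. edgeworth_expansion \<mu> r P \<and> (\<forall>k. k \<notin> {1..r} \<longrightarrow> P k = 0))"

definition edgeworth :: "real measure \<Rightarrow> nat \<Rightarrow> nat \<Rightarrow> real \<Rightarrow> real" where
  "edgeworth \<mu> r = edgeworth_of (edgeworth_polys \<mu> r) r"

end

theory Submission
  imports Defs "HOL-Complex_Analysis.Complex_Analysis" "HOL-Real_Asymp.Real_Asymp"
    "HOL-Analysis.Kronecker_Approximation_Theorem"
begin

text \<open>Esseen's smoothing inequality bounds the error by \<open>n powr (- R')\<close>, for a cut-off
  \<open>T = n powr R'\<close> with \<open>R' > max R (1/2)\<close> and still \<open>2 * (R' - 1/2) * \<beta> < 1\<close>, plus the integral over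
  \<open>\<bar>t\<bar> \<le> T\<close> of the difference of the Fourier transforms divided by \<open>\<bar>t\<bar>\<close>. For \<open>\<bar>t\<bar> \<le> \<delta> * sqrt n\<close> the characteristic
  function is the exponential of a holomorphic function, and its Taylor expansion both produces the
  Edgeworth polynomials (through Hermite polynomials) and gives an error of order \<open>n powr (- d / 2)\<close>. For larger
  \<open>\<bar>t\<bar>\<close> the Diophantine condition makes the characteristic function at most
  \<open>exp (- c * n powr \<epsilon>)\<close> with \<open>\<epsilon> = 1 - 2 * (R' - 1/2) * \<beta> > 0\<close>. Finally \<open>R < d / 2\<close>, because Dirichlet's theorem on
  simultaneous approximation forces \<open>(d - 1) * \<beta> \<ge> 1\<close>.\<close>

subsection \<open>The Fejer kernel and Esseen's smoothing inequality\<close>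

text \<open>The law of the normalised sum is discrete, so its characteristic function does not decay
  at infinity and only a band \<open>\<bar>t\<bar> \<le> T\<close> can be controlled; the rest costs
  \<open>m / T\<close>. On this band the unscaled frequency
  \<open>s = t / (\<sigma> * sqrt n)\<close> reaches \<open>n powr (R' - 1/2) / \<sigma>\<close>,
  where \<open>dioph_dist\<close> is only known to exceed a constant times
  \<open>n powr (- (R' - 1/2) * \<beta>)\<close>. As \<open>1 - cos\<close> is quadratic at its
  zeros, each step gains the square of this in the exponent and \<open>n\<close> steps gain order
  \<open>n powr \<epsilon>\<close>: hence the 2 in the hypothesis. That hypothesis reads
  \<open>R < 1/2 + 1 / (2 * \<beta>)\<close>, and with \<open>1 / \<beta> \<le> d - 1\<close> this
  is below \<open>d / 2\<close>, so order \<open>d - 1\<close> of the series is enough. The division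
  by \<open>\<bar>t\<bar>\<close> has to be paid for at the origin: every bound there carries a
  factor \<open>\<bar>t\<bar>\<close>, which is why the auxiliary polynomials have no constant term.
  Since the series is given by a definite description, the constructed expansion can be used only
  after uniqueness is proved.\<close>

definition fejer :: "real \<Rightarrow> real \<Rightarrow> real" where
  "fejer T y = (if y = 0 then T else 2 * (1 - cos (T * y)) / (T * y\<^sup>2))"

lemma fejer_nonneg: "T > 0 \<Longrightarrow> 0 \<le> fejer T y"
  by (auto simp: fejer_def)

lemma fejer_minus: "fejer T (- y) = fejer T y"
  by (simp add: fejer_def)

lemma fejer_le_inverse_square:
  assumes "T > 0" "y \<noteq> 0"
  shows "fejer T y \<le> 4 / (T * y\<^sup>2)"
proof -
  have "2 * (1 - cos (T * y)) \<le> 4"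
    by (smt (verit) cos_ge_minus_one)
  then show ?thesis using assms by (simp add: fejer_def divide_right_mono)
qed

lemma fejer_le: "T > 0 \<Longrightarrow> fejer T y \<le> T"
proof (cases "y = 0")
  case False assume T: "T > 0"
  have "1 - cos (T * y) = 2 * (sin (T*y/2))\<^sup>2"
    using cos_double_sin[of "T*y/2"] by simp
  also have "(sin (T*y/2))\<^sup>2 \<le> (T*y/2)\<^sup>2"
    using abs_sin_x_le_abs_x[of "T*y/2"] by (metis abs_le_square_iff)
  finally have "2 * (1 - cos (T * y)) \<le> T * (T * y\<^sup>2)" by (simp add: power_mult_distrib power2_eq_square)
  then show ?thesis using False T by (simp add: fejer_def divide_le_eq)
qed (simp add: fejer_def)

lemma fejer_measurable [measurable]: "fejer T \<in> borel_measurable borel"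
  unfolding fejer_def[abs_def] by measurable

lemma fejer_scale: "T > 0 \<Longrightarrow> fejer T y = T * fejer 1 (T * y)"
  by (auto simp: fejer_def field_simps power2_eq_square)

lemma fejer_fourier_has_integral:
  assumes "T > 0"
  shows "((\<lambda>t. of_real (1 - \<bar>t\<bar> / T) * iexp (t * y)) has_integral of_real (fejer T y)) {-T..T}"
proof (cases "y = 0")
  case True
  have 1: "((\<lambda>t. 1 - \<bar>t\<bar> / T) has_integral ((0 + 0\<^sup>2/(2*T)) - (-T + (-T)\<^sup>2/(2*T)))) {-T..0}"
    using assms by (intro fundamental_theorem_of_calculus)
      (auto intro!: derivative_eq_intros simp flip: has_real_derivative_iff_has_vector_derivative simp: field_simps)
  have 2: "((\<lambda>t. 1 - \<bar>t\<bar> / T) has_integral ((T - T\<^sup>2/(2*T)) - (0 - 0\<^sup>2/(2*T)))) {0..T}"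
    using assms by (intro fundamental_theorem_of_calculus)
      (auto intro!: derivative_eq_intros simp flip: has_real_derivative_iff_has_vector_derivative simp: field_simps)
  have "((\<lambda>t. 1 - \<bar>t\<bar> / T) has_integral T) {-T..T}"
    using has_integral_combine[OF _ _ 1 2] assms by (simp add: power2_eq_square)
  then have "((\<lambda>t. complex_of_real (1 - \<bar>t\<bar> / T)) has_integral of_real T) {-T..T}"
    by (rule has_integral_of_real)
  then show ?thesis
    by (simp add: True fejer_def)
next
  case False
  \<comment> \<open>Antiderivative by parts of \<open>(1 - s * t / T) * iexp (t * y)\<close>; the
    sign \<open>s\<close> is -1 on the left half of the triangle and 1 on the right half.\<close>
  let ?F = "\<lambda>s t. (1 - s * of_real t / of_real T) * exp (\<i> * (of_real (t * y))) / (\<i> * y) + s * exp (\<i> * (of_real (t * y))) / (of_real T * (\<i> * y)\<^sup>2)"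
  have D: "(?F s has_vector_derivative (1 - s * of_real t / of_real T) * iexp (t * y)) (at t within A)" for s t A
    using False assms
    by (auto intro!: derivative_eq_intros has_vector_derivative_real_field simp: field_simps power2_eq_square)
  have 1: "((\<lambda>t. of_real (1 - \<bar>t\<bar> / T) * iexp (t * y)) has_integral (?F (-1) 0 - ?F (-1) (-T))) {-T..0}"
    using assms by (intro fundamental_theorem_of_calculus has_vector_derivative_eq_rhs[OF D]) auto
  have 2: "((\<lambda>t. of_real (1 - \<bar>t\<bar> / T) * iexp (t * y)) has_integral (?F 1 T - ?F 1 0)) {0..T}"
    using assms by (intro fundamental_theorem_of_calculus has_vector_derivative_eq_rhs[OF D]) auto
  have "(?F (-1) 0 - ?F (-1) (-T)) + (?F 1 T - ?F 1 0) = fejer T y"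
    using False assms
    by (simp add: fejer_def complex_eq_iff Re_divide Im_divide power2_eq_square Re_exp Im_exp field_simps)
  with has_integral_combine[OF _ _ 1 2] assms show ?thesis by simp
qed

text \<open>The triangle function, whose Fourier transform is the kernel. Its compact support is
  what confines the comparison of characteristic functions to
  \<open>\<bar>t\<bar> \<le> T\<close>.\<close>

definition fejer_hat :: "real \<Rightarrow> real \<Rightarrow> real" where
  "fejer_hat T t = max 0 (1 - \<bar>t\<bar> / T)"

lemma fejer_hat_eq: "T > 0 \<Longrightarrow> fejer_hat T t = indicator {-T..T} t * (1 - \<bar>t\<bar> / T)"
  by (auto simp: fejer_hat_def indicator_def max_def field_simps abs_le_iff)

lemma fejer_hat_nonneg: "0 \<le> fejer_hat T t"
  by (simp add: fejer_hat_def)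

lemma fejer_hat_le: "T > 0 \<Longrightarrow> fejer_hat T t \<le> indicator {-T..T} t"
  by (auto simp: fejer_hat_def indicator_def max_def field_simps abs_le_iff)

lemma fejer_hat_measurable [measurable]: "fejer_hat T \<in> borel_measurable borel"
  unfolding fejer_hat_def[abs_def] by measurable

lemma fejer_hat_integrable: "T > 0 \<Longrightarrow> integrable lborel (fejer_hat T)"
  by (rule Bochner_Integration.integrable_bound[of _ "indicator {-T..T}"])
     (use fejer_hat_le fejer_hat_nonneg in auto)

lemma fejer_fourier:
  assumes "T > 0"
  shows "(CLBINT t. of_real (fejer_hat T t) * iexp (t * y)) = of_real (fejer T y)"
proof -
  have *: "set_integrable lborel {-T..T} (\<lambda>t. of_real (1 - \<bar>t\<bar> / T) * iexp (t * y))"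
    by (intro borel_integrable_atLeastAtMost' continuous_intros) (use assms in auto)
  have "(CLBINT t:{-T..T}. of_real (1 - \<bar>t\<bar> / T) * iexp (t * y)) = of_real (fejer T y)"
    using set_borel_integral_eq_integral(2)[OF *] fejer_fourier_has_integral[OF assms, of y]
    by (simp add: integral_unique)
  then show ?thesis
    by (simp add: set_lebesgue_integral_def fejer_hat_eq[OF assms] scaleR_conv_of_real of_real_indicator mult.assoc)
qed

text \<open>Adding the bound \<open>T\<close>, useful near 0, to the bound \<open>4 / T\<close> for
  \<open>y\<^sup>2 * fejer T y\<close>, useful far out, gives a multiple of
  \<open>1 / (1 + y\<^sup>2)\<close> as majorant.\<close>

lemma fejer_integrable:
  assumes "T > 0"
  shows "integrable lborel (fejer T)"
proof (rule Bochner_Integration.integrable_bound)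
  show "integrable lborel (\<lambda>y. (T + 4 / T) * inverse (1 + y\<^sup>2))"
    using integrable_inverse_1_plus_square by (simp add: set_integrable_def)
  have "(1 + y\<^sup>2) * fejer T y \<le> T + 4 / T" for y
  proof (cases "y = 0")
    case False
    have "y\<^sup>2 * fejer T y \<le> y\<^sup>2 * (4 / (T * y\<^sup>2))"
      using fejer_le_inverse_square[OF assms False] by (intro mult_left_mono) auto
    also have "\<dots> = 4 / T" using False by simp
    finally show ?thesis using fejer_le[OF assms, of y] by (simp add: algebra_simps)
  qed (use assms in \<open>simp add: fejer_def\<close>)
  then have "fejer T y \<le> (T + 4 / T) * inverse (1 + y\<^sup>2)" for y
    by (simp add: field_simps add_pos_nonneg)
  then show "AE y in lborel. norm (fejer T y) \<le> norm ((T + 4 / T) * inverse (1 + y\<^sup>2))"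
    using fejer_nonneg[OF assms] by (auto intro!: AE_I2 order_trans[OF _ abs_ge_self])
qed measurable

section \<open>Exchanging the kernel, its Fourier integral and a measure by Fubini\<close>

lemma (in pair_sigma_finite) integrable_pair_bound_product:
  fixes f :: "'a \<times> 'b \<Rightarrow> 'c::{banach, second_countable_topology}" and g h :: "_ \<Rightarrow> real"
  assumes f[measurable]: "f \<in> borel_measurable (M1 \<Otimes>\<^sub>M M2)"
    and g: "integrable M1 g" and h: "integrable M2 h"
    and bound: "\<And>x y. x \<in> space M1 \<Longrightarrow> y \<in> space M2 \<Longrightarrow> norm (f (x, y)) \<le> g x * h y"
  shows "integrable (M1 \<Otimes>\<^sub>M M2) f"
proof (rule Fubini_integrable)
  have int: "integrable M2 (\<lambda>y. f (x, y))" if "x \<in> space M1" for x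
    by (rule Bochner_Integration.integrable_bound[OF integrable_mult_right[OF h, of "g x"]])
       (use that bound[OF that] in \<open>auto intro!: AE_I2 order_trans[OF _ abs_ge_self]\<close>)
  then show "AE x in M1. integrable M2 (\<lambda>y. f (x, y))" by auto
  have "(\<integral>y. norm (f (x, y)) \<partial>M2) \<le> g x * (\<integral>y. h y \<partial>M2)" if "x \<in> space M1" for x
  proof -
    have "(\<integral>y. norm (f (x, y)) \<partial>M2) \<le> (\<integral>y. g x * h y \<partial>M2)"
      using int[OF that] h bound[OF that] by (intro integral_mono) auto
    then show ?thesis by simp
  qed
  then show "integrable M1 (\<lambda>x. \<integral>y. norm (f (x, y)) \<partial>M2)"
    by (intro Bochner_Integration.integrable_bound[OF integrable_mult_left[OF g, of "\<integral>y. h y \<partial>M2"]])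
       (auto intro!: AE_I2 order_trans[OF _ abs_ge_self])
qed measurable

definition interval_transform :: "real \<Rightarrow> real \<Rightarrow> real \<Rightarrow> complex" where
  "interval_transform a b t = (CLBINT v:{a<..b}. iexp (- (t * v)))"

text \<open>The antiderivative of the exponential has modulus \<open>1 / \<bar>t\<bar>\<close> at
  each end point. The bound is independent of the interval, so the left end point may later go to
  minus infinity.\<close>

lemma interval_transform_bound:
  assumes "a \<le> b" "t \<noteq> 0"
  shows "norm (interval_transform a b t) \<le> 2 / \<bar>t\<bar>"
proof -
  let ?F = "\<lambda>v::real. \<i> / t * iexp (- (t * v))"
  have "interval_transform a b t = (CLBINT v=a..b. iexp (- (t * v)))"
    using assms by (simp add: interval_transform_def interval_integral_Ioc)
  also have "\<dots> = ?F b - ?F a"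
    using assms
    by (intro interval_integral_FTC_finite continuous_intros)
       (auto intro!: derivative_eq_intros has_vector_derivative_real_field)
  also have "norm \<dots> \<le> norm (?F b) + norm (?F a)" by (rule norm_triangle_ineq4)
  also have "\<dots> = 2 / \<bar>t\<bar>" by (simp add: norm_mult norm_divide)
  finally show ?thesis .
qed

text \<open>Formulated for a measure \<open>N\<close> with weight \<open>h\<close> so that it covers
  both sides of the comparison: a law with \<open>h = 1\<close> and Lebesgue measure with a density.
  The kernel is replaced by its Fourier integral over a compact range and the integrals are
  exchanged, so no inversion theorem enters. The integrability claims allow the two instances to be
  subtracted.\<close>

lemma fejer_smoothing_identity:
  fixes h :: "real \<Rightarrow> real"
  assumes T: "T > 0" and "sigma_finite_measure N" and [measurable_cong]: "sets N = sets borel"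
    and h: "integrable N h" and ab: "a \<le> b"
  shows "integrable lborel (\<lambda>y. fejer T y * (\<integral>w. indicator {a-y<..b-y} w * h w \<partial>N))"
    and "integrable lborel (\<lambda>t. of_real (fejer_hat T t) * interval_transform a b t
           * (\<integral>w. iexp (t * w) * of_real (h w) \<partial>N))"
    and "of_real (\<integral>y. fejer T y * (\<integral>w. indicator {a-y<..b-y} w * h w \<partial>N) \<partial>lborel)
      = (CLBINT t. of_real (fejer_hat T t) * interval_transform a b t
           * (\<integral>w. iexp (t * w) * of_real (h w) \<partial>N))"
proof -
  interpret N: sigma_finite_measure N by fact
  interpret P: pair_sigma_finite lborel N ..
  have [measurable]: "h \<in> borel_measurable borel"
    using h borel_measurable_integrable measurable_cong_sets[OF assms(3) refl] by blast
  have ind: "indicator {a-y<..b-y} w = (indicator {a<..b} (y + w) :: real)" for y w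
    by (auto simp: indicator_def)
  have int1: "integrable (lborel \<Otimes>\<^sub>M N) (\<lambda>(y, w). fejer T y * (indicator {a<..b} (y + w) * h w))"
    by (rule P.integrable_pair_bound_product[of _ "fejer T" "\<lambda>w. norm (h w)"])
       (use fejer_integrable[OF T] h fejer_nonneg[OF T] in \<open>auto simp: abs_mult indicator_def\<close>)
  have eq1: "(\<integral>y. fejer T y * (\<integral>w. indicator {a-y<..b-y} w * h w \<partial>N) \<partial>lborel)
      = (\<integral>w. (\<integral>y. fejer T y * indicator {a<..b} (y + w) \<partial>lborel) * h w \<partial>N)"
    using P.Fubini_integral[OF int1] by (simp add: ind mult.assoc[symmetric] del: integral_mult_right_zero)
       (simp add: mult.assoc)
  show "integrable lborel (\<lambda>y. fejer T y * (\<integral>w. indicator {a-y<..b-y} w * h w \<partial>N))"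
    using P.integrable_fst[OF int1] by (simp add: ind)
  have iab: "integrable lborel (indicator {a<..b} :: real \<Rightarrow> real)"
    using ab by (simp add: emeasure_lborel_Ioc)
  have kappa: "interval_transform a b t = (CLBINT v. of_real (indicator {a<..b} v) * iexp (- (t * v)))" for t
    by (simp add: interval_transform_def set_lebesgue_integral_def scaleR_conv_of_real)
  have [measurable]: "(\<lambda>t. interval_transform a b t) \<in> borel_measurable borel"
    unfolding kappa by measurable
  \<comment> \<open>Near \<open>t = 0\<close> the bound \<open>2 / \<bar>t\<bar>\<close> is not
    integrable; the length of the interval serves for Fubini instead.\<close>
  have kb: "norm (interval_transform a b t) \<le> b - a" for t
  proof -
    have "norm (interval_transform a b t) \<le> (\<integral>v. norm (of_real (indicator {a<..b} v) * iexp (- (t * v))) \<partial>lborel)"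
      unfolding kappa by (rule integral_norm_bound)
    also have "\<dots> = b - a" using ab by (simp add: norm_mult)
    finally show ?thesis .
  qed
  \<comment> \<open>After a shift and by evenness of the kernel, the left side is the convolution of
    the kernel with the indicator of the interval, taken at \<open>w\<close>; the Fourier integral
    separates \<open>w\<close> from \<open>v\<close>.\<close>
  have eq2: "of_real (\<integral>y. fejer T y * indicator {a<..b} (y + w) \<partial>lborel)
     = (CLBINT t. of_real (fejer_hat T t) * interval_transform a b t * iexp (t * w))" for w
  proof -
    have "(\<integral>y. fejer T y * indicator {a<..b} (y + w) \<partial>lborel) = (\<integral>v. fejer T (w - v) * indicator {a<..b} v \<partial>lborel)"
      by (subst lborel_integral_real_affine[where c=1 and t="-w"])
         (auto simp: fejer_minus[of T "w - _", symmetric])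
    then have "of_real (\<integral>y. fejer T y * indicator {a<..b} (y + w) \<partial>lborel)
      = (CLBINT v. (CLBINT t. of_real (fejer_hat T t) * iexp (t * (w - v))) * of_real (indicator {a<..b} v))"
      by (simp add: fejer_fourier[OF T] flip: of_real_mult integral_complex_of_real)
    also have "\<dots> = (CLBINT v. (CLBINT t. of_real (indicator {a<..b} v) * (of_real (fejer_hat T t) * iexp (t * (w - v)))))"
      by (simp add: mult.commute)
    also have "\<dots> = (CLBINT t. (CLBINT v. of_real (indicator {a<..b} v) * (of_real (fejer_hat T t) * iexp (t * (w - v)))))"
      by (rule lborel_pair.Fubini_integral, rule lborel_pair.integrable_pair_bound_product[of _ "fejer_hat T" "indicator {a<..b}"])
         (use fejer_hat_integrable[OF T] iab fejer_hat_nonneg in \<open>auto simp: norm_mult mult.commute\<close>)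
    also have "\<dots> = (CLBINT t. of_real (fejer_hat T t) * interval_transform a b t * iexp (t * w))"
    proof (intro Bochner_Integration.integral_cong refl)
      fix t
      have "(CLBINT v. of_real (indicator {a<..b} v) * (of_real (fejer_hat T t) * iexp (t * (w - v))))
        = (CLBINT v. of_real (fejer_hat T t) * iexp (t * w) * (of_real (indicator {a<..b} v) * iexp (- (t * v))))"
        by (intro Bochner_Integration.integral_cong refl)
           (simp add: algebra_simps exp_diff exp_minus divide_inverse)
      also have "\<dots> = of_real (fejer_hat T t) * iexp (t * w) * interval_transform a b t"
        unfolding kappa by (rule integral_mult_right_zero)
      finally show "(CLBINT v. of_real (indicator {a<..b} v) * (of_real (fejer_hat T t) * iexp (t * (w - v))))
        = of_real (fejer_hat T t) * interval_transform a b t * iexp (t * w)"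
        by (simp only: mult_ac)
    qed
    finally show ?thesis .
  qed
  have kb': "fejer_hat T t * norm (interval_transform a b t) \<le> (b - a) * fejer_hat T t" for t
    by (subst mult.commute) (intro mult_right_mono kb fejer_hat_nonneg)
  have int3: "integrable (lborel \<Otimes>\<^sub>M N) (\<lambda>(t, w). of_real (fejer_hat T t) * interval_transform a b t * (iexp (t * w) * of_real (h w)))"
    by (rule P.integrable_pair_bound_product[of _ "\<lambda>t. (b - a) * fejer_hat T t" "\<lambda>w. norm (h w)"])
       (use fejer_hat_integrable[OF T] h fejer_hat_nonneg kb' in \<open>auto simp: norm_mult mult.assoc[symmetric] intro!: mult_right_mono\<close>)
  show "integrable lborel (\<lambda>t. of_real (fejer_hat T t) * interval_transform a b t
           * (\<integral>w. iexp (t * w) * of_real (h w) \<partial>N))"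
    using P.integrable_fst[OF int3] by simp
  have "of_real (\<integral>w. (\<integral>y. fejer T y * indicator {a<..b} (y + w) \<partial>lborel) * h w \<partial>N)
     = (\<integral>w. (CLBINT t. of_real (fejer_hat T t) * interval_transform a b t * iexp (t * w)) * of_real (h w) \<partial>N)"
    by (simp add: eq2[symmetric] flip: of_real_mult)
  also have "\<dots> = (\<integral>w. (CLBINT t. of_real (fejer_hat T t) * interval_transform a b t * (iexp (t * w) * of_real (h w))) \<partial>N)"
    by (simp add: mult.assoc flip: integral_mult_left_zero)
  also have "\<dots> = (CLBINT t. of_real (fejer_hat T t) * interval_transform a b t
           * (\<integral>w. iexp (t * w) * of_real (h w) \<partial>N))"
    by (subst P.Fubini_integral[OF int3]) simp
  finally show "of_real (\<integral>y. fejer T y * (\<integral>w. indicator {a-y<..b-y} w * h w \<partial>N) \<partial>lborel)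
      = (CLBINT t. of_real (fejer_hat T t) * interval_transform a b t
           * (\<integral>w. iexp (t * w) * of_real (h w) \<partial>N))"
    unfolding eq1 .
qed

section \<open>Mass and tails of the kernel, and undoing the smoothing\<close>

lemma fejer_integral_scale:
  fixes f :: "real \<Rightarrow> real"
  assumes "T > 0"
  shows "(\<integral>y. fejer T y * f (T * y) \<partial>lborel) = (\<integral>y. fejer 1 y * f y \<partial>lborel)"
  using lborel_integral_real_affine[of T "\<lambda>y. fejer 1 y * f y" 0] assms fejer_scale[OF assms]
  by (simp add: mult.assoc)

text \<open>The mass enters the constants only as a denominator. On \<open>{1..2}\<close> the kernel
  is strictly positive because \<open>cos y < 1\<close> for \<open>0 < y \<le> pi\<close>.\<close>

lemma fejer_mass_pos: "(\<integral>y. fejer 1 y \<partial>lborel) > 0"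
proof -
  have "fejer 1 y > 0" if "y \<in> {1..2}" for y
  proof -
    have "cos y < cos 0" using that pi_gt3 by (intro cos_monotone_0_pi) auto
    then show ?thesis using that by (simp add: fejer_def)
  qed
  then have "{1..2::real} \<subseteq> {y. fejer 1 y \<noteq> 0}" by fastforce
  then have "emeasure lborel {1..2::real} \<le> emeasure lborel {y\<in>space lborel. fejer 1 y \<noteq> 0}"
    by (intro emeasure_mono) auto
  then have "emeasure lborel {y\<in>space lborel. fejer 1 y \<noteq> 0} \<noteq> 0"
    by (auto simp: not_le)
  then have "(\<integral>y. fejer 1 y \<partial>lborel) \<noteq> 0"
    using fejer_integrable[of 1] fejer_nonneg[of 1]
    by (subst integral_nonneg_eq_0_iff_AE) (auto simp: AE_iff_measurable[OF _ refl])
  moreover have "(\<integral>y. fejer 1 y \<partial>lborel) \<ge> 0"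
    using fejer_nonneg[of 1] by (intro integral_nonneg_AE) auto
  ultimately show ?thesis by simp
qed

lemma fejer_tail:
  assumes "\<epsilon> > 0"
  obtains H where "H > 0" "(\<integral>y. fejer 1 y * indicator {y. \<bar>y\<bar> > H} y \<partial>lborel) \<le> \<epsilon>"
proof -
  have "(\<lambda>n. \<integral>y. fejer 1 y * indicator {y. \<bar>y\<bar> > real n} y \<partial>lborel) \<longlonglongrightarrow> (\<integral>y. 0 \<partial>(lborel :: real measure))"
  proof (rule integral_dominated_convergence[where w="fejer 1"])
    show "AE y in lborel. (\<lambda>n. fejer 1 y * indicator {y. \<bar>y\<bar> > real n} y) \<longlonglongrightarrow> 0"
    proof (intro AE_I2)
      fix y :: real
      have "\<forall>\<^sub>F n in sequentially. real n > \<bar>y\<bar>"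
        using filterlim_at_top_dense filterlim_real_sequentially by blast
      then have "\<forall>\<^sub>F n in sequentially. fejer 1 y * indicator {y. \<bar>y\<bar> > real n} y = 0"
        by eventually_elim auto
      then show "(\<lambda>n. fejer 1 y * indicator {y. \<bar>y\<bar> > real n} y) \<longlonglongrightarrow> 0"
        by (rule tendsto_eventually)
    qed
  qed (use fejer_integrable[of 1] fejer_nonneg[of 1] in \<open>auto simp: indicator_def\<close>)
  then have "\<forall>\<^sub>F n in sequentially. (\<integral>y. fejer 1 y * indicator {y. \<bar>y\<bar> > real n} y \<partial>lborel) < \<epsilon>"
    using assms by (intro order_tendstoD(2)[where y=0]) auto
  then have "\<forall>\<^sub>F n in sequentially. (\<integral>y. fejer 1 y * indicator {y. \<bar>y\<bar> > real n} y \<partial>lborel) < \<epsilon> \<and> n > 0"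
    by (intro eventually_conj eventually_gt_at_top)
  then obtain n where "(\<integral>y. fejer 1 y * indicator {y. \<bar>y\<bar> > real n} y \<partial>lborel) < \<epsilon>" "n > 0"
    using eventually_happens'[OF sequentially_bot] by blast
  then show thesis using that[of "real n"] by simp
qed

text \<open>\<open>D\<close> stays above \<open>c / 2\<close> on the window of radius \<open>h = c / (4 * m)\<close> around \<open>x0 + h\<close>, which carries most
  of the mass of the kernel unless \<open>c\<close> is already of order \<open>m / T\<close>.\<close>

lemma fejer_deconvolution:
  fixes D :: "real \<Rightarrow> real" and T m c \<eta> J x0 H :: real
  defines "I \<equiv> \<integral>y. fejer 1 y \<partial>lborel"
  assumes H: "H > 0" "(\<integral>y. fejer 1 y * indicator {y. \<bar>y\<bar> > H} y \<partial>lborel) \<le> I / 8"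
    and [measurable]: "D \<in> borel_measurable borel" and T: "T > 0" and m: "m > 0"
    and c: "c > 0" and \<eta>: "\<eta> \<le> 2 * c"
    and D: "\<And>x. \<bar>D x\<bar> \<le> \<eta>" and D0: "\<And>s. s \<ge> 0 \<Longrightarrow> D (x0 + s) \<ge> c - m * s"
    and J: "\<And>x. (\<integral>y. fejer T y * D (x - y) \<partial>lborel) \<le> J" and J0: "J \<ge> 0"
  shows "\<eta> \<le> (11 / I + 8 * H) * (J + m / T)"
proof -
  define C where "C = 11 / I + 8 * H"
  have I: "I > 0" unfolding I_def by (rule fejer_mass_pos)
  have mT: "m / T \<ge> 0" using m T by simp
  have "\<eta> \<le> C * (J + m / T)"
  \<comment> \<open>If this fails, the rescaled window has radius below \<open>H\<close> and no
    guaranteed share of the mass; but then \<open>c \<le> 4 * H * m / T\<close>, which is the source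
    of \<open>8 * H\<close>.\<close>
  proof (cases "T * (c / (4 * m)) \<ge> H")
    case False
    then have "c \<le> 4 * H * (m / T)" using T m by (simp add: field_simps)
    then have "\<eta> \<le> 8 * H * (m / T)" using \<eta> by simp
    also have "\<dots> \<le> C * (J + m / T)"
      using mT J0 I H by (intro mult_mono) (auto simp: C_def)
    finally show ?thesis .
  next
    case True
    define h where "h = c / (4 * m)"
    have h: "h > 0" using c m by (simp add: h_def)
    let ?i = "\<lambda>y. indicator {y. \<bar>y\<bar> > h} y :: real"
    have int_i: "integrable lborel (\<lambda>y. fejer T y * ?i y)"
      by (rule Bochner_Integration.integrable_bound[OF fejer_integrable[OF T]]) (auto simp: indicator_def)
    have \<eta>0: "\<eta> \<ge> 0" using D[of 0] by simp
    have int_D: "integrable lborel (\<lambda>y. fejer T y * D (x0 + h - y))"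
      by (rule Bochner_Integration.integrable_bound[OF integrable_mult_right[OF fejer_integrable[OF T], of \<eta>]])
         (use D \<eta>0 in \<open>auto simp: abs_mult mult.commute[of \<eta>] intro!: mult_left_mono AE_I2\<close>)
    \<comment> \<open>For \<open>\<bar>y\<bar> \<le> h\<close> the argument lies between
      \<open>x0\<close> and \<open>x0 + 2 * h\<close>, where \<open>D\<close> has lost at most
      \<open>2 * m * h = c / 2\<close>. Elsewhere only \<open>D \<ge> - \<eta>\<close> is known. The
      indicator merges both cases.\<close>
    have pw: "fejer T y * (c / 2) - (c / 2 + \<eta>) * (fejer T y * ?i y) \<le> fejer T y * D (x0 + h - y)" for y
    proof -
      have "c / 2 - (c / 2 + \<eta>) * ?i y \<le> D (x0 + h - y)"
      proof (cases "\<bar>y\<bar> > h")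
        case True then show ?thesis using D[of "x0 + h - y"] by (simp add: abs_le_iff)
      next
        case False
        then have "c - m * (h - y) \<le> D (x0 + (h - y))" by (intro D0) auto
        moreover have "m * (h - y) \<le> m * (2 * h)" using m False by (intro mult_left_mono) auto
        moreover have "m * (2 * h) = c / 2" using m by (simp add: h_def)
        ultimately show ?thesis using False by (simp add: algebra_simps)
      qed
      from mult_left_mono[OF this fejer_nonneg[OF T, of y]] show ?thesis by (simp add: algebra_simps)
    qed
    have mass: "(\<integral>y. fejer T y \<partial>lborel) = I"
      using fejer_integral_scale[OF T, of "\<lambda>_. 1"] by (simp add: I_def)
    have "(\<integral>y. fejer T y * ?i y \<partial>lborel) = (\<integral>y. fejer T y * indicator {y. \<bar>y\<bar> > T * h} (T * y) \<partial>lborel)"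
      using T by (intro Bochner_Integration.integral_cong) (auto simp: indicator_def abs_mult)
    also have "\<dots> = (\<integral>y. fejer 1 y * indicator {y. \<bar>y\<bar> > T * h} y \<partial>lborel)"
      by (rule fejer_integral_scale[OF T])
    also have "\<dots> \<le> (\<integral>y. fejer 1 y * indicator {y. \<bar>y\<bar> > H} y \<partial>lborel)"
      using True fejer_nonneg[of 1]
      by (intro integral_mono integrable_real_mult_indicator fejer_integrable)
         (auto simp: indicator_def h_def)
    also have "\<dots> \<le> I / 8" by (rule H)
    finally have tail: "(\<integral>y. fejer T y * ?i y \<partial>lborel) \<le> I / 8" .
    have "I * (c / 2) - (c / 2 + \<eta>) * (I / 8) \<le> I * (c / 2) - (c / 2 + \<eta>) * (\<integral>y. fejer T y * ?i y \<partial>lborel)"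
      using tail c \<eta>0 by (intro diff_left_mono mult_left_mono) auto
    also have "\<dots> = (\<integral>y. fejer T y * (c / 2) - (c / 2 + \<eta>) * (fejer T y * ?i y) \<partial>lborel)"
      using int_i fejer_integrable[OF T] by (simp add: mass)
    also have "\<dots> \<le> (\<integral>y. fejer T y * D (x0 + h - y) \<partial>lborel)"
      using int_i int_D fejer_integrable[OF T] pw by (intro integral_mono) auto
    also have "\<dots> \<le> J" by (rule J)
    finally have "I * (c / 2) - (c / 2 + \<eta>) * (I / 8) \<le> J" .
    \<comment> \<open>With \<open>\<eta> \<le> 2 * c\<close> the tail costs at most
      \<open>5/2 * c\<close> on an eighth of the mass, so \<open>1/2 - 5/16 = 3/16\<close> remains.
      Hence \<open>\<eta> \<le> 32/3 * J / I\<close>, and 11 rounds up 32/3.\<close>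
    moreover have "(c / 2 + \<eta>) * (I / 8) \<le> (c / 2 + 2 * c) * (I / 8)"
      using \<eta> I by (intro mult_right_mono) auto
    moreover have "I * (c / 2) - (c / 2 + 2 * c) * (I / 8) = I * c * (3 / 16)" by (simp add: field_simps)
    ultimately have "I * c * (3 / 16) \<le> J" by linarith
    then have "c \<le> 16 / 3 * J / I" using I by (simp add: field_simps)
    then have "\<eta> \<le> 32 / 3 * J / I" using \<eta> by simp
    also have "\<dots> \<le> 11 / I * J" using divide_right_mono[of "32 / 3 * J" "11 * J" I] I J0 by simp
    also have "\<dots> \<le> C * (J + m / T)"
      using mT J0 I H by (intro mult_mono) (auto simp: C_def)
    finally show ?thesis .
  qed
  then show ?thesis by (simp only: C_def)
qed

text \<open>Letting the base point \<open>a\<close> tend to \<open>-\<infinity>\<close> in the smoothing identity loses a factor 2 but makes the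
  Riemann--Lebesgue lemma superfluous.\<close>

lemma fejer_smoothed_difference_bound:
  fixes g G :: "real \<Rightarrow> real"
  assumes T: "T > 0" and mu: "real_distribution \<mu>" and g: "integrable lborel g"
    and G: "\<And>x. G x = (LBINT w:{..x}. g w)"
    and B: "set_integrable lborel {-T..T} B" and B_nonneg: "\<And>t. B t \<ge> 0"
    and bound: "\<And>t. \<bar>t\<bar> \<le> T \<Longrightarrow> norm (char \<mu> t - (CLBINT w. iexp (t * w) * of_real (g w))) \<le> \<bar>t\<bar> * B t"
    and [measurable]: "G \<in> borel_measurable borel" and G_bound: "\<And>x. \<bar>G x\<bar> \<le> \<eta>"
  shows "\<bar>\<integral>y. fejer T y * (cdf \<mu> (b - y) - G (b - y)) \<partial>lborel\<bar> \<le> 2 * (LBINT t:{-T..T}. B t)"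
proof -
  interpret real_distribution \<mu> by fact
  let ?D = "\<lambda>x. cdf \<mu> x - G x"
  have [measurable]: "cdf \<mu> \<in> borel_measurable borel"
    by (intro borel_measurable_mono monoI cdf_nondecreasing)
  have [measurable]: "g \<in> borel_measurable borel" using g by auto
  have D_bound: "\<bar>?D x\<bar> \<le> 1 + \<eta>" for x
    using cdf_nonneg[of x] cdf_bounded_prob[of x] G_bound[of x] by linarith
  have \<eta>: "\<eta> \<ge> 0" using G_bound[of 0] by simp
  have int_D: "integrable lborel (\<lambda>y. fejer T y * ?D (x - y))" for x
    by (rule Bochner_Integration.integrable_bound[OF integrable_mult_right[OF fejer_integrable[OF T], of "1 + \<eta>"]])
       (use D_bound \<eta> in \<open>auto simp: abs_mult mult.commute[of "1 + \<eta>"] intro!: mult_left_mono AE_I2\<close>)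
  have diff: "\<bar>(\<integral>y. fejer T y * ?D (b - y) \<partial>lborel) - (\<integral>y. fejer T y * ?D (a - y) \<partial>lborel)\<bar>
      \<le> 2 * (LBINT t:{-T..T}. B t)" if ab: "a \<le> b" for a
  proof -
    have int_ind: "integrable \<mu> (indicator {a - y<..b - y} :: real \<Rightarrow> real)" for y
      by (auto simp: emeasure_eq_measure)
    have gi: "integrable lborel (\<lambda>w. indicator {..x} w *\<^sub>R g w)" for x
      by (rule integrable_mult_indicator) (use g in auto)
    have D_diff: "?D (b - y) - ?D (a - y)
        = (\<integral>w. indicator {a - y<..b - y} w * 1 \<partial>\<mu>) - (\<integral>w. indicator {a - y<..b - y} w * g w \<partial>lborel)" for y
    proof -
      have "(LBINT w:{..b - y}. g w) - (LBINT w:{..a - y}. g w) = (LBINT w:{a - y<..b - y}. g w)"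
        unfolding set_lebesgue_integral_def
        by (subst Bochner_Integration.integral_diff[symmetric, OF gi gi])
           (use ab in \<open>auto intro!: Bochner_Integration.integral_cong simp: indicator_def\<close>)
      moreover have "cdf \<mu> (b - y) - cdf \<mu> (a - y) = measure \<mu> {a - y<..b - y}"
        using cdf_diff_eq[of "a - y" "b - y"] ab by (cases "a = b") auto
      ultimately show ?thesis
        by (simp add: G set_lebesgue_integral_def)
    qed
    note id1 = fejer_smoothing_identity[OF T, of \<mu> "\<lambda>_. 1" a b, OF _ _ _ ab]
    note id2 = fejer_smoothing_identity[OF T, of lborel g a b, OF _ _ g ab]
    have sf: "sigma_finite_measure \<mu>" "sigma_finite_measure (lborel :: real measure)"
      by unfold_locales
    have i1: "integrable \<mu> (\<lambda>_. 1 :: real)" by simp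
    let ?f = "\<lambda>t. char \<mu> t - (CLBINT w. iexp (t * w) * of_real (g w))"
    have "of_real ((\<integral>y. fejer T y * ?D (b - y) \<partial>lborel) - (\<integral>y. fejer T y * ?D (a - y) \<partial>lborel))
      = complex_of_real (\<integral>y. fejer T y * (?D (b - y) - ?D (a - y)) \<partial>lborel)"
      using int_D by (simp add: right_diff_distrib)
    also have "\<dots> = of_real ((\<integral>y. fejer T y * (\<integral>w. indicator {a - y<..b - y} w * 1 \<partial>\<mu>) \<partial>lborel)
         - (\<integral>y. fejer T y * (\<integral>w. indicator {a - y<..b - y} w * g w \<partial>lborel) \<partial>lborel))"
      unfolding D_diff right_diff_distrib
      by (subst Bochner_Integration.integral_diff[OF id1(1)[OF sf(1) _ i1] id2(1)[OF sf(2)]]) auto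
    also have "\<dots> = (CLBINT t. of_real (fejer_hat T t) * interval_transform a b t * ?f t)"
      unfolding of_real_diff id1(3)[OF sf(1) events_eq_borel i1] id2(3)[OF sf(2) sets_lborel]
      by (subst Bochner_Integration.integral_diff[symmetric, OF id1(2)[OF sf(1) events_eq_borel i1] id2(2)[OF sf(2) sets_lborel]])
         (simp add: char_def right_diff_distrib)
    finally have "norm (complex_of_real ((\<integral>y. fejer T y * ?D (b - y) \<partial>lborel) - (\<integral>y. fejer T y * ?D (a - y) \<partial>lborel)))
      = norm (CLBINT t. of_real (fejer_hat T t) * interval_transform a b t * ?f t)"
      by (rule arg_cong)
    then have "\<bar>(\<integral>y. fejer T y * ?D (b - y) \<partial>lborel) - (\<integral>y. fejer T y * ?D (a - y) \<partial>lborel)\<bar>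
      = norm (CLBINT t. of_real (fejer_hat T t) * interval_transform a b t * ?f t)"
      unfolding norm_of_real .
    also have "\<dots> \<le> (\<integral>t. indicator {-T..T} t * (2 * B t) \<partial>lborel)"
    proof (rule Bochner_Integration.integral_norm_bound_integral)
      show "integrable lborel (\<lambda>t. of_real (fejer_hat T t) * interval_transform a b t * ?f t)"
        using Bochner_Integration.integrable_diff[OF id1(2)[OF sf(1) events_eq_borel i1] id2(2)[OF sf(2) sets_lborel]]
        by (simp add: char_def right_diff_distrib)
      show "integrable lborel (\<lambda>t. indicator {-T..T} t * (2 * B t))"
        using integrable_mult_right[OF B[unfolded set_integrable_def], of 2] by (simp add: mult_ac)
      fix t :: real
      show "norm (of_real (fejer_hat T t) * interval_transform a b t * ?f t) \<le> indicator {-T..T} t * (2 * B t)"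
      proof (cases "\<bar>t\<bar> \<le> T")
        case False
        then have "fejer_hat T t = 0" using fejer_hat_le[OF T, of t] fejer_hat_nonneg[of T t]
          by (auto simp: indicator_def abs_le_iff split: if_splits)
        then show ?thesis using False by (auto simp: abs_le_iff)
      next
        case True
        then have i: "indicator {-T..T} t = (1::real)" by (auto simp: abs_le_iff)
        show ?thesis
        \<comment> \<open>At \<open>t = 0\<close>, where \<open>interval_transform_bound\<close>
          says nothing, the factor \<open>\<bar>t\<bar>\<close> in \<open>bound\<close> forces
          \<open>?f t = 0\<close>.\<close>
        proof (cases "t = 0")
          case True then have "?f t = 0" using bound[of 0] T by simp
          then show ?thesis using B_nonneg[of t] by (simp add: \<open>?f t = 0\<close> del: right_minus_eq)
        next
          case False
          have "norm (of_real (fejer_hat T t) * interval_transform a b t * ?f t)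
             \<le> 1 * (2 / \<bar>t\<bar>) * (\<bar>t\<bar> * B t)"
            unfolding norm_mult
            using fejer_hat_le[OF T, of t] fejer_hat_nonneg[of T t] i interval_transform_bound[OF ab False] bound[OF True]
            by (intro mult_mono) auto
          then show ?thesis using False i by simp
        qed
      qed
    qed
    also have "\<dots> = 2 * (LBINT t:{-T..T}. B t)"
      by (simp add: set_lebesgue_integral_def mult.left_commute[of _ 2])
    finally show ?thesis .
  qed
  \<comment> \<open>Both \<open>cdf \<mu>\<close> and \<open>G\<close> vanish at minus infinity, and
    a multiple of the kernel dominates. Since the right side of \<open>diff\<close> does not contain
    \<open>a\<close>, the limit keeps the bound.\<close>
  have "(\<lambda>n. \<integral>y. fejer T y * ?D (- real n - y) \<partial>lborel) \<longlonglongrightarrow> (\<integral>y. 0 \<partial>(lborel :: real measure))"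
  proof (rule integral_dominated_convergence[where w="\<lambda>y. (1 + \<eta>) * fejer T y"])
    show "AE y in lborel. (\<lambda>n. fejer T y * ?D (- real n - y)) \<longlonglongrightarrow> 0"
    proof (intro AE_I2)
      fix y
      have lim: "filterlim (\<lambda>n. - real n - y) at_bot sequentially" by real_asymp
      have "(\<lambda>n. cdf \<mu> (- real n - y)) \<longlonglongrightarrow> 0"
        by (rule filterlim_compose[OF cdf_lim_at_bot lim])
      moreover have "(\<lambda>n. G (- real n - y)) \<longlonglongrightarrow> (\<integral>w. 0 \<partial>(lborel :: real measure))"
        unfolding G set_lebesgue_integral_def
      proof (rule integral_dominated_convergence[where w="\<lambda>w. norm (g w)"])
        show "AE w in lborel. (\<lambda>n. indicator {..- real n - y} w *\<^sub>R g w) \<longlonglongrightarrow> 0"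
        proof (intro AE_I2)
          fix w
          have "\<forall>\<^sub>F n in sequentially. - real n - y < w"
            using lim by (simp add: filterlim_at_bot_dense)
          then have "\<forall>\<^sub>F n in sequentially. indicator {..- real n - y} w *\<^sub>R g w = 0"
            by eventually_elim auto
          then show "(\<lambda>n. indicator {..- real n - y} w *\<^sub>R g w) \<longlonglongrightarrow> 0"
            by (rule tendsto_eventually)
        qed
      qed (use g in \<open>auto simp: indicator_def\<close>)
      ultimately show "(\<lambda>n. fejer T y * ?D (- real n - y)) \<longlonglongrightarrow> 0"
        by (auto intro!: tendsto_eq_intros)
    qed
  qed (use fejer_integrable[OF T] fejer_nonneg[OF T] D_bound in
        \<open>auto simp: abs_mult mult.commute[of "1 + \<eta>"] intro!: mult_left_mono AE_I2\<close>)
  then have "(\<lambda>n. \<bar>(\<integral>y. fejer T y * ?D (b - y) \<partial>lborel) - (\<integral>y. fejer T y * ?D (- real n - y) \<partial>lborel)\<bar>)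
    \<longlonglongrightarrow> \<bar>(\<integral>y. fejer T y * ?D (b - y) \<partial>lborel) - 0\<bar>"
    by (intro tendsto_intros) simp
  moreover have "\<forall>\<^sub>F n in sequentially. \<bar>(\<integral>y. fejer T y * ?D (b - y) \<partial>lborel) - (\<integral>y. fejer T y * ?D (- real n - y) \<partial>lborel)\<bar> \<le> 2 * (LBINT t:{-T..T}. B t)"
  proof -
    have "\<forall>\<^sub>F n in sequentially. real n \<ge> - b"
      using filterlim_at_top filterlim_real_sequentially by blast
    then show ?thesis by eventually_elim (rule diff, simp)
  qed
  ultimately show ?thesis
    by (intro tendsto_upperbound[where F=sequentially]) auto
qed

text \<open>Chosen once, from the kernel alone, so that the constant in the smoothing inequality is
  absolute and can be used for all sample sizes at the same time.\<close>

definition fejer_cutoff :: real where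
  "fejer_cutoff = (SOME H. H > 0 \<and>
     (\<integral>y. fejer 1 y * indicator {y. \<bar>y\<bar> > H} y \<partial>lborel) \<le> (\<integral>y. fejer 1 y \<partial>lborel) / 8)"

lemma fejer_cutoff:
  "fejer_cutoff > 0"
  "(\<integral>y. fejer 1 y * indicator {y. \<bar>y\<bar> > fejer_cutoff} y \<partial>lborel) \<le> (\<integral>y. fejer 1 y \<partial>lborel) / 8"
proof -
  have "\<exists>H>0. (\<integral>y. fejer 1 y * indicator {y. \<bar>y\<bar> > H} y \<partial>lborel) \<le> (\<integral>y. fejer 1 y \<partial>lborel) / 8"
    using fejer_tail[of "(\<integral>y. fejer 1 y \<partial>lborel) / 8"] fejer_mass_pos by (metis divide_pos_pos zero_less_numeral)
  from someI_ex[OF this] show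
    "fejer_cutoff > 0"
    "(\<integral>y. fejer 1 y * indicator {y. \<bar>y\<bar> > fejer_cutoff} y \<partial>lborel) \<le> (\<integral>y. fejer 1 y \<partial>lborel) / 8"
    unfolding fejer_cutoff_def by auto
qed

text \<open>The leading 2 comes from the two end points in \<open>interval_transform_bound\<close>;
  the bracket is the constant of \<open>fejer_deconvolution\<close>.\<close>

definition esseen_constant :: real where
  "esseen_constant = 2 * (11 / (\<integral>y. fejer 1 y \<partial>lborel) + 8 * fejer_cutoff)"

lemma esseen_constant_pos: "esseen_constant > 0"
  using fejer_cutoff(1) fejer_mass_pos by (simp add: esseen_constant_def add_pos_pos)

text \<open>Let \<open>\<eta>\<close> be the supremum of \<open>\<bar>cdf \<mu> - G\<bar>\<close>
  and \<open>x0\<close> a point with more than half of it, as the supremum need not be attained.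
  Since the distribution function cannot fall and \<open>G\<close> is Lipschitz with constant
  \<open>m\<close>, a positive difference at \<open>x0\<close> decreases at rate at most
  \<open>m\<close> to the right, which is the one-sided condition of
  \<open>fejer_deconvolution\<close>.\<close>

lemma esseen_smoothing:
  fixes g G B :: "real \<Rightarrow> real" and m T x :: real
  assumes "real_distribution \<mu>" and g: "integrable lborel g"
    and G: "\<And>x. G x = (LBINT w:{..x}. g w)" and gm: "\<And>y. \<bar>g y\<bar> \<le> m" and m: "m > 0" and T: "T > 0"
    and B: "set_integrable lborel {-T..T} B" and B_nonneg: "\<And>t. B t \<ge> 0"
    and bound: "\<And>t. \<bar>t\<bar> \<le> T \<Longrightarrow> norm (char \<mu> t - (CLBINT w. iexp (t * w) * of_real (g w))) \<le> \<bar>t\<bar> * B t"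
  shows "\<bar>cdf \<mu> x - G x\<bar> \<le> esseen_constant * ((LBINT t:{-T..T}. B t) + m / T)"
proof -
  define C0 where "C0 = 11 / (\<integral>y. fejer 1 y \<partial>lborel) + 8 * fejer_cutoff"
  have C0: "C0 > 0" using fejer_cutoff fejer_mass_pos by (simp add: C0_def add_pos_pos)
  note deconv = fejer_deconvolution[OF fejer_cutoff, folded C0_def]
  interpret real_distribution \<mu> by fact
  have [measurable]: "cdf \<mu> \<in> borel_measurable borel"
    by (intro borel_measurable_mono monoI cdf_nondecreasing)
  let ?D = "\<lambda>x. cdf \<mu> x - G x"
  have gi: "integrable lborel (\<lambda>w. indicator {..x} w *\<^sub>R g w)" for x
    by (rule integrable_mult_indicator) (use g in auto)
  have lip: "\<bar>G b - G a\<bar> \<le> m * (b - a)" if "a \<le> b" for a b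
  proof -
    have "G b - G a = (LBINT w:{a<..b}. g w)"
      unfolding set_lebesgue_integral_def G
      by (subst Bochner_Integration.integral_diff[symmetric, OF gi gi])
         (use that in \<open>auto intro!: Bochner_Integration.integral_cong simp: indicator_def\<close>)
    also have "\<bar>\<dots>\<bar> \<le> (\<integral>w. m * indicator {a<..b} w \<partial>lborel)"
      unfolding set_lebesgue_integral_def real_norm_def[symmetric]
    proof (rule Bochner_Integration.integral_norm_bound_integral)
      show "integrable lborel (\<lambda>w. indicator {a<..b} w *\<^sub>R g w)"
        by (rule integrable_mult_indicator) (use g in auto)
      show "integrable lborel (\<lambda>w. m * indicator {a<..b} w)"
        using that by (intro integrable_mult_right) (simp add: emeasure_lborel_Ioc)
      show "norm (indicator {a<..b} w *\<^sub>R g w) \<le> m * indicator {a<..b} w" for w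
        using gm[of w] by (auto simp: indicator_def)
    qed
    finally show ?thesis using that by simp
  qed
  have "continuous_on UNIV G"
  proof (rule lipschitz_on_continuous_on[where L=m])
    show "m-lipschitz_on UNIV G"
    proof (intro lipschitz_onI)
      show "dist (G x) (G y) \<le> m * dist x y" for x y
        using lip[of x y] lip[of y x] by (cases "x \<le> y") (auto simp: dist_real_def abs_minus_commute)
    qed (use m in auto)
  qed
  then have [measurable]: "G \<in> borel_measurable borel"
    by (rule borel_measurable_continuous_onI)
  define \<eta>0 where "\<eta>0 = (\<integral>w. norm (g w) \<partial>lborel)"
  have G_bound: "\<bar>G x\<bar> \<le> \<eta>0" for x
    unfolding G set_lebesgue_integral_def real_norm_def[symmetric] \<eta>0_def
    using g by (intro Bochner_Integration.integral_norm_bound_integral integrable_mult_indicator)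
         (auto simp: indicator_def)
  note sm = fejer_smoothed_difference_bound[OF T \<open>real_distribution \<mu>\<close> g G B B_nonneg bound \<open>G \<in> borel_measurable borel\<close> G_bound]
  define J where "J = 2 * (LBINT t:{-T..T}. B t)"
  have J0: "J \<ge> 0" using sm[of 0] unfolding J_def by linarith
  have D_bdd: "\<bar>?D x\<bar> \<le> 1 + \<eta>0" for x
    using cdf_nonneg[of x] cdf_bounded_prob[of x] G_bound[of x] by linarith
  define \<eta> where "\<eta> = (SUP x. \<bar>?D x\<bar>)"
  have bdd: "bdd_above (range (\<lambda>x. \<bar>?D x\<bar>))" using D_bdd by (auto intro!: bdd_aboveI)
  have D_le: "\<bar>?D x\<bar> \<le> \<eta>" for x unfolding \<eta>_def by (rule cSUP_upper[OF _ bdd]) simp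
  have main: "\<eta> \<le> C0 * (J + m / T)"
  proof (cases "\<eta> > 0")
    case False
    moreover have "C0 * (J + m / T) \<ge> 0" using C0 J0 m T by simp
    ultimately show ?thesis by linarith
  next
    case True
    then obtain x0 where x0: "\<bar>?D x0\<bar> > \<eta> / 2"
      using less_cSUP_iff[OF _ bdd, of "\<eta> / 2"] unfolding \<eta>_def[symmetric] by auto
    show ?thesis
    proof (cases "?D x0 > 0")
      case True
      show ?thesis
      proof (rule deconv[of ?D T m "?D x0" \<eta> x0])
        show "?D (x0 + s) \<ge> ?D x0 - m * s" if "s \<ge> 0" for s
          using lip[of x0 "x0 + s"] cdf_nondecreasing[of x0 "x0 + s"] that by (simp add: abs_le_iff)
        show "(\<integral>y. fejer T y * ?D (x - y) \<partial>lborel) \<le> J" for x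
          using sm[of x] unfolding J_def by linarith
      qed (use True T m x0 D_le J0 in auto)
    next
      case False
      show ?thesis
      \<comment> \<open>A negative difference persists to the left of \<open>x0\<close>; reflecting
        argument and value reduces it to the positive case, and the even kernel does not
        notice.\<close>
      proof (rule deconv[of "\<lambda>x. - ?D (- x)" T m "- ?D x0" \<eta> "- x0"])
        show "- ?D (- (- x0 + s)) \<ge> - ?D x0 - m * s" if "s \<ge> 0" for s
          using lip[of "x0 - s" x0] cdf_nondecreasing[of "x0 - s" x0] that by (simp add: abs_le_iff)
        show "(\<integral>y. fejer T y * - ?D (- (x - y)) \<partial>lborel) \<le> J" for x
        proof -
          have "(\<integral>y. fejer T y * - ?D (- (x - y)) \<partial>lborel) = - (\<integral>y. fejer T y * ?D (- x - y) \<partial>lborel)"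
            by (subst lborel_integral_real_affine[where c="-1" and t=0])
               (simp_all add: fejer_minus right_diff_distrib flip: Bochner_Integration.integral_minus)
          then show ?thesis using sm[of "- x"] unfolding J_def by linarith
        qed
        show "\<bar>- ?D (- x)\<bar> \<le> \<eta>" for x
          using D_le[of "- x"] by simp
      qed (use False True T m x0 J0 in auto)
    qed
  qed
  have "\<bar>?D x\<bar> \<le> C0 * (J + m / T)" using D_le[of x] main by linarith
  also have "\<dots> \<le> 2 * C0 * ((LBINT t:{-T..T}. B t) + m / T)"
    using C0 m T by (simp add: J_def field_simps)
  finally show ?thesis by (simp add: C0_def esseen_constant_def)
qed

subsection \<open>Hermite polynomials and uniqueness of the Edgeworth polynomials\<close>

abbreviation gauss_poly :: "real poly \<Rightarrow> real \<Rightarrow> real" where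
  "gauss_poly p z \<equiv> std_normal_density z * poly p z"

text \<open>Differentiation conjugated by the Gaussian density, acting on the polynomial
  factor.\<close>

definition gauss_deriv :: "real poly \<Rightarrow> real poly" where
  "gauss_deriv p = pderiv p - pCons 0 p"

lemma std_normal_density_has_derivative:
  "(std_normal_density has_real_derivative - z * std_normal_density z) (at z)"
  unfolding std_normal_density_def[abs_def]
  by (auto intro!: derivative_eq_intros simp: field_simps)

lemma gauss_poly_has_derivative:
  "(gauss_poly p has_real_derivative gauss_poly (gauss_deriv p) z) (at z)"
  by (rule derivative_eq_intros std_normal_density_has_derivative poly_DERIV | 
      simp add: gauss_deriv_def algebra_simps)+

lemma borel_measurable_poly [measurable]: "poly p \<in> borel_measurable borel" for p :: "real poly"
  by (intro borel_measurable_continuous_onI continuous_intros)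

lemma gauss_poly_integrable: "integrable lborel (gauss_poly p)"
proof -
  have "integrable lborel (\<lambda>z. \<Sum>i\<le>degree p. coeff p i * (std_normal_density z * z ^ i))"
    using integrable_std_normal_moment by (intro Bochner_Integration.integrable_sum integrable_mult_right)
  then show ?thesis by (simp add: poly_altdef sum_distrib_left mult_ac)
qed

lemma gauss_poly_tendsto_0: "(gauss_poly p \<longlongrightarrow> 0) at_top" "(gauss_poly p \<longlongrightarrow> 0) at_bot"
proof -
  have eq: "gauss_poly p = (\<lambda>z. \<Sum>i\<le>degree p. coeff p i / sqrt (2 * pi) * (z ^ i * exp (- z\<^sup>2 / 2)))"
    by (simp add: poly_altdef sum_distrib_left std_normal_density_def sum_divide_distrib mult_ac)
  have top: "((\<lambda>z::real. z ^ i * exp (- z\<^sup>2 / 2)) \<longlongrightarrow> 0) at_top" for i :: nat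
    by real_asymp
  show "(gauss_poly p \<longlongrightarrow> 0) at_top"
    unfolding eq using top by (intro tendsto_null_sum tendsto_mult_right_zero)
  have "((\<lambda>z::real. z ^ i * exp (- z\<^sup>2 / 2)) \<longlongrightarrow> 0) at_bot" for i :: nat
  proof -
    have "(- z) ^ i * exp (- (- z)\<^sup>2 / 2) = (- 1) ^ i * (z ^ i * exp (- z\<^sup>2 / 2))" for z :: real
      using power_minus[of z i] by simp
    then show ?thesis
      unfolding filterlim_at_bot_mirror by (simp only:) (intro tendsto_mult_right_zero top)
  qed
  then show "(gauss_poly p \<longlongrightarrow> 0) at_bot"
    unfolding eq by (intro tendsto_null_sum tendsto_mult_right_zero)
qed

lemma gauss_poly_continuous: "continuous_on A (gauss_poly p)" "isCont (gauss_poly p) z"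
proof -
  show "isCont (gauss_poly p) z" for z using gauss_poly_has_derivative DERIV_isCont by blast
  then show "continuous_on A (gauss_poly p)" by (simp add: continuous_at_imp_continuous_on)
qed

lemma gauss_poly_bounded: obtains m where "m > 0" "\<And>z. \<bar>gauss_poly p z\<bar> \<le> m"
proof -
  obtain b1 where b1: "\<And>z. z \<ge> b1 \<Longrightarrow> \<bar>gauss_poly p z\<bar> < 1"
    using gauss_poly_tendsto_0(1)[of p, THEN tendstoD, of 1] by (auto simp: eventually_at_top_linorder)
  obtain b2 where b2: "\<And>z. z \<le> b2 \<Longrightarrow> \<bar>gauss_poly p z\<bar> < 1"
    using gauss_poly_tendsto_0(2)[of p, THEN tendstoD, of 1] by (auto simp: eventually_at_bot_linorder)
  have "bounded (gauss_poly p ` {b2..b1})"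
    by (intro compact_imp_bounded compact_continuous_image gauss_poly_continuous) auto
  then obtain m0 where m0: "\<And>z. z \<in> {b2..b1} \<Longrightarrow> \<bar>gauss_poly p z\<bar> \<le> m0"
    unfolding bounded_iff by (metis image_eqI real_norm_def)
  show thesis
  proof (rule that[of "max m0 1"])
    show "\<bar>gauss_poly p z\<bar> \<le> max m0 1" for z
      using b1[of z] b2[of z] m0[of z] by (cases "z \<ge> b1"; cases "z \<le> b2") auto
  qed auto
qed

definition gauss_fourier :: "real poly \<Rightarrow> real \<Rightarrow> complex" where
  "gauss_fourier p t = (CLBINT z. iexp (t * z) * of_real (gauss_poly p z))"

lemma gauss_fourier_integrable: "integrable lborel (\<lambda>z. iexp (t * z) * of_real (gauss_poly p z))"
  by (rule Bochner_Integration.integrable_bound[OF gauss_poly_integrable[of p]]) (auto simp: norm_mult)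

lemma gauss_fourier_linear:
  "gauss_fourier (p + q) t = gauss_fourier p t + gauss_fourier q t"
  "gauss_fourier (smult c p) t = of_real c * gauss_fourier p t"
  "gauss_fourier 0 t = 0"
proof -
  show "gauss_fourier (p + q) t = gauss_fourier p t + gauss_fourier q t"
    unfolding gauss_fourier_def
    by (subst Bochner_Integration.integral_add[symmetric, OF gauss_fourier_integrable gauss_fourier_integrable])
       (simp add: algebra_simps)
  have "gauss_fourier (smult c p) t = (CLBINT z. of_real c * (iexp (t * z) * of_real (gauss_poly p z)))"
    unfolding gauss_fourier_def by (intro Bochner_Integration.integral_cong) auto
  then show "gauss_fourier (smult c p) t = of_real c * gauss_fourier p t"
    unfolding gauss_fourier_def by (simp only: integral_mult_right_zero)
qed (simp add: gauss_fourier_def)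

lemma gauss_fourier_sum: "gauss_fourier (\<Sum>i\<in>A. f i) t = (\<Sum>i\<in>A. gauss_fourier (f i) t)"
  by (induction A rule: infinite_finite_induct) (simp_all add: gauss_fourier_linear)

lemma gauss_fourier_diff: "gauss_fourier (p - q) t = gauss_fourier p t - gauss_fourier q t"
  using gauss_fourier_linear(1)[of "p - q" q t] by simp

lemma gauss_fourier_1: "gauss_fourier 1 t = exp (- (of_real t)\<^sup>2 / 2)"
proof -
  have "char std_normal_distribution t = gauss_fourier 1 t"
    unfolding char_def gauss_fourier_def
    by (subst integral_density) (auto simp: scaleR_conv_of_real mult.commute normal_density_nonneg)
  then show ?thesis by (simp add: char_std_normal_distribution flip: exp_of_real)
qed

text \<open>Integration by parts: the derivative of \<open>?F\<close> integrates to 0, since the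
  Gaussian factor removes the boundary terms at both infinities.\<close>

lemma gauss_fourier_deriv:
  "gauss_fourier (gauss_deriv p) t = - (\<i> * of_real t) * gauss_fourier p t"
proof -
  let ?f = "\<lambda>z. iexp (t * z) * of_real (gauss_poly (gauss_deriv p) z) + \<i> * of_real t * (iexp (t * z) * of_real (gauss_poly p z))"
  let ?F = "\<lambda>z. iexp (t * z) * of_real (gauss_poly p z)"
  have int: "integrable lborel ?f"
    by (intro Bochner_Integration.integrable_add integrable_mult_right gauss_fourier_integrable)
  have D: "(?F has_vector_derivative ?f z) (at z)" for z
  proof -
    have "((\<lambda>z. iexp (t * z)) has_vector_derivative \<i> * of_real t * iexp (t * z)) (at z)"
      by (auto intro!: derivative_eq_intros has_vector_derivative_real_field)
    moreover have "((\<lambda>z. complex_of_real (gauss_poly p z)) has_vector_derivative of_real (gauss_poly (gauss_deriv p) z)) (at z)"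
      by (intro has_vector_derivative_of_real gauss_poly_has_derivative)
    ultimately show ?thesis
      by (rule has_vector_derivative_eq_rhs[OF has_vector_derivative_mult]) (simp add: algebra_simps)
  qed
  have lim: "(?F \<longlongrightarrow> 0) F" if "(gauss_poly p \<longlongrightarrow> 0) F" for F
    by (rule tendsto_norm_zero_cancel) (use tendsto_rabs_zero[OF that] in \<open>simp add: norm_mult abs_mult\<close>)
  have "(LBINT z=-\<infinity>..\<infinity>. ?f z) = 0 - 0"
  proof (rule interval_integral_FTC_integrable)
    show "(?F has_vector_derivative ?f z) (at z)" for z by (rule D)
    show "isCont ?f z" for z
      by (intro continuous_intros gauss_poly_continuous isCont_of_real)
    show "set_integrable lborel (einterval (-\<infinity>) \<infinity>) ?f"
      using int by (simp add: set_integrable_def)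
    show "((?F \<circ> real_of_ereal) \<longlongrightarrow> 0) (at_right (-\<infinity>))" "((?F \<circ> real_of_ereal) \<longlongrightarrow> 0) (at_left \<infinity>)"
      using gauss_poly_tendsto_0[of p] by (simp_all add: ereal_tendsto_simps lim del: of_real_mult)
  qed simp
  then have "(CLBINT z. ?f z) = 0" by (simp add: interval_lebesgue_integral_def set_lebesgue_integral_def)
  also have "(CLBINT z. ?f z) = gauss_fourier (gauss_deriv p) t + \<i> * of_real t * gauss_fourier p t"
    unfolding gauss_fourier_def
    by (subst Bochner_Integration.integral_add[OF gauss_fourier_integrable integrable_mult_right[OF gauss_fourier_integrable]])
       (simp only: integral_mult_right_zero)
  finally show ?thesis by (simp add: add_eq_0_iff)
qed

text \<open>The probabilists' Hermite polynomials. The minus sign makes them monic and gives the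
  transforms the plain factor \<open>(\<i> * t) ^ k\<close>.\<close>

fun hermite :: "nat \<Rightarrow> real poly" where
  "hermite 0 = 1"
| "hermite (Suc k) = - gauss_deriv (hermite k)"

lemma gauss_fourier_hermite:
  "gauss_fourier (hermite k) t = (\<i> * of_real t) ^ k * exp (- (of_real t)\<^sup>2 / 2)"
proof (induction k)
  case (Suc k)
  then show ?case
    using gauss_fourier_diff[of 0 "gauss_deriv (hermite k)" t]
    by (simp add: gauss_fourier_linear gauss_fourier_deriv)
qed (simp add: gauss_fourier_1)

lemma hermite_monic: "degree (hermite k) = k" "lead_coeff (hermite k) = 1"
proof -
  have "degree (hermite k) = k \<and> lead_coeff (hermite k) = 1"
  proof (induction k)
    case (Suc k)
    let ?p = "hermite k"
    have nz: "?p \<noteq> 0" using Suc by auto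
    have d: "degree (pderiv ?p) < degree (pCons 0 ?p)"
      using nz by (simp add: degree_pderiv less_Suc_eq_le)
    have eq: "hermite (Suc k) = pCons 0 ?p + - pderiv ?p" by (simp add: gauss_deriv_def)
    have "degree (pCons 0 ?p + - pderiv ?p) = degree (pCons 0 ?p)"
      by (rule degree_add_eq_left) (use d in simp)
    moreover have "coeff ?p k = 1" "degree ?p = k" using Suc by auto
    moreover from this have "coeff (pCons 0 ?p + - pderiv ?p) (Suc k) = 1"
      using d nz by (simp add: coeff_eq_0)
    ultimately show ?case unfolding eq using nz Suc by (simp only: degree_pCons_eq) simp
  qed simp
  then show "degree (hermite k) = k" "lead_coeff (hermite k) = 1" by auto
qed

text \<open>Being monic of degree \<open>k\<close>, the Hermite polynomials form a triangular basis:
  subtract the top coefficient times \<open>hermite N\<close> and recurse.\<close>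

lemma hermite_expansion:
  "degree p < N \<Longrightarrow> \<exists>c. p = (\<Sum>i<N. smult (c i) (hermite i))"
proof (induction N arbitrary: p)
  case (Suc N)
  define q where "q = p - smult (coeff p N) (hermite N)"
  have "degree q \<le> N" unfolding q_def using Suc.prems hermite_monic(1)[of N]
    by (intro degree_diff_le) (auto intro: order_trans[OF degree_smult_le])
  moreover have "coeff q N = 0" using hermite_monic[of N] by (simp add: q_def)
  ultimately have *: "q = 0 \<or> degree q < N" 
    using eq_zero_or_degree_less by blast
  have "\<exists>c. q = (\<Sum>i<N. smult (c i) (hermite i))"
  proof (cases "q = 0")
    case True then show ?thesis by (intro exI[of _ "\<lambda>_. 0"]) simp
  next
    case False then show ?thesis using * Suc.IH by blast
  qed
  then obtain c where "q = (\<Sum>i<N. smult (c i) (hermite i))" ..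
  moreover have "(\<Sum>i<N. smult ((c(N := coeff p N)) i) (hermite i)) = (\<Sum>i<N. smult (c i) (hermite i))"
    by (intro sum.cong) auto
  ultimately have "p = (\<Sum>i<Suc N. smult ((c(N := coeff p N)) i) (hermite i))"
    by (simp add: q_def diff_eq_eq)
  then show ?case by blast
qed simp

lemma gauss_fourier_hermite_sum:
  "gauss_fourier (\<Sum>i\<in>A. smult (c i) (hermite i)) t
     = (\<Sum>i\<in>A. of_real (c i) * (\<i> * of_real t) ^ i) * exp (- (of_real t)\<^sup>2 / 2)"
  by (simp add: gauss_fourier_sum gauss_fourier_linear gauss_fourier_hermite sum_distrib_right mult.assoc)

text \<open>In the Hermite basis the transform is a polynomial in \<open>t\<close> times a
  nonvanishing Gaussian, so infinitely many zeros suffice. The point \<open>t = 0\<close> is left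
  out because the uniqueness argument has to divide by \<open>\<i> * t\<close>.\<close>

lemma gauss_fourier_eq_0_imp:
  assumes "\<And>t. t \<noteq> 0 \<Longrightarrow> gauss_fourier p t = 0"
  shows "p = 0"
proof -
  obtain c where c: "p = (\<Sum>i<Suc (degree p). smult (c i) (hermite i))"
    using hermite_expansion[of p "Suc (degree p)"] by auto
  have "(\<Sum>i\<le>degree p. (of_real (c i) * \<i> ^ i) * of_real t ^ i) = 0" if "t \<noteq> 0" for t
  proof -
    have "gauss_fourier (\<Sum>i<Suc (degree p). smult (c i) (hermite i)) t = 0"
      using assms[OF that] c by simp
    then show ?thesis unfolding gauss_fourier_hermite_sum
      by (simp add: power_mult_distrib mult_ac lessThan_Suc_atMost)
  qed
  then have "complex_of_real ` (- {0}) \<subseteq> {z. (\<Sum>i\<le>degree p. (of_real (c i) * \<i> ^ i) * z ^ i) = 0}"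
    by auto
  moreover have "infinite (complex_of_real ` (- {0}))"
    by (subst finite_image_iff) (auto simp: inj_on_def infinite_UNIV_char_0)
  ultimately have "infinite {z. (\<Sum>i\<le>degree p. (of_real (c i) * \<i> ^ i) * z ^ i) = 0}"
    using finite_subset by blast
  then have "\<forall>i\<le>degree p. of_real (c i) * \<i> ^ i = 0"
    using polyfun_finite_roots[of "\<lambda>i. of_real (c i) * \<i> ^ i" "degree p"] by blast
  then show ?thesis by (subst c) (simp add: lessThan_Suc_atMost)
qed

section \<open>The Edgeworth series as primitive of a Gaussian times a polynomial\<close>

lemma normal_cdf_eq: "normal_cdf z = normal_cdf 0 + (LBINT y=0..z. std_normal_density y)"
proof -
  have int: "integrable lborel std_normal_density" using gauss_poly_integrable[of 1] by simp
  have eq: "normal_cdf z = (LBINT y=-\<infinity>..z. std_normal_density y)" for z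
  proof -
    have "AE y in lborel. (y \<in> {..z}) = (y \<in> {..<z})"
      using AE_lborel_singleton[of z] by eventually_elim auto
    then have "(LBINT y:{..z}. std_normal_density y) = (LBINT y:{..<z}. std_normal_density y)"
      unfolding set_lebesgue_integral_def
      by (intro integral_cong_AE) (auto simp: indicator_def)
    then show ?thesis
      by (simp add: normal_cdf_def interval_lebesgue_integral_def)
  qed
  have ii: "interval_lebesgue_integrable lborel a b std_normal_density" for a b
    unfolding interval_lebesgue_integrable_def set_integrable_def
    using integrable_mult_indicator[OF _ int] by simp
  have "(LBINT y=-\<infinity>..ereal 0. std_normal_density y) + (LBINT y=ereal 0..ereal z. std_normal_density y)
     = (LBINT y=-\<infinity>..ereal z. std_normal_density y)"
    by (rule interval_integral_sum[OF ii])
  then show ?thesis by (simp add: eq zero_ereal_def)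
qed

lemma normal_cdf_has_derivative: "(normal_cdf has_real_derivative std_normal_density z) (at z)"
proof -
  have c: "continuous_on A std_normal_density" for A using gauss_poly_continuous(1)[of A 1] by simp
  have "((\<lambda>u. LBINT y=ereal 0..u. std_normal_density y) has_vector_derivative std_normal_density z) (at z within {min 0 z - 1..max 0 z + 1})"
    by (rule interval_integral_FTC2[OF _ _ c]) auto
  then have "((\<lambda>u. LBINT y=ereal 0..u. std_normal_density y) has_vector_derivative std_normal_density z) (at z)"
    by (subst (asm) at_within_interior) auto
  then have "((\<lambda>u. normal_cdf 0 + (LBINT y=0..u. std_normal_density y)) has_real_derivative std_normal_density z) (at z)"
    by (auto intro!: derivative_eq_intros simp: has_real_derivative_iff_has_vector_derivative zero_ereal_def)
  moreover have "normal_cdf = (\<lambda>u. normal_cdf 0 + (LBINT y=0..u. std_normal_density y))"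
    by (rule ext) (rule normal_cdf_eq)
  ultimately show ?thesis by metis
qed

lemma normal_cdf_tendsto_0: "(normal_cdf \<longlongrightarrow> 0) at_bot"
proof -
  interpret real_distribution std_normal_distribution by (rule real_dist_normal_dist)
  have "cdf std_normal_distribution z = normal_cdf z" for z
  proof -
    have "cdf std_normal_distribution z = (\<integral>y. indicator {..z} y \<partial>std_normal_distribution)"
      by (simp add: cdf_def)
    also have "\<dots> = normal_cdf z"
      by (subst integral_density)
         (auto simp: normal_cdf_def set_lebesgue_integral_def normal_density_nonneg mult.commute)
    finally show ?thesis .
  qed
  then have "cdf std_normal_distribution = normal_cdf" by (rule ext)
  then show ?thesis using cdf_lim_at_bot by simp
qed

text \<open>The resulting density may take negative values, which is why
  \<open>esseen_smoothing\<close> compares a law with an integrable function and not with a second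
  law.\<close>

definition edgeworth_density_poly :: "(nat \<Rightarrow> real poly) \<Rightarrow> nat \<Rightarrow> nat \<Rightarrow> real poly" where
  "edgeworth_density_poly P r n = 1 + (\<Sum>k=1..r. smult (real n powr (- real k / 2)) (gauss_deriv (P k)))"

lemma edgeworth_of_has_derivative:
  "(edgeworth_of P r n has_real_derivative gauss_poly (edgeworth_density_poly P r n) z) (at z)"
proof -
  have eq: "edgeworth_of P r n = (\<lambda>z. normal_cdf z + (\<Sum>k=1..r. real n powr (- real k / 2) * gauss_poly (P k) z))"
    by (simp add: edgeworth_of_def[abs_def] sum_distrib_left mult_ac)
  show ?thesis unfolding eq
    by (rule DERIV_cong[OF DERIV_add[OF normal_cdf_has_derivative DERIV_sum[OF DERIV_cmult[OF gauss_poly_has_derivative]]]])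
       (simp add: edgeworth_density_poly_def poly_sum algebra_simps sum_distrib_left)
qed

text \<open>The form in which \<open>esseen_smoothing\<close> expects \<open>G\<close>. No constant
  of integration appears because the series vanishes at minus infinity.\<close>

lemma edgeworth_of_eq_integral:
  "edgeworth_of P r n x = (LBINT z:{..x}. gauss_poly (edgeworth_density_poly P r n) z)"
proof -
  let ?g = "gauss_poly (edgeworth_density_poly P r n)"
  have "(edgeworth_of P r n \<longlongrightarrow> 0 + (\<Sum>k=1..r. real n powr (- real k / 2) * 0)) at_bot"
  proof -
    have eq: "edgeworth_of P r n = (\<lambda>z. normal_cdf z + (\<Sum>k=1..r. real n powr (- real k / 2) * gauss_poly (P k) z))"
      by (simp add: edgeworth_of_def[abs_def] sum_distrib_left mult_ac)
    show ?thesis unfolding eq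
      by (intro tendsto_intros normal_cdf_tendsto_0 gauss_poly_tendsto_0)
  qed
  then have lim: "(edgeworth_of P r n \<longlongrightarrow> 0) at_bot" by simp
  have "(LBINT z=-\<infinity>..ereal x. ?g z) = edgeworth_of P r n x - 0"
  proof (rule interval_integral_FTC_integrable)
    show "(edgeworth_of P r n has_vector_derivative ?g z) (at z)" for z
      using edgeworth_of_has_derivative by (simp add: has_real_derivative_iff_has_vector_derivative)
    show "isCont ?g z" for z by (rule gauss_poly_continuous)
    show "set_integrable lborel (einterval (-\<infinity>) (ereal x)) ?g"
      unfolding set_integrable_def by (intro integrable_mult_indicator gauss_poly_integrable) auto
    show "((edgeworth_of P r n \<circ> real_of_ereal) \<longlongrightarrow> 0) (at_right (-\<infinity>))"
      using lim by (simp add: ereal_tendsto_simps)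
    have "isCont (edgeworth_of P r n) x" using edgeworth_of_has_derivative DERIV_isCont by blast
    then show "((edgeworth_of P r n \<circ> real_of_ereal) \<longlongrightarrow> edgeworth_of P r n x) (at_left (ereal x))"
      by (simp add: ereal_tendsto_simps isCont_def filterlim_at_split)
  qed simp
  moreover have "(LBINT z=-\<infinity>..ereal x. ?g z) = (LBINT z:{..x}. ?g z)"
  proof -
    have "AE y in lborel. (y \<in> {..x}) = (y \<in> {..<x})"
      using AE_lborel_singleton[of x] by eventually_elim auto
    then have "(LBINT y:{..x}. ?g y) = (LBINT y:{..<x}. ?g y)"
      unfolding set_lebesgue_integral_def
      by (intro integral_cong_AE) (auto simp: indicator_def)
    then show ?thesis
      by (simp add: interval_lebesgue_integral_def)
  qed
  ultimately show ?thesis by simp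
qed

lemma deriv_edgeworth_of: "deriv (edgeworth_of P r n) = gauss_poly (edgeworth_density_poly P r n)"
  using edgeworth_of_has_derivative by (intro ext DERIV_imp_deriv)

lemma fourier_stieltjes_eq_gauss_fourier:
  "fourier_stieltjes (edgeworth_of P r n) t = gauss_fourier (edgeworth_density_poly P r n) t"
  by (simp add: fourier_stieltjes_def gauss_fourier_def deriv_edgeworth_of)

text \<open>Each correction is the derivative of a Gaussian times \<open>P k\<close>, hence the
  common factor \<open>\<i> * t\<close>: only polynomials in \<open>t\<close> without constant term
  can be matched by a choice of \<open>P\<close>.\<close>

lemma fourier_stieltjes_edgeworth_of:
  "fourier_stieltjes (edgeworth_of P r n) t = exp (- (of_real t)\<^sup>2 / 2)
     - \<i> * of_real t * (\<Sum>k=1..r. of_real (real n powr (- real k / 2)) * gauss_fourier (P k) t)"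
  unfolding fourier_stieltjes_eq_gauss_fourier edgeworth_density_poly_def
  by (simp add: gauss_fourier_linear gauss_fourier_sum gauss_fourier_1 gauss_fourier_deriv
        sum_distrib_left mult_ac sum_negf)

text \<open>All weights \<open>n powr (- k / 2)\<close> are at most 1, so a single \<open>m\<close>
  bounds the densities for every \<open>n\<close>; the term \<open>m / T\<close> then decays like
  \<open>1 / T\<close>.\<close>

lemma edgeworth_density_bounded:
  obtains m where "m > 0" "\<And>n z. n \<ge> 1 \<Longrightarrow> \<bar>gauss_poly (edgeworth_density_poly P r n) z\<bar> \<le> m"
proof -
  have "\<exists>m. \<forall>z. \<bar>gauss_poly p z\<bar> \<le> m" for p
    using gauss_poly_bounded[of p] by metis
  then obtain m where m: "\<And>p z. \<bar>gauss_poly p z\<bar> \<le> m p" by metis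
  let ?m = "m 1 + (\<Sum>k=1..r. m (gauss_deriv (P k)))"
  show thesis
  proof (rule that[of "?m + 1"])
    have m0: "m p \<ge> 0" for p :: "real poly" using m[where p=p and z=0] by linarith
    show "?m + 1 > 0" using m0 by (intro add_nonneg_pos add_nonneg_nonneg sum_nonneg) auto
    fix n :: nat and z assume n: "n \<ge> 1"
    have "gauss_poly (edgeworth_density_poly P r n) z = gauss_poly 1 z
        + (\<Sum>k=1..r. real n powr (- real k / 2) * gauss_poly (gauss_deriv (P k)) z)"
      by (simp add: edgeworth_density_poly_def poly_sum algebra_simps sum_distrib_left)
    also have "\<bar>\<dots>\<bar> \<le> m 1 + (\<Sum>k=1..r. \<bar>real n powr (- real k / 2) * gauss_poly (gauss_deriv (P k)) z\<bar>)"
      by (intro order_trans[OF abs_triangle_ineq] add_mono m sum_abs)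
    also have "(\<Sum>k=1..r. \<bar>real n powr (- real k / 2) * gauss_poly (gauss_deriv (P k)) z\<bar>)
        \<le> (\<Sum>k=1..r. 1 * m (gauss_deriv (P k)))"
      unfolding abs_mult
    proof (intro sum_mono mult_mono)
      fix k
      have "real n powr (- real k / 2) \<le> real n powr 0" using n by (intro powr_mono) auto
      then show "\<bar>real n powr (- real k / 2)\<bar> \<le> 1" using n by simp
      show "\<bar>std_normal_density z\<bar> * \<bar>poly (gauss_deriv (P k)) z\<bar> \<le> m (gauss_deriv (P k))"
        using m[where p="gauss_deriv (P k)" and z=z] by (simp add: abs_mult)
    qed auto
    finally show "\<bar>gauss_poly (edgeworth_density_poly P r n) z\<bar> \<le> ?m + 1" by simp
  qed
qed

text \<open>Strong induction: with the earlier coefficients gone, division by \<open>u n ^ k\<close>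
  leaves \<open>c k\<close> plus terms tending to 0, while the other side, divided likewise, stays
  below any \<open>e\<close> because \<open>k \<le> r\<close> and \<open>u n < 1\<close>.\<close>

lemma power_sum_smallo_imp_zero:
  fixes c :: "nat \<Rightarrow> complex" and u :: "nat \<Rightarrow> real"
  assumes u: "u \<longlonglongrightarrow> 0" and u_pos: "\<forall>\<^sub>F n in sequentially. u n > 0"
    and o: "(\<lambda>n. norm (\<Sum>k=1..r. of_real (u n ^ k) * c k)) \<in> o(\<lambda>n. u n ^ r)"
    and k: "k \<in> {1..r}"
  shows "c k = 0"
  using k
proof (induction k rule: less_induct)
  case (less k)
  have lt: "(\<Sum>j=1..r. of_real (u n ^ j) * c j) = of_real (u n ^ k) * (\<Sum>j=k..r. of_real (u n ^ (j - k)) * c j)" for n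
  proof -
    have "(\<Sum>j=1..r. of_real (u n ^ j) * c j) = (\<Sum>j=k..r. of_real (u n ^ j) * c j)"
      using less by (intro sum.mono_neutral_right) auto
    also have "\<dots> = of_real (u n ^ k) * (\<Sum>j=k..r. of_real (u n ^ (j - k)) * c j)"
      by (simp add: sum_distrib_left mult.assoc[symmetric] flip: power_add)
    finally show ?thesis .
  qed
  have "(\<lambda>n. \<Sum>j=k..r. of_real (u n ^ (j - k)) * c j) \<longlonglongrightarrow> (\<Sum>j=k..r. of_real (0 ^ (j - k)) * c j)"
    using u by (intro tendsto_intros)
  also have "(\<Sum>j=k..r. of_real (0 ^ (j - k)) * c j) = (\<Sum>j\<in>{k}. of_real (0 ^ (j - k)) * c j)"
    using less.prems by (intro sum.mono_neutral_right) auto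
  finally have lim: "(\<lambda>n. norm (\<Sum>j=k..r. of_real (u n ^ (j - k)) * c j)) \<longlonglongrightarrow> norm (c k)"
    by (intro tendsto_norm) simp
  have "norm (c k) \<le> e" if e: "e > 0" for e
  proof (rule tendsto_upperbound[OF lim])
    have "\<forall>\<^sub>F n in sequentially. norm (norm (\<Sum>k=1..r. of_real (u n ^ k) * c k)) \<le> e * norm (u n ^ r)"
      using landau_o.smallD[OF o e] .
    moreover have "\<forall>\<^sub>F n in sequentially. u n < 1" using order_tendstoD(2)[OF u] by simp
    ultimately show "\<forall>\<^sub>F n in sequentially. norm (\<Sum>j=k..r. of_real (u n ^ (j - k)) * c j) \<le> e"
      using u_pos
    proof eventually_elim
      case (elim n)
      have "u n ^ k * norm (\<Sum>j=k..r. of_real (u n ^ (j - k)) * c j) \<le> e * u n ^ r"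
        using elim lt[of n] by (simp add: norm_mult norm_power)
      also have "\<dots> \<le> e * u n ^ k"
        using e elim less.prems by (intro mult_left_mono power_decreasing) auto
      finally show ?case using elim by (simp add: mult.commute[of e])
    qed
  qed simp
  then show ?case using field_le_epsilon[of "norm (c k)" 0] by simp
qed

text \<open>Passes to integer powers of \<open>1 / sqrt n\<close>, the small parameter of all
  expansions. At \<open>n = 0\<close> the two sides differ for \<open>k = 0\<close> (0 against
  1).\<close>

lemma nat_powr_half: "n \<ge> 1 \<Longrightarrow> real n powr (- real k / 2) = (1 / sqrt (real n)) ^ k"
proof -
  assume "n \<ge> 1"
  then have "(1 / sqrt (real n)) ^ k = (real n powr (- 1/2)) ^ k"
    by (simp add: powr_minus_divide powr_half_sqrt)
  then show ?thesis using \<open>n \<ge> 1\<close> by (simp add: powr_power)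
qed

text \<open>In the difference of two expansions the characteristic function cancels. For fixed
  \<open>t\<close> a polynomial in \<open>1 / sqrt n\<close> of size
  \<open>o(n powr (- r / 2))\<close> remains, so each coefficient, a multiple of
  \<open>gauss_fourier (P k - Q k) t\<close>, vanishes.\<close>

lemma edgeworth_expansion_unique:
  assumes P: "edgeworth_expansion \<mu> r P" and Q: "edgeworth_expansion \<mu> r Q"
    and P0: "\<And>k. k \<notin> {1..r} \<Longrightarrow> P k = 0" and Q0: "\<And>k. k \<notin> {1..r} \<Longrightarrow> Q k = 0"
  shows "P = Q"
proof
  fix k
  show "P k = Q k"
  proof (cases "k \<in> {1..r}")
    case False then show ?thesis using P0 Q0 by simp
  next
    case k: True
    have "gauss_fourier (P k - Q k) t = 0" if t: "t \<noteq> 0" for t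
    proof -
      let ?u = "\<lambda>n. 1 / sqrt (real n)"
      let ?c = "\<lambda>k. \<i> * of_real t * gauss_fourier (P k - Q k) t"
      let ?\<phi> = "\<lambda>n. char \<mu> (t / (std_dev \<mu> * sqrt (real n))) ^ n"
      have "(\<lambda>n. norm (?\<phi> n - fourier_stieltjes (edgeworth_of Q r n) t) + norm (?\<phi> n - fourier_stieltjes (edgeworth_of P r n) t))
          \<in> o(\<lambda>n. real n powr (- real r / 2))"
        using P Q by (intro sum_in_smallo) (auto simp: edgeworth_expansion_def)
      then have "(\<lambda>n. norm (fourier_stieltjes (edgeworth_of P r n) t - fourier_stieltjes (edgeworth_of Q r n) t))
          \<in> o(\<lambda>n. real n powr (- real r / 2))"
      proof (rule landau_o.big_small_trans[rotated], intro landau_o.big_mono always_eventually allI)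
        fix n
        have "norm ((a - c) - (b - c)) \<le> norm (b - c) + norm (a - c)" for a b c :: complex
          using norm_triangle_ineq4[of "a - c" "b - c"] by simp
        from this[of "fourier_stieltjes (edgeworth_of P r n) t" "?\<phi> n" "fourier_stieltjes (edgeworth_of Q r n) t"]
        show "norm (norm (fourier_stieltjes (edgeworth_of P r n) t - fourier_stieltjes (edgeworth_of Q r n) t))
          \<le> norm (norm (?\<phi> n - fourier_stieltjes (edgeworth_of Q r n) t) + norm (?\<phi> n - fourier_stieltjes (edgeworth_of P r n) t))"
          by (simp add: norm_minus_commute)
      qed
      then have "(\<lambda>n. norm (\<Sum>k=1..r. of_real (?u n ^ k) * ?c k)) \<in> o(\<lambda>n. ?u n ^ r)"
      proof (rule landau_o.small.cong_ex[THEN iffD1, rotated 2])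
        have ev: "\<forall>\<^sub>F n in sequentially. n \<ge> (1::nat)" by (rule eventually_ge_at_top)
        show "\<forall>\<^sub>F n in sequentially. real n powr (- real r / 2) = ?u n ^ r"
          using ev by eventually_elim (rule nat_powr_half)
        show "\<forall>\<^sub>F n in sequentially. norm (fourier_stieltjes (edgeworth_of P r n) t - fourier_stieltjes (edgeworth_of Q r n) t)
            = norm (\<Sum>k=1..r. of_real (?u n ^ k) * ?c k)"
          using ev
        proof eventually_elim
          case (elim n)
          have "fourier_stieltjes (edgeworth_of P r n) t - fourier_stieltjes (edgeworth_of Q r n) t
              = - (\<Sum>k=1..r. of_real (?u n ^ k) * ?c k)"
            unfolding fourier_stieltjes_edgeworth_of nat_powr_half[OF elim] gauss_fourier_diff
            by (simp add: sum_distrib_left algebra_simps sum_subtractf)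
          then show ?case by (metis norm_minus_cancel)
        qed
      qed
      then have "?c k = 0"
        by (rule power_sum_smallo_imp_zero[OF _ _ _ k, rotated 2]) real_asymp+
      then show ?thesis using t by simp
    qed
    then have "P k - Q k = 0" by (rule gauss_fourier_eq_0_imp)
    then show ?thesis by simp
  qed
qed

subsection \<open>Expansion of the characteristic function near the origin\<close>

lemma holomorphic_factor_out:
  assumes "f holomorphic_on S" "open S" "0 \<in> S"
  obtains g where "g holomorphic_on S" "g 0 = deriv f 0" "\<And>z. z \<in> S \<Longrightarrow> f z = f 0 + z * g z"
proof
  let ?g = "\<lambda>z. if z = 0 then deriv f 0 else (f z - f 0) / z"
  have "f field_differentiable at 0" using assms holomorphic_on_imp_differentiable_at by blast
  then have d: "deriv (\<lambda>z. f z - f 0) 0 = deriv f 0"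
    by (subst deriv_diff) auto
  show "?g holomorphic_on S"
  proof (rule pole_theorem_open_0)
    show "(\<lambda>z. f z - f 0) holomorphic_on S" by (intro holomorphic_intros assms)
  qed (use assms d in auto)
qed (auto simp: field_simps)

text \<open>Repeated division by \<open>z\<close>, the singularity at 0 being removable. With the
  remainder as \<open>z ^ N\<close> times a holomorphic function, compactness alone bounds
  it.\<close>

lemma holomorphic_taylor_factor:
  assumes "f holomorphic_on S" "open S" "0 \<in> S"
  shows "\<exists>c g. g holomorphic_on S \<and> (\<forall>z\<in>S. f z = (\<Sum>k<N. c k * z ^ k) + z ^ N * g z)"
proof (induction N)
  case 0
  then show ?case using assms by (intro exI[of _ "\<lambda>_. 0"] exI[of _ f]) auto
next
  case (Suc N)
  then obtain c g where g: "g holomorphic_on S" "\<And>z. z \<in> S \<Longrightarrow> f z = (\<Sum>k<N. c k * z ^ k) + z ^ N * g z"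
    by blast
  obtain h where h: "h holomorphic_on S" "\<And>z. z \<in> S \<Longrightarrow> g z = g 0 + z * h z"
    using holomorphic_factor_out[OF g(1) assms(2,3)] by metis
  have "f z = (\<Sum>k<Suc N. (c(N := g 0)) k * z ^ k) + z ^ Suc N * h z" if "z \<in> S" for z
  proof -
    have "(\<Sum>k<N. (c(N := g 0)) k * z ^ k) = (\<Sum>k<N. c k * z ^ k)" by (intro sum.cong) auto
    then show ?thesis using g(2)[OF that] h(2)[OF that] by (simp add: algebra_simps)
  qed
  then show ?case using h(1) by blast
qed

lemma holomorphic_bounded_on_cball:
  fixes f :: "complex \<Rightarrow> complex"
  assumes "f holomorphic_on ball 0 \<rho>" "\<delta> < \<rho>"
  obtains B where "B > 0" "\<And>z. norm z \<le> \<delta> \<Longrightarrow> norm (f z) \<le> B"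
proof -
  have "continuous_on (cball 0 \<delta>) f"
    using assms by (intro holomorphic_on_imp_continuous_on holomorphic_on_subset[OF assms(1)]) auto
  then have "bounded (f ` cball 0 \<delta>)" by (intro compact_imp_bounded compact_continuous_image) auto
  then obtain B where "B > 0" "\<forall>x\<in>f ` cball 0 \<delta>. norm x \<le> B" using bounded_pos by metis
  then show thesis using that by auto
qed

lemma holomorphic_taylor_bound:
  assumes "f holomorphic_on ball 0 \<rho>" "0 < \<rho>" "\<delta> < \<rho>"
  shows "\<exists>c B. B > 0 \<and> (\<forall>z. norm z \<le> \<delta> \<longrightarrow> norm (f z - (\<Sum>k<N. c k * z ^ k)) \<le> B * norm z ^ N)"
proof -
  obtain c g where g: "g holomorphic_on ball 0 \<rho>" "\<And>z. z \<in> ball 0 \<rho> \<Longrightarrow> f z = (\<Sum>k<N. c k * z ^ k) + z ^ N * g z"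
    using holomorphic_taylor_factor[OF assms(1), of N] assms(2) by auto
  obtain B where B: "B > 0" "\<And>z. norm z \<le> \<delta> \<Longrightarrow> norm (g z) \<le> B"
    using holomorphic_bounded_on_cball[OF g(1) assms(3)] by metis
  have "norm (f z - (\<Sum>k<N. c k * z ^ k)) \<le> B * norm z ^ N" if "norm z \<le> \<delta>" for z
  proof -
    have "f z - (\<Sum>k<N. c k * z ^ k) = z ^ N * g z" using g(2)[of z] that assms(3) by simp
    then show ?thesis using B(2)[OF that] by (simp add: norm_mult norm_power mult_left_mono mult.commute[of B])
  qed
  then show ?thesis using B(1) by blast
qed

text \<open>Order three fits the moments: weight, mean and variance are prescribed, and everything
  beyond goes into an entire function.\<close>

lemma exp_third_order:
  obtains E :: "complex \<Rightarrow> complex" where "E holomorphic_on UNIV" "\<And>z. exp z = 1 + z + z\<^sup>2 / 2 + z ^ 3 * E z"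
proof -
  define E :: "complex \<Rightarrow> complex" where "E = (\<lambda>z. \<Sum>n. z ^ n / fact (n + 3))"
  have sums: "(\<lambda>n. z ^ n / fact (n + 3)) sums E z" for z :: complex
  proof -
    have "summable (\<lambda>n. z ^ n / fact (n + 3))"
    proof (rule summable_comparison_test'[where N=0])
      show "summable (\<lambda>n. norm z ^ n /\<^sub>R fact n)" by (rule summable_exp_generic)
      show "norm (z ^ n / fact (n + 3)) \<le> norm z ^ n /\<^sub>R fact n" for n
      proof -
        have "norm (z ^ n / fact (n + 3)) = norm z ^ n / fact (n + 3)"
          by (simp only: norm_divide norm_power norm_fact)
        also have "\<dots> \<le> norm z ^ n / fact n"
          by (intro divide_left_mono fact_mono mult_pos_pos) auto
        finally show ?thesis by (simp add: divide_inverse mult.commute)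
      qed
    qed
    then show ?thesis unfolding E_def by (rule summable_sums)
  qed
  show thesis
  proof (rule that)
    show "E holomorphic_on UNIV"
    proof (rule holomorphic_onI)
      fix z :: complex
      have "E holomorphic_on ball 0 (norm z + 1)"
        by (rule power_series_holomorphic[where a="\<lambda>n. 1 / fact (n + 3)"]) (use sums in simp)
      then show "E field_differentiable at z within UNIV"
        by (intro holomorphic_on_imp_differentiable_at[THEN field_differentiable_at_within]) auto
    qed
    show "exp z = 1 + z + z\<^sup>2 / 2 + z ^ 3 * E z" for z
    proof -
      have "(\<lambda>n. z ^ 3 * (z ^ n / fact (n + 3))) sums (z ^ 3 * E z)" by (intro sums_mult sums)
      then have "(\<lambda>n. z ^ (n + 3) /\<^sub>R fact (n + 3)) sums (z ^ 3 * E z)"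
        by (simp add: power_add mult_ac scaleR_conv_of_real divide_inverse)
      moreover have "(\<lambda>n. z ^ n /\<^sub>R fact n) sums exp z" by (rule exp_converges)
      then have "(\<lambda>n. z ^ (n + 3) /\<^sub>R fact (n + 3)) sums (exp z - (\<Sum>n<3. z ^ n /\<^sub>R fact n))"
        by (rule sums_split_initial_segment)
      ultimately have "z ^ 3 * E z = exp z - (\<Sum>n<3. z ^ n /\<^sub>R fact n)" by (rule sums_unique2)
      then show ?thesis by (simp add: eval_nat_numeral scaleR_conv_of_real)
    qed
  qed
qed

text \<open>First order is enough: the lemma is applied to a \<open>w\<close> of order
  \<open>x\<^sup>2\<close>, so \<open>w\<^sup>2\<close> is of order \<open>x ^ 4\<close>. Stating it
  through \<open>exp\<close> keeps the branch of the logarithm out of later statements.\<close>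

lemma Ln_second_order:
  obtains L where "L holomorphic_on ball 0 1" "\<And>w. norm w < 1 \<Longrightarrow> 1 + w = exp (w + w\<^sup>2 * L w)"
proof -
  have re: "1 + w \<notin> \<real>\<^sub>\<le>\<^sub>0" if "norm w < 1" for w :: complex
    using that abs_Re_le_cmod[of w] by (auto simp: complex_nonpos_Reals_iff)
  have hol: "(\<lambda>w. Ln (1 + w)) holomorphic_on ball 0 1"
    using re by (intro holomorphic_intros) auto
  have "((\<lambda>w. Ln (1 + w)) has_field_derivative 1) (at 0)"
    by (auto intro!: derivative_eq_intros simp: complex_nonpos_Reals_iff)
  then have d: "deriv (\<lambda>w. Ln (1 + w)) 0 = 1" by (rule DERIV_imp_deriv)
  obtain g where g: "g holomorphic_on ball 0 1" "g 0 = 1" "\<And>z. z \<in> ball 0 1 \<Longrightarrow> Ln (1 + z) = z * g z"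
    using holomorphic_factor_out[OF hol] d by auto
  obtain L where L: "L holomorphic_on ball 0 1" "\<And>z. z \<in> ball 0 1 \<Longrightarrow> g z = 1 + z * L z"
    using holomorphic_factor_out[OF g(1)] g(2) by auto
  have "1 + w = exp (w + w\<^sup>2 * L w)" if "norm w < 1" for w
  proof -
    have "w + w\<^sup>2 * L w = Ln (1 + w)" using g(3)[of w] L(2)[of w] that by (simp add: algebra_simps power2_eq_square)
    moreover have "1 + w \<noteq> 0" using re[OF that] by auto
    ultimately show ?thesis by (simp add: exp_Ln)
  qed
  then show thesis using L(1) that by blast
qed

text \<open>As the mean is 0, the moment generating function is \<open>1 + x\<^sup>2 * V x\<close>;
  on a disc where \<open>\<bar>x\<^sup>2 * V x\<bar> < 1\<close> it has a logarithm.
  \<open>G\<close> collects the cumulants from the third on. The argument is complex so that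
  \<open>x\<close> can be taken on the imaginary axis.\<close>

lemma cumulant_expansion:
  fixes a p :: "nat \<Rightarrow> real" and J :: "nat set" and s :: real
  assumes p: "(\<Sum>j\<in>J. p j) = 1" and mean: "(\<Sum>j\<in>J. p j * a j) = 0" and var: "(\<Sum>j\<in>J. p j * (a j)\<^sup>2) = s\<^sup>2"
  obtains \<rho> G where "\<rho> > 0" "G holomorphic_on ball 0 \<rho>"
    "\<And>x. norm x < \<rho> \<Longrightarrow> (\<Sum>j\<in>J. of_real (p j) * exp (of_real (a j) * x)) = exp (of_real (s\<^sup>2) / 2 * x\<^sup>2 + x ^ 3 * G x)"
proof -
  obtain E :: "complex \<Rightarrow> complex" where E: "E holomorphic_on UNIV" "\<And>z. exp z = 1 + z + z\<^sup>2 / 2 + z ^ 3 * E z"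
    by (rule exp_third_order) blast
  obtain L where L: "L holomorphic_on ball 0 1" "\<And>w. norm w < 1 \<Longrightarrow> 1 + w = exp (w + w\<^sup>2 * L w)"
    by (rule Ln_second_order) blast
  define W where "W = (\<lambda>x. \<Sum>j\<in>J. of_real (p j) * of_real (a j) ^ 3 * E (of_real (a j) * x))"
  define V where "V = (\<lambda>x. of_real (s\<^sup>2) / 2 + x * W x)"
  have E': "(\<lambda>x. E (c * x)) holomorphic_on UNIV" for c
    using holomorphic_on_compose_gen[OF _ E(1), of "\<lambda>x. c * x" UNIV]
    by (auto simp: o_def intro!: holomorphic_intros)
  have W: "W holomorphic_on UNIV" unfolding W_def by (intro holomorphic_intros E')
  have V: "V holomorphic_on UNIV" unfolding V_def by (intro holomorphic_intros W)
  have M: "(\<Sum>j\<in>J. of_real (p j) * exp (of_real (a j) * x)) = 1 + x\<^sup>2 * V x" for x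
  proof -
    have "(\<Sum>j\<in>J. of_real (p j) * exp (of_real (a j) * x))
      = (\<Sum>j\<in>J. of_real (p j) + x * of_real (p j * a j) + x\<^sup>2 / 2 * of_real (p j * (a j)\<^sup>2)
           + x ^ 3 * (of_real (p j) * of_real (a j) ^ 3 * E (of_real (a j) * x)))"
      by (intro sum.cong refl, subst E(2)) (simp add: algebra_simps power_mult_distrib)
    also have "\<dots> = of_real (\<Sum>j\<in>J. p j) + x * of_real (\<Sum>j\<in>J. p j * a j)
       + x\<^sup>2 / 2 * of_real (\<Sum>j\<in>J. p j * (a j)\<^sup>2) + x ^ 3 * W x"
      by (simp add: sum.distrib sum_distrib_left W_def)
    finally show ?thesis
      by (simp only: p mean var) (simp add: V_def algebra_simps power2_eq_square power3_eq_cube)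
  qed
  have cont: "isCont (\<lambda>x. x\<^sup>2 * V x) 0"
    using V by (intro continuous_intros holomorphic_on_imp_continuous_on[THEN continuous_on_interior, of V UNIV]) auto
  obtain \<rho> where "\<rho> > 0" "\<And>x. dist x 0 < \<rho> \<Longrightarrow> dist (x\<^sup>2 * V x) (0\<^sup>2 * V 0) < 1"
    using cont[unfolded continuous_at_eps_delta, rule_format, of 1] by auto
  then have \<rho>: "\<rho> > 0" "\<And>x. norm x < \<rho> \<Longrightarrow> norm (x\<^sup>2 * V x) < 1"
    by (simp_all add: dist_norm)
  define G where "G = (\<lambda>x. W x + x * (V x)\<^sup>2 * L (x\<^sup>2 * V x))"
  show thesis
  proof (rule that[OF \<rho>(1)])
    have V': "V holomorphic_on ball 0 \<rho>" and W': "W holomorphic_on ball 0 \<rho>"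
      using V W holomorphic_on_subset by blast+
    have "(L \<circ> (\<lambda>x. x\<^sup>2 * V x)) holomorphic_on ball 0 \<rho>"
      by (rule holomorphic_on_compose_gen[OF _ L(1)]) (use \<rho> V' in \<open>auto intro!: holomorphic_intros\<close>)
    then show "G holomorphic_on ball 0 \<rho>"
      unfolding G_def using V' W' by (intro holomorphic_intros) (auto simp: o_def)
    show "(\<Sum>j\<in>J. of_real (p j) * exp (of_real (a j) * x)) = exp (of_real (s\<^sup>2) / 2 * x\<^sup>2 + x ^ 3 * G x)"
      if x: "norm x < \<rho>" for x
    proof -
      have "of_real (s\<^sup>2) / 2 * x\<^sup>2 + x ^ 3 * G x = x\<^sup>2 * V x + (x\<^sup>2 * V x)\<^sup>2 * L (x\<^sup>2 * V x)"
        by (simp add: G_def V_def algebra_simps power2_eq_square power3_eq_cube)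
      then show ?thesis unfolding M using L(2)[OF \<rho>(2)[OF x]] by simp
    qed
  qed
qed

text \<open>One factor \<open>x\<close> is kept apart from the weight: it becomes the
  \<open>\<bar>t\<bar>\<close> that cancels the division in the smoothing inequality.\<close>

lemma power_le_polynomial_weight:
  fixes x :: real
  assumes "x \<ge> 0" "1 \<le> k" "k \<le> Suc D"
  shows "x ^ k \<le> x * (1 + x) ^ D"
proof -
  obtain l where l: "k = Suc l" "l \<le> D" using assms(2,3) by (cases k) auto
  have "x ^ l \<le> (1 + x) ^ l" using assms(1) by (intro power_mono) auto
  also have "\<dots> \<le> (1 + x) ^ D" using assms(1) l by (intro power_increasing) auto
  finally show ?thesis using assms(1) l by (simp add: mult_left_mono)
qed

text \<open>The polynomial \<open>q k\<close> collects the terms of order \<open>u ^ k\<close> after truncating the exponential series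
  at \<open>m = r\<close> and each \<open>g ^ m\<close> at the order that completes \<open>u ^ m\<close> to \<open>u ^ r\<close>.\<close>

lemma exp_scaled_expansion:
  fixes g :: "complex \<Rightarrow> complex"
  assumes g: "g holomorphic_on ball 0 \<rho>" and \<rho>: "\<rho> > 0"
  obtains q :: "nat \<Rightarrow> complex poly" and \<delta> C :: real
    where "\<delta> > 0" "\<delta> < \<rho>" "C > 0" "\<And>k. coeff (q k) 0 = 0"
      "\<And>u y. u > 0 \<Longrightarrow> u * norm y \<le> \<delta> \<Longrightarrow>
         norm (exp (of_real u * y ^ 3 * g (of_real u * y)) - (1 + (\<Sum>k=1..r. of_real u ^ k * poly (q k) y)))
           \<le> C * u ^ Suc r * (norm y * (1 + norm y) ^ (3 * r + 2)) * exp ((norm y)\<^sup>2 / 4)"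
proof -
  obtain B0 where B0: "B0 > 0" "\<And>z. norm z \<le> \<rho> / 2 \<Longrightarrow> norm (g z) \<le> B0"
    using holomorphic_bounded_on_cball[OF g, of "\<rho> / 2"] \<rho> by auto
  have "\<forall>m. \<exists>c B. B > 0 \<and> (\<forall>z. norm z \<le> \<rho> / 2 \<longrightarrow>
      norm ((g z) ^ m - (\<Sum>l<Suc r - m. c l * z ^ l)) \<le> B * norm z ^ (Suc r - m))"
    using holomorphic_taylor_bound[of "\<lambda>z. (g z) ^ m" \<rho> "\<rho> / 2" for m] g \<rho>
    by (auto intro!: holomorphic_intros)
  then obtain c B where B: "\<And>m. B m > (0::real)" and
    cB: "\<And>m z. norm z \<le> \<rho> / 2 \<Longrightarrow> norm ((g z) ^ m - (\<Sum>l<Suc r - m. c m l * z ^ l)) \<le> B m * norm z ^ (Suc r - m)"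
    by metis
  define q :: "nat \<Rightarrow> complex poly" where "q k = (\<Sum>m=1..r. \<Sum>l<Suc r - m. if m + l = k then monom (c m l / fact m) (3 * m + l) else 0)" for k
  \<comment> \<open>The first bound keeps \<open>u * y\<close> in a compact disc. The second gives
    \<open>norm w \<le> (norm y)\<^sup>2 / 4\<close>, so that \<open>exp w\<close> uses up only half
    of the Gaussian exponent.\<close>
  define \<delta> where "\<delta> = min (\<rho> / 2) (1 / (4 * B0))"
  define C where "C = B0 ^ Suc r + (\<Sum>m=1..r. B m) + 1"
  show thesis
  proof (rule that)
    show "\<delta> > 0" "\<delta> < \<rho>" using \<rho> B0 by (auto simp: \<delta>_def)
    show "C > 0" unfolding C_def using B0 B by (intro add_nonneg_pos add_nonneg_nonneg sum_nonneg) (auto intro: less_imp_le)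
    show "coeff (q k) 0 = 0" for k
      unfolding q_def coeff_sum by (intro sum.neutral ballI) auto
    fix u :: real and y :: complex
    assume u: "u > 0" and uy: "u * norm y \<le> \<delta>"
    define w where "w = of_real u * y ^ 3 * g (of_real u * y)"
    define N where "N = norm y * (1 + norm y) ^ (3 * r + 2)"
    have N0: "N \<ge> 0" by (simp add: N_def)
    have uy2: "norm (of_real u * y) \<le> \<rho> / 2" using u uy by (simp add: norm_mult \<delta>_def)
    have gB: "norm (g (of_real u * y)) \<le> B0" by (rule B0(2)[OF uy2])
    have w1: "norm w \<le> u * norm y ^ 3 * B0"
      unfolding w_def norm_mult norm_power using gB u by (intro mult_mono) auto
    have w2: "norm w \<le> (norm y)\<^sup>2 / 4"
    proof -
      have "u * norm y \<le> 1 / (4 * B0)" using uy by (simp add: \<delta>_def)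
      then have "(u * norm y) * B0 \<le> 1 / 4" using B0 by (simp add: field_simps)
      then have "(norm y)\<^sup>2 * ((u * norm y) * B0) \<le> (norm y)\<^sup>2 * (1 / 4)" by (intro mult_left_mono) auto
      then show ?thesis using w1 by (simp add: power2_eq_square power3_eq_cube mult_ac)
    qed
    have sum_eq: "(\<Sum>k=1..r. of_real u ^ k * poly (q k) y)
      = (\<Sum>m=1..r. (of_real u * y ^ 3) ^ m / fact m * (\<Sum>l<Suc r - m. c m l * (of_real u * y) ^ l))"
    proof -
      have "(\<Sum>k=1..r. of_real u ^ k * poly (q k) y)
        = (\<Sum>k=1..r. \<Sum>m=1..r. \<Sum>l<Suc r - m. if m + l = k then of_real u ^ k * (c m l / fact m * y ^ (3 * m + l)) else 0)"
        by (simp add: q_def poly_sum sum_distrib_left poly_monom if_distrib[of "\<lambda>p. poly p y"] if_distrib[of "\<lambda>z. _ * z"] cong: if_cong)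
      also have "\<dots> = (\<Sum>m=1..r. \<Sum>l<Suc r - m. \<Sum>k=1..r. if m + l = k then of_real u ^ k * (c m l / fact m * y ^ (3 * m + l)) else 0)"
        by (subst sum.swap) (intro sum.cong refl sum.swap)
      \<comment> \<open>The range of \<open>l\<close> puts \<open>m + l\<close> between 1 and
        \<open>r\<close>, so exactly one \<open>k\<close> is hit.\<close>
      also have "\<dots> = (\<Sum>m=1..r. \<Sum>l<Suc r - m. of_real u ^ (m + l) * (c m l / fact m * y ^ (3 * m + l)))"
        by (intro sum.cong refl) (subst sum.delta', auto)
      also have "\<dots> = (\<Sum>m=1..r. (of_real u * y ^ 3) ^ m / fact m * (\<Sum>l<Suc r - m. c m l * (of_real u * y) ^ l))"
        unfolding sum_distrib_left
        by (intro sum.cong refl) (simp add: power_add power_mult_distrib power_mult)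
      finally show ?thesis .
    qed
    \<comment> \<open>The remainder contains \<open>norm y\<close> to the power
      \<open>3 * r + 3\<close>, the largest that occurs; splitting off one factor leaves the
      exponent \<open>3 * r + 2\<close> of the weight.\<close>
    have err1: "norm (exp w - (\<Sum>m\<le>r. w ^ m / fact m)) \<le> B0 ^ Suc r * u ^ Suc r * N * exp ((norm y)\<^sup>2 / 4)"
    proof -
      have "norm (exp w - (\<Sum>m\<le>r. w ^ m / fact m)) \<le> exp \<bar>Re w\<bar> * (norm w ^ Suc r) / fact r"
        by (rule Taylor_exp)
      also have "\<dots> \<le> exp \<bar>Re w\<bar> * (norm w ^ Suc r) / 1"
        by (intro divide_left_mono) auto
      also have "\<dots> \<le> exp ((norm y)\<^sup>2 / 4) * (u * norm y ^ 3 * B0) ^ Suc r / 1"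
        using w1 w2 abs_Re_le_cmod[of w] by (intro divide_right_mono mult_mono power_mono) auto
      also have "\<dots> = B0 ^ Suc r * u ^ Suc r * norm y ^ (3 * Suc r) * exp ((norm y)\<^sup>2 / 4)"
        by (simp only: power_mult_distrib power_mult) simp
      also have "norm y ^ (3 * Suc r) \<le> N"
        unfolding N_def by (rule power_le_polynomial_weight) auto
      finally show ?thesis using B0 u by (simp add: mult_left_mono mult_right_mono)
    qed
    have err2: "norm (w ^ m / fact m - (of_real u * y ^ 3) ^ m / fact m * (\<Sum>l<Suc r - m. c m l * (of_real u * y) ^ l))
       \<le> B m * u ^ Suc r * N * exp ((norm y)\<^sup>2 / 4)" if m: "m \<in> {1..r}" for m
    proof -
      have "w ^ m / fact m - (of_real u * y ^ 3) ^ m / fact m * (\<Sum>l<Suc r - m. c m l * (of_real u * y) ^ l)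
        = (of_real u * y ^ 3) ^ m / fact m * (g (of_real u * y) ^ m - (\<Sum>l<Suc r - m. c m l * (of_real u * y) ^ l))"
        by (simp add: w_def power_mult_distrib algebra_simps)
      also have "norm \<dots> \<le> (u * norm y ^ 3) ^ m / 1 * (B m * norm (of_real u * y) ^ (Suc r - m))"
        unfolding norm_mult norm_divide norm_power
        using cB[OF uy2, of m] u by (intro mult_mono divide_mono) (auto simp: norm_mult)
      also have "\<dots> = B m * u ^ (m + (Suc r - m)) * norm y ^ (3 * m + (Suc r - m))"
        using u by (simp only: power_add power_mult_distrib power_mult norm_mult) simp
      also have "m + (Suc r - m) = Suc r" using m by simp
      also have "norm y ^ (3 * m + (Suc r - m)) \<le> N"
        unfolding N_def by (rule power_le_polynomial_weight) (use m in auto)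
      finally have "norm (w ^ m / fact m - (of_real u * y ^ 3) ^ m / fact m * (\<Sum>l<Suc r - m. c m l * (of_real u * y) ^ l))
        \<le> B m * u ^ Suc r * N" using B[of m] u by (simp add: mult_left_mono)
      also have "\<dots> \<le> B m * u ^ Suc r * N * exp ((norm y)\<^sup>2 / 4)"
        using mult_left_mono[of 1 "exp ((norm y)\<^sup>2 / 4)" "B m * u ^ Suc r * N"] B[of m] u N0 by simp
      finally show ?thesis .
    qed
    have "(\<Sum>m\<le>r. w ^ m / fact m) = 1 + (\<Sum>m=1..r. w ^ m / fact m)"
      by (simp add: atMost_atLeast0 sum.atLeast_Suc_atMost)
    then have "exp w - (1 + (\<Sum>k=1..r. of_real u ^ k * poly (q k) y))
      = (exp w - (\<Sum>m\<le>r. w ^ m / fact m)) + (\<Sum>m=1..r. w ^ m / fact m - (of_real u * y ^ 3) ^ m / fact m * (\<Sum>l<Suc r - m. c m l * (of_real u * y) ^ l))"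
      unfolding sum_eq sum_subtractf by simp
    also have "norm \<dots> \<le> B0 ^ Suc r * u ^ Suc r * N * exp ((norm y)\<^sup>2 / 4) + (\<Sum>m=1..r. B m * u ^ Suc r * N * exp ((norm y)\<^sup>2 / 4))"
      by (intro order_trans[OF norm_triangle_ineq] add_mono err1 order_trans[OF norm_sum] sum_mono err2)
    also have "\<dots> = (B0 ^ Suc r + (\<Sum>m=1..r. B m)) * u ^ Suc r * N * exp ((norm y)\<^sup>2 / 4)"
      by (simp only: distrib_right sum_distrib_right)
    also have "\<dots> \<le> C * u ^ Suc r * N * exp ((norm y)\<^sup>2 / 4)"
      using u N0 by (intro mult_right_mono) (auto simp: C_def)
    finally show "norm (exp (of_real u * y ^ 3 * g (of_real u * y)) - (1 + (\<Sum>k=1..r. of_real u ^ k * poly (q k) y)))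
           \<le> C * u ^ Suc r * (norm y * (1 + norm y) ^ (3 * r + 2)) * exp ((norm y)\<^sup>2 / 4)"
      unfolding w_def N_def .
  qed
qed

subsection \<open>Diophantine vectors\<close>

abbreviation two_pi_ints :: "real set" where
  "two_pi_ints \<equiv> range (\<lambda>k::int. 2 * pi * of_int k)"

text \<open>The set of multiples of \<open>2 * pi\<close> is mapped into itself by multiplication
  with \<open>m\<close>, and this multiplication stretches distances by \<open>m\<close>.\<close>

lemma infdist_two_pi_ints_mult:
  "infdist (real m * x) two_pi_ints \<le> real m * infdist x two_pi_ints"
proof (cases "m = 0")
  case True
  have "infdist 0 two_pi_ints = 0" by (rule in_closure_iff_infdist_zero[THEN iffD1, rotated, OF closure_subset[THEN subsetD]]) (auto intro!: range_eqI[of _ _ 0])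
  then show ?thesis using True by simp
next
  case False
  have "infdist (real m * x) two_pi_ints / real m \<le> dist x y" if y: "y \<in> two_pi_ints" for y
  proof -
    obtain k :: int where k: "y = 2 * pi * of_int k" using y by blast
    have "real m * y = 2 * pi * of_int (int m * k)" by (simp add: k)
    then have "real m * y \<in> two_pi_ints" by blast
    then have "infdist (real m * x) two_pi_ints \<le> dist (real m * x) (real m * y)" by (rule infdist_le)
    also have "\<dots> = real m * dist x y" by (simp add: dist_real_def abs_mult flip: right_diff_distrib)
    finally show ?thesis using False by (simp add: field_simps)
  qed
  then have "infdist (real m * x) two_pi_ints / real m \<le> infdist x two_pi_ints"
    by (subst infdist_notempty) (auto intro!: cINF_greatest)
  then show ?thesis using False by (simp add: field_simps)
qed

lemma dioph_dist_attained:
  assumes "d \<ge> 1"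
  obtains j where "j \<in> {2..d+1}" "dioph_dist d a s = infdist ((a j - a 1) * s) two_pi_ints"
proof -
  let ?f = "\<lambda>j. infdist ((a j - a 1) * s) two_pi_ints"
  have "Max (?f ` {2..d+1}) \<in> ?f ` {2..d+1}"
    using assms by (intro Max_in) auto
  then show thesis using that by (auto simp: dioph_dist_def)
qed

lemma dioph_dist_mult: "d \<ge> 1 \<Longrightarrow> dioph_dist d a (real m * s) \<le> real m * dioph_dist d a s"
proof -
  assume d: "d \<ge> 1"
  obtain j where j: "j \<in> {2..d+1}" "dioph_dist d a (real m * s) = infdist ((a j - a 1) * (real m * s)) two_pi_ints"
    using dioph_dist_attained[OF d] .
  have "infdist (real m * ((a j - a 1) * s)) two_pi_ints \<le> real m * infdist ((a j - a 1) * s) two_pi_ints"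
    by (rule infdist_two_pi_ints_mult)
  also have "\<dots> \<le> real m * dioph_dist d a s"
    unfolding dioph_dist_def using j(1) by (intro mult_left_mono Max_ge) auto
  finally show ?thesis unfolding j(2) by (simp only: mult.left_commute)
qed

text \<open>Passing to a multiple of \<open>s\<close> transfers the Diophantine bound from \<open>\<bar>s\<bar> > 1\<close> to all \<open>s\<close>
  bounded away from \<open>0\<close>.\<close>

lemma diophantine_lower_bound:
  assumes dio: "diophantine d \<beta> a" and d: "d \<ge> 1" and \<delta>: "\<delta> > 0"
  obtains K where "K > 0" "\<And>s. \<bar>s\<bar> \<ge> \<delta> \<Longrightarrow> dioph_dist d a s \<ge> K * \<bar>s\<bar> powr (- \<beta>)"
proof -
  obtain K where K: "K > 0" "\<And>s. \<bar>s\<bar> > 1 \<Longrightarrow> dioph_dist d a s \<ge> K * \<bar>s\<bar> powr (- \<beta>)"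
    using dio by (auto simp: diophantine_def)
  \<comment> \<open>One fixed multiplier moves every \<open>s\<close> with
    \<open>\<bar>s\<bar> \<ge> \<delta>\<close> beyond 1; it costs the constant factor
    \<open>m powr (- \<beta>) / m\<close>.\<close>
  obtain m :: nat where m: "real m > 1 / \<delta>" using reals_Archimedean2 by blast
  have m0: "real m > 0" using m \<delta> by (meson divide_pos_pos less_trans zero_less_one)
  show thesis
  proof (rule that[of "K * real m powr (- \<beta>) / real m"])
    show "K * real m powr (- \<beta>) / real m > 0" using K m0 by simp
    fix s assume s: "\<bar>s\<bar> \<ge> \<delta>"
    have "1 < real m * \<delta>" using m \<delta> by (simp add: field_simps)
    also have "\<dots> \<le> real m * \<bar>s\<bar>" using s m0 by simp
    finally have "\<bar>real m * s\<bar> > 1" by (simp add: abs_mult)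
    then have "K * \<bar>real m * s\<bar> powr (- \<beta>) \<le> dioph_dist d a (real m * s)" by (rule K(2))
    also have "\<dots> \<le> real m * dioph_dist d a s" using d by (rule dioph_dist_mult)
    also have "K * \<bar>real m * s\<bar> powr (- \<beta>) = K * real m powr (- \<beta>) * \<bar>s\<bar> powr (- \<beta>)"
      by (simp add: abs_mult powr_mult)
    finally show "K * real m powr (- \<beta>) / real m * \<bar>s\<bar> powr (- \<beta>) \<le> dioph_dist d a s"
      using m0 by (simp add: field_simps)
  qed
qed

lemma infdist_two_pi_ints_0: "infdist 0 two_pi_ints = 0"
  using infdist_two_pi_ints_mult[of 0 0] infdist_nonneg[of 0 two_pi_ints] by simp

text \<open>With all entries equal, \<open>dioph_dist\<close> would vanish identically;
  \<open>s = 2\<close> is a test point beyond 1. The lemma supplies a positive variance and a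
  denominator for Dirichlet's theorem.\<close>

lemma diophantine_imp_differs:
  assumes "diophantine d \<beta> a" "d \<ge> 1"
  obtains j where "j \<in> {2..d+1}" "a j \<noteq> a 1"
proof -
  obtain K where K: "K > 0" "\<And>s. \<bar>s\<bar> > 1 \<Longrightarrow> dioph_dist d a s \<ge> K * \<bar>s\<bar> powr (- \<beta>)"
    using assms by (auto simp: diophantine_def)
  have "dioph_dist d a 2 > 0" using K(2)[of 2] K(1) by (smt (verit) mult_pos_pos powr_gt_zero)
  moreover obtain j where "j \<in> {2..d+1}" "dioph_dist d a 2 = infdist ((a j - a 1) * 2) two_pi_ints"
    using dioph_dist_attained[OF assms(2)] .
  ultimately show thesis using that[of j] infdist_two_pi_ints_0 by force
qed

text \<open>Dirichlet's theorem is applied to the \<open>d - 1\<close> quotients \<open>(a j - a 1) / (a j0 - a 1)\<close>, \<open>j \<noteq> j0\<close>.\<close>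

lemma diophantine_exponent:
  assumes dio: "diophantine d \<beta> a" and d: "d \<ge> 2" and \<beta>: "\<beta> \<ge> 0"
  shows "real (d - 1) * \<beta> \<ge> 1"
proof (rule ccontr)
  assume "\<not> real (d - 1) * \<beta> \<ge> 1"
  define \<epsilon> where "\<epsilon> = 1 - real (d - 1) * \<beta>"
  have \<epsilon>: "\<epsilon> > 0" using \<open>\<not> _\<close> by (simp add: \<epsilon>_def)
  have d1: "d \<ge> 1" using d by simp
  obtain j0 where j0: "j0 \<in> {2..d+1}" "a j0 \<noteq> a 1"
    using diophantine_imp_differs[OF dio d1] .
  define b where "b j = a j - a 1" for j
  have b0: "b j0 \<noteq> 0" using j0 by (simp add: b_def)
  \<comment> \<open>The smallest modulus of the frequencies \<open>2 * pi * q / b j0\<close> with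
    \<open>q \<ge> 1\<close>, the only ones considered below.\<close>
  define \<delta> where "\<delta> = 2 * pi / \<bar>b j0\<bar>"
  have \<delta>: "\<delta> > 0" using b0 by (simp add: \<delta>_def)
  obtain K where K: "K > 0" "\<And>s. \<bar>s\<bar> \<ge> \<delta> \<Longrightarrow> dioph_dist d a s \<ge> K * \<bar>s\<bar> powr (- \<beta>)"
    using diophantine_lower_bound[OF dio d1 \<delta>] by blast
  have "card ({2..d+1} - {j0}) = d - 1" using j0 by simp
  then obtain e where e: "bij_betw e {0..<d - 1} ({2..d+1} - {j0})"
    using ex_bij_betw_nat_finite[of "{2..d+1} - {j0}"] by auto
  \<comment> \<open>Dirichlet with denominators up to \<open>N ^ (d - 1)\<close> brings the distance
    down to order \<open>1 / N\<close>, whereas the Diophantine bound keeps it above order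
    \<open>N powr (- (d - 1) * \<beta>)\<close>. The quotient \<open>N powr \<epsilon>\<close> would
    be bounded.\<close>
  have bound: "real N powr \<epsilon> \<le> 2 * pi / (K * \<delta> powr (- \<beta>))" if N: "N > 0" for N :: nat
  proof -
    obtain q p where q: "0 < q" "q \<le> int (N ^ (d - 1))"
      and qp: "\<And>i. i < d - 1 \<Longrightarrow> \<bar>of_int q * (b (e i) / b j0) - of_int (p i)\<bar> < 1 / real N"
      using Dirichlet_approx_simult[OF N, of "d - 1" "\<lambda>i. b (e i) / b j0"] by metis
    \<comment> \<open>This choice puts \<open>b j0 * s\<close> exactly on a multiple of
      \<open>2 * pi\<close>, so only \<open>d - 1\<close> phases need approximation.\<close>
    define s where "s = 2 * pi * of_int q / b j0"
    have s_abs: "\<bar>s\<bar> = \<delta> * of_int q" using q by (simp add: s_def \<delta>_def abs_mult)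
    have s\<delta>: "\<bar>s\<bar> \<ge> \<delta>" unfolding s_abs using \<delta> q by simp
    have s0: "\<bar>s\<bar> > 0" using s\<delta> \<delta> by linarith
    obtain j where j: "j \<in> {2..d+1}" "dioph_dist d a s = infdist (b j * s) two_pi_ints"
      using dioph_dist_attained[OF d1] unfolding b_def .
    have "infdist (b j * s) two_pi_ints \<le> 2 * pi / real N"
    proof (cases "j = j0")
      case True
      then have "b j * s = 2 * pi * of_int q" using b0 by (simp add: s_def)
      then have "b j * s \<in> two_pi_ints" by blast
      then have "infdist (b j * s) two_pi_ints = 0" by (rule infdist_zero)
      then show ?thesis using N by simp
    next
      case False
      then have "j \<in> e ` {0..<d - 1}" using e j(1) by (simp add: bij_betw_def)
      then obtain i where i: "i < d - 1" "e i = j" by auto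
      have "infdist (b j * s) two_pi_ints \<le> dist (b j * s) (2 * pi * of_int (p i))"
        by (rule infdist_le) blast
      also have "\<dots> = 2 * pi * \<bar>of_int q * (b (e i) / b j0) - of_int (p i)\<bar>"
      proof -
        have "b j * s - 2 * pi * of_int (p i) = 2 * pi * (of_int q * (b (e i) / b j0) - of_int (p i))"
          by (simp add: s_def i algebra_simps)
        then show ?thesis by (simp add: dist_real_def abs_mult)
      qed
      also have "\<dots> \<le> 2 * pi * (1 / real N)" using qp[OF i(1)] by (intro mult_left_mono) auto
      finally show ?thesis by simp
    qed
    then have "K * \<bar>s\<bar> powr (- \<beta>) \<le> 2 * pi / real N" using K(2)[OF s\<delta>] j(2) by simp
    moreover have "(\<delta> * real N ^ (d - 1)) powr (- \<beta>) \<le> \<bar>s\<bar> powr (- \<beta>)"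
    proof (rule powr_mono2')
      have "real_of_int q \<le> real N ^ (d - 1)" using q(2) by (metis of_int_le_iff of_int_of_nat_eq of_nat_power)
      then show "\<bar>s\<bar> \<le> \<delta> * real N ^ (d - 1)" unfolding s_abs using \<delta> by simp
    qed (use s0 \<beta> in auto)
    ultimately have "K * (\<delta> * real N ^ (d - 1)) powr (- \<beta>) \<le> 2 * pi / real N"
      using K(1) by (meson mult_left_mono less_imp_le order_trans)
    also have "(\<delta> * real N ^ (d - 1)) powr (- \<beta>) = \<delta> powr (- \<beta>) * real N powr (- real (d - 1) * \<beta>)"
      using \<delta> N by (simp add: powr_mult powr_powr flip: powr_realpow)
    finally have "K * \<delta> powr (- \<beta>) * (real N * real N powr (- real (d - 1) * \<beta>)) \<le> 2 * pi"
      using N by (simp add: field_simps)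
    also have "real N * real N powr (- real (d - 1) * \<beta>) = real N powr \<epsilon>"
      using N by (simp add: \<epsilon>_def powr_diff powr_minus divide_inverse)
    finally show ?thesis using K(1) \<delta> by (simp add: field_simps)
  qed
  have "filterlim (\<lambda>N. real N powr \<epsilon>) at_top sequentially"
    using \<epsilon> by (intro filterlim_compose[OF real_powr_at_top filterlim_real_sequentially])
  then have "\<forall>\<^sub>F N in sequentially. real N powr \<epsilon> > 2 * pi / (K * \<delta> powr (- \<beta>))"
    by (simp add: filterlim_at_top_dense)
  then have "\<forall>\<^sub>F N in sequentially. real N powr \<epsilon> > 2 * pi / (K * \<delta> powr (- \<beta>)) \<and> N > 0"
    by (intro eventually_conj eventually_gt_at_top)
  then obtain N :: nat where "real N powr \<epsilon> > 2 * pi / (K * \<delta> powr (- \<beta>))" "N > 0"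
    using eventually_happens'[OF sequentially_bot] by blast
  then show False using bound[of N] by linarith
qed

section \<open>From the distance of the phases to the modulus of the characteristic function\<close>

lemma one_minus_cos_ge_square:
  fixes y :: real
  assumes "\<bar>y\<bar> \<le> pi"
  shows "1 - cos y \<ge> y\<^sup>2 / 25"
proof -
  have taylor: "cos x \<le> 1 - x\<^sup>2 / 2 + x ^ 4 / 24" for x :: real
  proof -
    have "\<bar>Re (iexp x - (\<Sum>k\<le>3. (\<i> * x)^k / fact k))\<bar> \<le> \<bar>x\<bar>^(Suc 3) / fact (Suc 3)"
      by (rule order_trans[OF abs_Re_le_cmod iexp_approx1])
    also have "\<dots> = x ^ 4 / 24"
      by (simp add: fact_numeral eval_nat_numeral)
    finally have "\<bar>Re (iexp x - (\<Sum>k\<le>3. (\<i> * x)^k / fact k))\<bar> \<le> x ^ 4 / 24" .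
    moreover have "Re (iexp x - (\<Sum>k\<le>3. (\<i> * x)^k / fact k)) = cos x - 1 + x\<^sup>2 / 2"
      by (simp add: atMost_nat_numeral fact_numeral power_mult_distrib Re_exp power3_eq_cube power2_eq_square)
    ultimately show ?thesis by linarith
  qed
  show ?thesis
  \<comment> \<open>Up to 1 the Taylor bound gives at least \<open>11/24 * y\<^sup>2\<close>. From 1
    to \<open>pi\<close> the left side is at least \<open>11/24\<close>, while
    \<open>pi\<^sup>2 / 25\<close> is at most about 0.41: this determines the order of the constant
    25.\<close>
  proof (cases "\<bar>y\<bar> \<le> 1")
    case True
    then have "y\<^sup>2 \<le> 1" by (simp add: abs_square_le_1)
    then have "y\<^sup>2 * y\<^sup>2 \<le> y\<^sup>2 * 1" by (intro mult_left_mono) auto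
    then have "y ^ 4 \<le> y\<^sup>2" by (simp add: power2_eq_square eval_nat_numeral mult_ac)
    then show ?thesis using taylor[of y] zero_le_power2[of y] by linarith
  next
    case False
    have "cos y = cos \<bar>y\<bar>" by (simp add: abs_if)
    also have "\<dots> \<le> cos 1" using False assms by (intro cos_monotone_0_pi_le) auto
    also have "\<dots> \<le> 13 / 24" using taylor[of 1] by simp
    finally have "1 - cos y \<ge> 11 / 24" by simp
    moreover have "y\<^sup>2 \<le> pi\<^sup>2" using assms by (metis abs_ge_zero power2_abs power_mono)
    moreover have "pi\<^sup>2 \<le> (16/5)\<^sup>2" using pi_approx by (intro power_mono) auto
    ultimately show ?thesis by (simp add: power2_eq_square)
  qed
qed

text \<open>Rounding \<open>x / (2 * pi)\<close> reduces to \<open>\<bar>y\<bar> \<le> pi\<close>.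
  As \<open>infdist\<close> is an infimum, the chosen multiple need not be shown to be the
  nearest.\<close>

lemma one_minus_cos_ge_infdist:
  "1 - cos x \<ge> (infdist x two_pi_ints)\<^sup>2 / 25"
proof -
  define k where "k = round (x / (2 * pi))"
  define y where "y = x - 2 * pi * of_int k"
  have "\<bar>x / (2 * pi) - of_int k\<bar> \<le> 1 / 2"
    unfolding k_def using of_int_round_abs_le[of "x / (2 * pi)"] by (simp add: abs_minus_commute)
  then have "\<bar>2 * pi * (x / (2 * pi) - of_int k)\<bar> \<le> 2 * pi * (1 / 2)"
    unfolding abs_mult by (intro mult_mono) auto
  then have y: "\<bar>y\<bar> \<le> pi" by (simp add: y_def algebra_simps)
  have "x = y + 2 * pi * of_int k" by (simp add: y_def)
  then have "cos x = cos y" by (simp only: cos_add sin_int_2pin cos_int_2pin mult_1_right mult_zero_right diff_zero)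
  moreover have "infdist x two_pi_ints \<le> \<bar>y\<bar>"
    using infdist_le[of "2 * pi * of_int k" two_pi_ints x] by (simp add: dist_real_def y_def)
  then have "(infdist x two_pi_ints)\<^sup>2 \<le> y\<^sup>2" by (metis infdist_nonneg power2_abs power_mono)
  ultimately show ?thesis using one_minus_cos_ge_square[OF y] by simp
qed

text \<open>With \<open>e = p * q * (1 - cos (y - x))\<close> the squared modulus is
  \<open>(p + q)\<^sup>2 - 2 * e\<close>. Because \<open>p + q \<le> 1\<close>, this is at most
  \<open>(p + q)\<^sup>2 - 2 * e * (p + q)\<close>, hence at most
  \<open>(p + q - e)\<^sup>2\<close>.\<close>

lemma norm_two_phases_le:
  fixes p q x y :: real
  assumes "p \<ge> 0" "q \<ge> 0" "p + q \<le> 1"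
  shows "norm (of_real p * iexp x + of_real q * iexp y) \<le> p + q - p * q * (1 - cos (y - x))"
proof (rule power2_le_imp_le)
  let ?e = "p * q * (1 - cos (y - x))"
  have c: "0 \<le> 1 - cos (y - x)" "1 - cos (y - x) \<le> 2" 
    by (simp, smt (verit) cos_ge_minus_one)
  have e0: "?e \<ge> 0" using assms c by simp
  have "?e \<le> p * q * 2" using assms c by (intro mult_left_mono) auto
  also have "p * q * 2 \<le> p + q"
    using assms mult_left_le[of q p] mult_left_le[of p q] by (simp add: mult.commute)
  finally show "0 \<le> p + q - ?e" by simp
  have "(norm (of_real p * iexp x + of_real q * iexp y))\<^sup>2 = (p + q)\<^sup>2 - 2 * ?e"
  proof -
    have "(norm (of_real p * iexp x + of_real q * iexp y))\<^sup>2 = (p * cos x + q * cos y)\<^sup>2 + (p * sin x + q * sin y)\<^sup>2"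
      by (simp add: cmod_power2 Re_exp Im_exp)
    also have "\<dots> = p\<^sup>2 * ((sin x)\<^sup>2 + (cos x)\<^sup>2) + q\<^sup>2 * ((sin y)\<^sup>2 + (cos y)\<^sup>2) + 2 * p * q * cos (y - x)"
      unfolding cos_diff by (simp only: power2_eq_square) algebra
    also have "\<dots> = (p + q)\<^sup>2 - 2 * ?e" by (simp add: power2_eq_square algebra_simps)
    finally show ?thesis .
  qed
  also have "\<dots> \<le> (p + q)\<^sup>2 - 2 * ?e * (p + q)"
    using mult_left_le[of "p + q" "2 * ?e"] assms e0 by simp
  also have "\<dots> \<le> (p + q - ?e)\<^sup>2"
  proof -
    have "x\<^sup>2 - 2 * e * x \<le> (x - e)\<^sup>2" for x e :: real
      by (simp add: power2_diff)
    then show ?thesis .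
  qed
  finally show "(norm (of_real p * iexp x + of_real q * iexp y))\<^sup>2 \<le> (p + q - ?e)\<^sup>2" .
qed

text \<open>Interference of the summands 1 and \<open>j\<close> alone yields the gain; the others
  are bounded by their weights. The index \<open>j\<close> stays free, to be taken where
  \<open>dioph_dist\<close> is attained.\<close>

lemma char_sum_norm_le:
  fixes a p :: "nat \<Rightarrow> real"
  assumes p: "\<And>i. i \<in> {1..d+1} \<Longrightarrow> p i \<ge> 0" "(\<Sum>i=1..d+1. p i) = 1" and j: "j \<in> {2..d+1}"
  shows "norm (\<Sum>i=1..d+1. of_real (p i) * iexp (s * a i)) \<le> 1 - p 1 * p j * (1 - cos ((a j - a 1) * s))"
proof -
  let ?R = "{1..d+1} - {1, j}"
  have split: "(\<Sum>i=1..d+1. f i) = f 1 + f j + (\<Sum>i\<in>?R. f i)" for f :: "nat \<Rightarrow> 'b::comm_monoid_add"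
  proof -
    have "(\<Sum>i=1..d+1. f i) = (\<Sum>i\<in>?R. f i) + (\<Sum>i\<in>{1, j}. f i)"
      using j by (intro sum.subset_diff) auto
    also have "(\<Sum>i\<in>{1, j}. f i) = f 1 + f j" using j by simp
    finally show ?thesis by (simp only: add.commute)
  qed
  have R: "(\<Sum>i\<in>?R. p i) \<ge> 0" using p(1) by (intro sum_nonneg) auto
  have s1: "p 1 + p j + (\<Sum>i\<in>?R. p i) = 1" using p(2) by (simp only: split)
  have "norm (\<Sum>i=1..d+1. of_real (p i) * iexp (s * a i))
     \<le> norm (of_real (p 1) * iexp (s * a 1) + of_real (p j) * iexp (s * a j)) + (\<Sum>i\<in>?R. norm (of_real (p i) * iexp (s * a i)))"
    unfolding split by (intro order_trans[OF norm_triangle_ineq] add_mono norm_sum order_refl)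
  also have "(\<Sum>i\<in>?R. norm (of_real (p i) * iexp (s * a i))) = (\<Sum>i\<in>?R. p i)"
    using p(1) by (intro sum.cong) (auto simp: norm_mult)
  also have "norm (of_real (p 1) * iexp (s * a 1) + of_real (p j) * iexp (s * a j))
     \<le> p 1 + p j - p 1 * p j * (1 - cos (s * a j - s * a 1))"
    using p(1)[of 1] p(1)[of j] j R s1 by (intro norm_two_phases_le) auto
  finally show ?thesis using s1 by (simp add: algebra_simps)
qed

subsection \<open>Existence of the Edgeworth expansion and decay estimates\<close>

text \<open>Since \<open>char \<mu> (- t) = cnj (char \<mu> t)\<close>, an expansion with complex coefficients may be averaged with its
  reflected conjugate, which replaces the coefficients by their real parts.\<close>

definition real_hermite :: "complex poly \<Rightarrow> real poly" where
  "real_hermite q = - (\<Sum>j<degree q. smult (Re (coeff q (Suc j))) (hermite j))"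

text \<open>The factor \<open>\<i> * t\<close> raises the power belonging to
  \<open>hermite j\<close> to \<open>Suc j\<close>, which explains the shifted coefficient and why
  the constant one must be 0. The reflected conjugate of a polynomial at \<open>\<i> * t\<close> has
  the conjugate coefficients.\<close>

lemma gauss_fourier_real_hermite:
  assumes q0: "coeff q 0 = 0"
  shows "- (\<i> * of_real t) * gauss_fourier (real_hermite q) t
    = exp (- (of_real t)\<^sup>2 / 2) * ((poly q (\<i> * of_real t) + cnj (poly q (\<i> * of_real (- t)))) / 2)"
proof -
  let ?y = "\<i> * of_real t" and ?e = "exp (- (of_real t)\<^sup>2 / 2) :: complex"
  have "gauss_fourier (real_hermite q) t = - ((\<Sum>j<degree q. of_real (Re (coeff q (Suc j))) * ?y ^ j) * ?e)"
    using gauss_fourier_diff[of 0 "- real_hermite q" t]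
    by (simp add: real_hermite_def gauss_fourier_hermite_sum gauss_fourier_linear)
  then have "- ?y * gauss_fourier (real_hermite q) t = ?e * (?y * (\<Sum>j<degree q. of_real (Re (coeff q (Suc j))) * ?y ^ j))"
    by (simp add: algebra_simps)
  also have "?y * (\<Sum>j<degree q. of_real (Re (coeff q (Suc j))) * ?y ^ j) = (\<Sum>i\<le>degree q. of_real (Re (coeff q i)) * ?y ^ i)"
    by (subst sum.atMost_shift) (simp add: q0 sum_distrib_left mult_ac)
  also have "\<dots> = (\<Sum>i\<le>degree q. (coeff q i * ?y ^ i + cnj (coeff q i) * ?y ^ i) / 2)"
    by (intro sum.cong refl) (simp add: complex_add_cnj flip: distrib_right)
  also have "\<dots> = (poly q ?y + cnj (poly q (\<i> * of_real (- t)))) / 2"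
    by (simp add: poly_altdef sum.distrib flip: sum_divide_distrib)
  finally show ?thesis .
qed

text \<open>Existence of the polynomials together with an error uniform in
  \<open>\<bar>t\<bar> \<le> \<delta> * sqrt n\<close>. The definition asks only for a pointwise
  \<open>o\<close>, but the smoothing inequality needs this uniform form with its factor
  \<open>\<bar>t\<bar>\<close>.\<close>

lemma edgeworth_char_bound:
  fixes a p :: "nat \<Rightarrow> real" and J :: "nat set" and \<mu> :: "real measure"
  defines "\<sigma> \<equiv> std_dev \<mu>"
  assumes p: "(\<Sum>j\<in>J. p j) = 1" and mean: "(\<Sum>j\<in>J. p j * a j) = 0" and var: "(\<Sum>j\<in>J. p j * (a j)\<^sup>2) = \<sigma>\<^sup>2"
    and \<sigma>: "\<sigma> > 0" and char: "\<And>t. char \<mu> t = (\<Sum>j\<in>J. of_real (p j) * iexp (t * a j))"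
  obtains P \<delta> C where "\<And>k. k \<notin> {1..r} \<Longrightarrow> P k = 0" "\<delta> > 0" "C > 0"
    "\<And>n t. n \<ge> 1 \<Longrightarrow> \<bar>t\<bar> \<le> \<delta> * sqrt (real n) \<Longrightarrow>
       norm (char \<mu> (t / (\<sigma> * sqrt (real n))) ^ n - fourier_stieltjes (edgeworth_of P r n) t)
       \<le> C * (1 / sqrt (real n)) ^ Suc r * (\<bar>t\<bar> * (1 + \<bar>t\<bar>) ^ (3 * r + 2)) * exp (- t\<^sup>2 / 4)"
proof -
  obtain \<rho> G where \<rho>: "\<rho> > 0" and G: "G holomorphic_on ball 0 \<rho>"
    and M: "\<And>x. norm x < \<rho> \<Longrightarrow> (\<Sum>j\<in>J. of_real (p j) * exp (of_real (a j) * x)) = exp (of_real (\<sigma>\<^sup>2) / 2 * x\<^sup>2 + x ^ 3 * G x)"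
    using cumulant_expansion[OF p mean var] by blast
  \<comment> \<open>Rescaled to unit variance: for \<open>x = u * y / \<sigma>\<close> and
    \<open>n * u\<^sup>2 = 1\<close>, the term \<open>n * x ^ 3 * G x\<close> becomes
    \<open>u * y ^ 3 * g (u * y)\<close>.\<close>
  define g where "g v = G (v / of_real \<sigma>) / of_real \<sigma> ^ 3" for v
  have "(G \<circ> (\<lambda>v. v / of_real \<sigma>)) holomorphic_on ball 0 (\<rho> * \<sigma>)"
  proof (rule holomorphic_on_compose_gen[OF _ G])
    show "(\<lambda>v. v / of_real \<sigma>) holomorphic_on ball 0 (\<rho> * \<sigma>)"
      using \<sigma> by (intro holomorphic_intros) auto
  qed (use \<sigma> in \<open>auto simp: norm_divide divide_less_eq\<close>)
  then have g: "g holomorphic_on ball 0 (\<rho> * \<sigma>)"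
    unfolding g_def o_def using \<sigma> by (intro holomorphic_intros) auto
  have \<rho>\<sigma>: "\<rho> * \<sigma> > 0" using \<rho> \<sigma> by simp
  obtain q \<delta> C where \<delta>: "\<delta> > 0" "\<delta> < \<rho> * \<sigma>" and C: "C > 0" and q0: "\<And>k. coeff (q k) 0 = 0"
    and q: "\<And>u y. u > 0 \<Longrightarrow> u * norm y \<le> \<delta> \<Longrightarrow>
         norm (exp (of_real u * y ^ 3 * g (of_real u * y)) - (1 + (\<Sum>k=1..r. of_real u ^ k * poly (q k) y)))
           \<le> C * u ^ Suc r * (norm y * (1 + norm y) ^ (3 * r + 2)) * exp ((norm y)\<^sup>2 / 4)"
  proof (rule exp_scaled_expansion[OF g \<rho>\<sigma>, of r], goal_cases)
    case (1 q \<delta> C)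
    show ?case by (rule 1(1); (rule 1(2-5) | (rule 1(6); assumption)))
  qed
  define P where "P k = (if k \<in> {1..r} then real_hermite (q k) else 0)" for k
  define A where "A n t = char \<mu> (t / (\<sigma> * sqrt (real n))) ^ n" for n t
  define T where "T n t = exp (- (of_real t)\<^sup>2 / 2) * (1 + (\<Sum>k=1..r. of_real (1 / sqrt (real n)) ^ k * poly (q k) (\<i> * of_real t)))" for n t
  define bnd where "bnd n t = C * (1 / sqrt (real n)) ^ Suc r * (\<bar>t\<bar> * (1 + \<bar>t\<bar>) ^ (3 * r + 2)) * exp (- t\<^sup>2 / 4)" for n t
  have AT: "norm (A n t - T n t) \<le> bnd n t" if n: "n \<ge> 1" and t: "\<bar>t\<bar> \<le> \<delta> * sqrt (real n)" for n t
  proof -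
    define u where "u = 1 / sqrt (real n)"
    define y where "y = \<i> * of_real t"
    define x where "x = of_real (u / \<sigma>) * y"
    have u: "u > 0" "real n * u\<^sup>2 = 1" using n by (auto simp: u_def power_divide)
    have ny: "norm y = \<bar>t\<bar>" by (simp add: y_def norm_mult)
    have uy: "u * norm y \<le> \<delta>" using t n by (simp add: ny u_def field_simps)
    have "norm x = u * norm y / \<sigma>" using u \<sigma> by (simp add: x_def norm_mult norm_divide)
    then have nx: "norm x < \<rho>" using uy \<delta> \<sigma> by (simp add: divide_less_eq)
    have "char \<mu> (t / (\<sigma> * sqrt (real n))) = (\<Sum>j\<in>J. of_real (p j) * exp (of_real (a j) * x))"
      unfolding char by (intro sum.cong refl) (simp add: x_def y_def u_def mult_ac)
    also have "\<dots> = exp (of_real (\<sigma>\<^sup>2) / 2 * x\<^sup>2 + x ^ 3 * G x)" by (rule M[OF nx])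
    finally have "A n t = exp (of_nat n * (of_real (\<sigma>\<^sup>2) / 2 * x\<^sup>2 + x ^ 3 * G x))"
      by (simp only: A_def exp_of_nat_mult)
    also have "of_nat n * (of_real (\<sigma>\<^sup>2) / 2 * x\<^sup>2 + x ^ 3 * G x) = of_real (real n * u\<^sup>2) * (y\<^sup>2 / 2 + of_real u * y ^ 3 * g (of_real u * y))"
      using \<sigma> by (simp add: x_def g_def power_mult_distrib power_divide field_simps power2_eq_square power3_eq_cube)
    also have "\<dots> = - (of_real t)\<^sup>2 / 2 + of_real u * y ^ 3 * g (of_real u * y)"
      unfolding u by (simp add: y_def power_mult_distrib)
    finally have "A n t - T n t = exp (- (of_real t)\<^sup>2 / 2) *
        (exp (of_real u * y ^ 3 * g (of_real u * y)) - (1 + (\<Sum>k=1..r. of_real u ^ k * poly (q k) y)))"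
      by (simp only: exp_add T_def u_def y_def right_diff_distrib)
    then have "norm (A n t - T n t) = exp (- t\<^sup>2 / 2) * norm (exp (of_real u * y ^ 3 * g (of_real u * y)) - (1 + (\<Sum>k=1..r. of_real u ^ k * poly (q k) y)))"
      by (simp only: norm_mult) (simp add: norm_exp_eq_Re)
    also have "\<dots> \<le> exp (- t\<^sup>2 / 2) * (C * u ^ Suc r * (norm y * (1 + norm y) ^ (3 * r + 2)) * exp ((norm y)\<^sup>2 / 4))"
      by (intro mult_left_mono q u uy) auto
    also have "\<dots> = C * u ^ Suc r * (\<bar>t\<bar> * (1 + \<bar>t\<bar>) ^ (3 * r + 2)) * (exp (- t\<^sup>2 / 2) * exp (t\<^sup>2 / 4))"
      by (simp only: ny power2_abs mult_ac)
    \<comment> \<open>Half of the Gaussian survives the growth allowed by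
      \<open>exp_scaled_expansion\<close>.\<close>
    also have "exp (- t\<^sup>2 / 2) * exp (t\<^sup>2 / 4) = exp (- t\<^sup>2 / 4)"
      by (simp flip: exp_add)
    finally show ?thesis by (simp only: bnd_def u_def)
  qed
  have A_cnj: "cnj (A n (- t)) = A n t" for n t
    unfolding A_def char by (simp add: exp_cnj)
  have fs: "fourier_stieltjes (edgeworth_of P r n) t = (T n t + cnj (T n (- t))) / 2" if n: "n \<ge> 1" for n t
  proof -
    let ?e = "exp (- (of_real t)\<^sup>2 / 2) :: complex" and ?u = "of_real (1 / sqrt (real n)) :: complex"
    have "fourier_stieltjes (edgeworth_of P r n) t
      = ?e + (\<Sum>k=1..r. ?u ^ k * (- (\<i> * of_real t) * gauss_fourier (real_hermite (q k)) t))"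
      unfolding fourier_stieltjes_edgeworth_of nat_powr_half[OF n]
      by (simp add: P_def sum_distrib_left sum_negf mult_ac)
    also have "\<dots> = ?e + (\<Sum>k=1..r. ?u ^ k * (?e * ((poly (q k) (\<i> * of_real t) + cnj (poly (q k) (\<i> * of_real (- t)))) / 2)))"
      unfolding gauss_fourier_real_hermite[OF q0] ..
    also have "\<dots> = (T n t + cnj (T n (- t))) / 2"
      by (simp add: T_def exp_cnj sum_distrib_left sum.distrib algebra_simps add_divide_distrib sum_divide_distrib)
    finally show ?thesis .
  qed
  show thesis
  proof (rule that[OF _ \<delta>(1) C])
    show "P k = 0" if "k \<notin> {1..r}" for k using that by (simp only: P_def if_False)
    fix n t assume n: "(n::nat) \<ge> 1" and t: "\<bar>t\<bar> \<le> \<delta> * sqrt (real n)"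
    have t': "\<bar>- t\<bar> \<le> \<delta> * sqrt (real n)" using t by simp
    have "A n t - fourier_stieltjes (edgeworth_of P r n) t = ((A n t - T n t) + cnj (A n (- t) - T n (- t))) / 2"
      using A_cnj[of n t] by (simp add: fs[OF n] field_simps)
    then have "norm (A n t - fourier_stieltjes (edgeworth_of P r n) t) \<le> (norm (A n t - T n t) + norm (A n (- t) - T n (- t))) / 2"
      using norm_triangle_ineq[of "A n t - T n t" "cnj (A n (- t) - T n (- t))"]
      by (simp only: norm_divide complex_mod_cnj) simp
    also have "\<dots> \<le> (bnd n t + bnd n (- t)) / 2"
      by (intro divide_right_mono add_mono AT n t t') auto
    also have "\<dots> = bnd n t" by (simp add: bnd_def)
    finally show "norm (char \<mu> (t / (\<sigma> * sqrt (real n))) ^ n - fourier_stieltjes (edgeworth_of P r n) t)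
       \<le> C * (1 / sqrt (real n)) ^ Suc r * (\<bar>t\<bar> * (1 + \<bar>t\<bar>) ^ (3 * r + 2)) * exp (- t\<^sup>2 / 4)"
      by (simp only: A_def bnd_def)
  qed
qed

text \<open>A fixed \<open>t\<close> eventually enters the range
  \<open>\<bar>t\<bar> \<le> \<delta> * sqrt n\<close>, and the extra power of
  \<open>1 / sqrt n\<close> turns the bound into a small \<open>o\<close>.\<close>

lemma edgeworth_expansionI:
  assumes \<delta>: "\<delta> > 0"
    and bound: "\<And>n t. n \<ge> 1 \<Longrightarrow> \<bar>t\<bar> \<le> \<delta> * sqrt (real n) \<Longrightarrow>
       norm (char \<mu> (t / (std_dev \<mu> * sqrt (real n))) ^ n - fourier_stieltjes (edgeworth_of P r n) t)
       \<le> C * (1 / sqrt (real n)) ^ Suc r * w t"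
  shows "edgeworth_expansion \<mu> r P"
  unfolding edgeworth_expansion_def
proof
  fix t
  let ?f = "\<lambda>n. norm (char \<mu> (t / (std_dev \<mu> * sqrt (real n))) ^ n - fourier_stieltjes (edgeworth_of P r n) t)"
  have "filterlim (\<lambda>n. \<delta> * sqrt (real n)) at_top sequentially"
    using \<delta> by real_asymp
  then have "\<forall>\<^sub>F n in sequentially. \<bar>t\<bar> \<le> \<delta> * sqrt (real n)" by (simp add: filterlim_at_top)
  then have ev: "\<forall>\<^sub>F n in sequentially. norm (?f n) \<le> (C * w t) * norm ((1 / sqrt (real n)) ^ Suc r)"
    using eventually_ge_at_top[of 1]
  proof eventually_elim
    case (elim n)
    then show ?case using bound[of n t] by (simp add: mult_ac)
  qed
  have "?f \<in> O(\<lambda>n. (1 / sqrt (real n)) ^ Suc r)" using ev by (rule bigoI)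
  also have "(\<lambda>n. (1 / sqrt (real n)) ^ Suc r) \<in> o(\<lambda>n. (1 / sqrt (real n)) ^ r)"
    by real_asymp
  also have "(\<lambda>n. (1 / sqrt (real n)) ^ r) \<in> \<Theta>(\<lambda>n. real n powr (- real r / 2))"
  proof (rule bigthetaI_cong)
    show "\<forall>\<^sub>F n in sequentially. (1 / sqrt (real n)) ^ r = real n powr (- real r / 2)"
      using eventually_ge_at_top[of 1] by eventually_elim (simp only: nat_powr_half)
  qed
  finally show "?f \<in> o(\<lambda>n. real n powr (- real r / 2))" .
qed

text \<open>Here the \<open>THE\<close> of the definition is evaluated; the vanishing outside
  \<open>{1..r}\<close> fixes the entries that the expansion does not see.\<close>

lemma edgeworth_polys_eqI:
  assumes "edgeworth_expansion \<mu> r P" "\<And>k. k \<notin> {1..r} \<Longrightarrow> P k = 0"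
  shows "edgeworth_polys \<mu> r = P"
  unfolding edgeworth_polys_def
  using assms by (intro the_equality) (auto intro!: edgeworth_expansion_unique[of \<mu> r])

section \<open>The law of one step: moments, nondegeneracy and decay\<close>

lemma Omega_law:
  assumes "(a, p) \<in> Omega d"
  shows "real_distribution (step_law d a p)"
    and "\<And>t. char (step_law d a p) t = (\<Sum>j=1..d+1. of_real (p j) * iexp (t * a j))"
    and "std_dev (step_law d a p) \<ge> 0" "(\<Sum>j=1..d+1. p j * (a j)\<^sup>2) = (std_dev (step_law d a p))\<^sup>2"
proof -
  have p: "\<And>i. i \<in> {1..d+1} \<Longrightarrow> p i > 0" "(\<Sum>i=1..d+1. p i) = 1" "(\<Sum>i=1..d+1. p i * a i) = 0"
    using assms by (auto simp: Omega_def)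
  let ?N = "point_measure {1..d+1} (\<lambda>j. ennreal (p j))"
  have int: "integral\<^sup>L (step_law d a p) f = (\<Sum>j=1..d+1. p j *\<^sub>R f (a j))"
    if "f \<in> borel_measurable borel" for f :: "real \<Rightarrow> 'b::{banach, second_countable_topology}"
  proof -
    have "integral\<^sup>L (step_law d a p) f = (\<integral>j. f (a j) \<partial>?N)"
      unfolding step_law_def by (rule integral_distr) (use that in \<open>auto simp: measurable_point_measure_eq1\<close>)
    also have "\<dots> = (\<Sum>j=1..d+1. p j *\<^sub>R f (a j))"
      by (rule lebesgue_integral_point_measure_finite) (use p(1) in \<open>auto simp: less_imp_le\<close>)
    finally show ?thesis .
  qed
  have "prob_space ?N"
  proof
    show "emeasure ?N (space ?N) = 1"
    proof -
      have "emeasure ?N (space ?N) = (\<Sum>j=1..d+1. ennreal (p j))"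
        by (simp only: space_point_measure) (rule emeasure_point_measure_finite, auto)
      also have "\<dots> = ennreal (\<Sum>j=1..d+1. p j)" using p(1) by (intro sum_ennreal) (simp add: less_imp_le)
      finally show ?thesis by (simp only: p(2) ennreal_1)
    qed
  qed
  then have ps: "prob_space (step_law d a p)"
    unfolding step_law_def by (rule prob_space.prob_space_distr) (simp add: measurable_point_measure_eq1)
  then show "real_distribution (step_law d a p)"
    by (simp add: real_distribution_def real_distribution_axioms_def step_law_def)
  show "char (step_law d a p) t = (\<Sum>j=1..d+1. of_real (p j) * iexp (t * a j))" for t
    unfolding char_def by (subst int) (auto simp: scaleR_conv_of_real)
  have var: "integral\<^sup>L (step_law d a p) (\<lambda>x. (x - integral\<^sup>L (step_law d a p) (\<lambda>x. x))\<^sup>2) = (\<Sum>j=1..d+1. p j * (a j)\<^sup>2)"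
    using p(3) by (simp add: int)
  have nn: "(\<Sum>j=1..d+1. p j * (a j)\<^sup>2) \<ge> 0"
    using p(1) by (intro sum_nonneg) (auto simp: less_imp_le)
  show "std_dev (step_law d a p) \<ge> 0" "(\<Sum>j=1..d+1. p j * (a j)\<^sup>2) = (std_dev (step_law d a p))\<^sup>2"
    using nn by (simp_all only: std_dev_def var real_sqrt_pow2 real_sqrt_ge_zero)
qed

lemma Omega_std_dev_pos:
  assumes \<Omega>: "(a, p) \<in> Omega d" and j: "j \<in> {2..d+1}" "a j \<noteq> a 1"
  shows "std_dev (step_law d a p) > 0"
proof -
  have p: "\<And>i. i \<in> {1..d+1} \<Longrightarrow> p i > 0" using \<Omega> by (auto simp: Omega_def)
  obtain i where i: "i \<in> {1..d+1}" "a i \<noteq> 0"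
  proof (cases "a j = 0")
    case True
    then show thesis using j that[of 1] by auto
  next
    case False
    then show thesis using j that[of j] by auto
  qed
  have "0 < p i * (a i)\<^sup>2" using p i by simp
  also have "\<dots> \<le> (\<Sum>j=1..d+1. p j * (a j)\<^sup>2)"
    by (rule member_le_sum) (use i p in \<open>auto simp: less_imp_le\<close>)
  finally have "(std_dev (step_law d a p))\<^sup>2 > 0" unfolding Omega_law(4)[OF \<Omega>] .
  then show ?thesis using Omega_law(3)[OF \<Omega>] by (metis less_eq_real_def power_zero_numeral less_irrefl)
qed

lemma Omega_char_decay:
  assumes \<Omega>: "(a, p) \<in> Omega d" and d: "d \<ge> 1"
  obtains c where "c > 0" "\<And>s n. norm (char (step_law d a p) s) ^ n \<le> exp (- c * real n * (dioph_dist d a s)\<^sup>2)"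
proof -
  have p: "\<And>i. i \<in> {1..d+1} \<Longrightarrow> p i > 0" "(\<Sum>i=1..d+1. p i) = 1"
    using \<Omega> by (auto simp: Omega_def)
  \<comment> \<open>The minimum of the weights makes \<open>c\<close> independent of the index at
    which \<open>dioph_dist\<close> is attained, as this index varies with \<open>s\<close>; 25 is
    inherited from \<open>one_minus_cos_ge_infdist\<close>.\<close>
  define c where "c = p 1 * Min (p ` {2..d+1}) / 25"
  have pmin: "Min (p ` {2..d+1}) > 0" using p(1) d by (subst Min_gr_iff) auto
  have p1: "p 1 > 0" using p(1)[of 1] by simp
  show thesis
  proof (rule that)
    show "c > 0" using pmin p1 by (simp add: c_def)
    fix s n
    let ?D = "dioph_dist d a s"
    obtain j where j: "j \<in> {2..d+1}" "?D = infdist ((a j - a 1) * s) two_pi_ints"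
      using dioph_dist_attained[OF d] .
    have "norm (char (step_law d a p) s) \<le> 1 - p 1 * p j * (1 - cos ((a j - a 1) * s))"
      unfolding Omega_law(2)[OF \<Omega>] using p by (intro char_sum_norm_le j) (auto simp: less_imp_le)
    also have "\<dots> \<le> 1 - c * ?D\<^sup>2"
    proof -
      have "c * ?D\<^sup>2 = p 1 * Min (p ` {2..d+1}) * (?D\<^sup>2 / 25)" by (simp add: c_def)
      also have "\<dots> \<le> p 1 * p j * (1 - cos ((a j - a 1) * s))"
        using one_minus_cos_ge_infdist[of "(a j - a 1) * s"] p1 j pmin
        by (intro mult_mono mult_nonneg_nonneg) (auto intro!: Min_le simp: less_imp_le p)
      finally show ?thesis by simp
    qed
    also have "\<dots> \<le> exp (- c * ?D\<^sup>2)" using exp_ge_add_one_self[of "- c * ?D\<^sup>2"] by simp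
    finally have "norm (char (step_law d a p) s) ^ n \<le> exp (- c * ?D\<^sup>2) ^ n" by (intro power_mono) auto
    also have "\<dots> = exp (- c * real n * ?D\<^sup>2)" by (simp add: mult_ac flip: exp_of_nat_mult)
    finally show "norm (char (step_law d a p) s) ^ n \<le> exp (- c * real n * ?D\<^sup>2)" .
  qed
qed

text \<open>Beyond \<open>\<delta> * sqrt n\<close> the two transforms are no longer close and are
  estimated separately; this handles the series, uniformly in \<open>n\<close>. In the Hermite basis
  each transform is a polynomial times a Gaussian.\<close>

lemma edgeworth_transform_bound:
  obtains C D where "C > 0" "\<And>n t. n \<ge> 1 \<Longrightarrow>
    norm (fourier_stieltjes (edgeworth_of P r n) t) \<le> C * (1 + \<bar>t\<bar>) ^ D * exp (- t\<^sup>2 / 2)"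
proof -
  have "\<exists>C D. C \<ge> 0 \<and> (\<forall>t. norm (gauss_fourier p t) \<le> C * (1 + \<bar>t\<bar>) ^ D * exp (- t\<^sup>2 / 2))" for p
  proof -
    obtain c where c: "p = (\<Sum>i<Suc (degree p). smult (c i) (hermite i))"
      using hermite_expansion[of p "Suc (degree p)"] by auto
    have "norm (gauss_fourier p t) \<le> (\<Sum>i<Suc (degree p). \<bar>c i\<bar>) * (1 + \<bar>t\<bar>) ^ degree p * exp (- t\<^sup>2 / 2)" for t
    proof -
      have "gauss_fourier p t = (\<Sum>i<Suc (degree p). of_real (c i) * (\<i> * of_real t) ^ i) * exp (- (of_real t)\<^sup>2 / 2)"
        by (subst c) (rule gauss_fourier_hermite_sum)
      then have eq: "norm (gauss_fourier p t) = norm (\<Sum>i<Suc (degree p). of_real (c i) * (\<i> * of_real t) ^ i) * exp (- t\<^sup>2 / 2)"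
        by (simp add: norm_mult)
      have "norm (\<Sum>i<Suc (degree p). of_real (c i) * (\<i> * of_real t) ^ i) \<le> (\<Sum>i<Suc (degree p). \<bar>c i\<bar> * (1 + \<bar>t\<bar>) ^ degree p)"
      proof (rule sum_norm_le)
        fix i assume i: "i \<in> {..<Suc (degree p)}"
        have "\<bar>t\<bar> ^ i \<le> (1 + \<bar>t\<bar>) ^ i" by (intro power_mono) auto
        also have "\<dots> \<le> (1 + \<bar>t\<bar>) ^ degree p" using i by (intro power_increasing) auto
        finally show "norm (of_real (c i) * (\<i> * of_real t) ^ i) \<le> \<bar>c i\<bar> * (1 + \<bar>t\<bar>) ^ degree p"
          by (simp add: norm_mult norm_power mult_left_mono)
      qed
      from mult_right_mono[OF this, of "exp (- t\<^sup>2 / 2)"] show ?thesis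
        unfolding eq by (simp only: sum_distrib_right exp_ge_zero)
    qed
    then show ?thesis by (intro exI[of _ "\<Sum>i<Suc (degree p). \<bar>c i\<bar>"] exI[of _ "degree p"] conjI sum_nonneg) auto
  qed
  then obtain C D where CD: "\<And>p. C p \<ge> (0::real)" "\<And>p t. norm (gauss_fourier p t) \<le> C p * (1 + \<bar>t\<bar>) ^ D p * exp (- t\<^sup>2 / 2)"
    by metis
  \<comment> \<open>The sum of the degrees dominates each of them, and \<open>Suc\<close> makes room
    for the factor \<open>\<bar>t\<bar>\<close> in front of the corrections.\<close>
  define D0 where "D0 = Suc (\<Sum>k=1..r. D (P k))"
  define C0 where "C0 = 1 + (\<Sum>k=1..r. C (P k))"
  show thesis
  proof (rule that)
    show "C0 > 0" unfolding C0_def using CD(1) by (intro add_pos_nonneg sum_nonneg) auto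
    fix n :: nat and t :: real assume n: "n \<ge> 1"
    let ?e = "exp (- t\<^sup>2 / 2)"
    have "norm (fourier_stieltjes (edgeworth_of P r n) t) \<le> norm (exp (- (of_real t)\<^sup>2 / 2) :: complex)
      + norm (\<i> * of_real t * (\<Sum>k=1..r. of_real (real n powr (- real k / 2)) * gauss_fourier (P k) t))"
      unfolding fourier_stieltjes_edgeworth_of by (rule norm_triangle_ineq4)
    also have "\<dots> = ?e + \<bar>t\<bar> * norm (\<Sum>k=1..r. of_real (real n powr (- real k / 2)) * gauss_fourier (P k) t)"
      by (simp add: norm_mult)
    also have "norm (\<Sum>k=1..r. of_real (real n powr (- real k / 2)) * gauss_fourier (P k) t)
       \<le> (\<Sum>k=1..r. C (P k) * (1 + \<bar>t\<bar>) ^ (\<Sum>k=1..r. D (P k)) * ?e)"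
    proof (rule sum_norm_le)
      fix k assume k: "k \<in> {1..r}"
      have "real n powr (- real k / 2) \<le> real n powr 0" using n by (intro powr_mono) auto
      then have n1: "norm (of_real (real n powr (- real k / 2)) :: complex) \<le> 1" using n by simp
      have "norm (of_real (real n powr (- real k / 2)) * gauss_fourier (P k) t) \<le> 1 * (C (P k) * (1 + \<bar>t\<bar>) ^ D (P k) * ?e)"
        unfolding norm_mult by (intro mult_mono n1 CD) auto
      also have "(1 + \<bar>t\<bar>) ^ D (P k) \<le> (1 + \<bar>t\<bar>) ^ (\<Sum>k=1..r. D (P k))"
        using k by (intro power_increasing member_le_sum) auto
      finally show "norm (of_real (real n powr (- real k / 2)) * gauss_fourier (P k) t) \<le> C (P k) * (1 + \<bar>t\<bar>) ^ (\<Sum>k=1..r. D (P k)) * ?e"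
        using CD(1)[of "P k"] by (simp add: mult_left_mono mult_right_mono)
    qed
    also have "?e + \<bar>t\<bar> * (\<Sum>k=1..r. C (P k) * (1 + \<bar>t\<bar>) ^ (\<Sum>k=1..r. D (P k)) * ?e)
       \<le> (1 + \<bar>t\<bar>) ^ D0 * ?e + (1 + \<bar>t\<bar>) * (\<Sum>k=1..r. C (P k) * (1 + \<bar>t\<bar>) ^ (\<Sum>k=1..r. D (P k)) * ?e)"
    proof (intro add_mono mult_right_mono)
      show "?e \<le> (1 + \<bar>t\<bar>) ^ D0 * ?e" using one_le_power[of "1 + \<bar>t\<bar>" D0] by (simp del: power_Suc)
    qed (use CD(1) in \<open>auto intro!: sum_nonneg\<close>)
    also have "\<dots> = C0 * (1 + \<bar>t\<bar>) ^ D0 * ?e"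
      unfolding C0_def D0_def power_Suc sum_distrib_right[symmetric] by (simp add: algebra_simps)
    finally show "norm (fourier_stieltjes (edgeworth_of P r n) t) \<le> C0 * (1 + \<bar>t\<bar>) ^ D0 * ?e"
      by (simp add: mult_left_mono)
  qed
qed

text \<open>Up to a constant, \<open>exp (- t\<^sup>2 / 4)\<close> is the normal density of variance
  2; a binomial expansion reduces the claim to absolute moments.\<close>

lemma polynomial_gauss_integrable: "integrable lborel (\<lambda>t::real. (1 + \<bar>t\<bar>) ^ D * exp (- t\<^sup>2 / 4))"
proof -
  have int: "integrable lborel (\<lambda>t. (sqrt (2 * pi * (sqrt 2)\<^sup>2)) * (normal_density 0 (sqrt 2) t * \<bar>t - 0\<bar> ^ k))" for k
    by (intro integrable_mult_right integrable_normal_moment_abs) auto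
  have "integrable lborel (\<lambda>t::real. \<Sum>k\<le>D. real (D choose k) * ((sqrt (2 * pi * (sqrt 2)\<^sup>2)) * (normal_density 0 (sqrt 2) t * \<bar>t - 0\<bar> ^ k)))"
    by (intro Bochner_Integration.integrable_sum integrable_mult_right int)
  also have "(\<lambda>t::real. \<Sum>k\<le>D. real (D choose k) * ((sqrt (2 * pi * (sqrt 2)\<^sup>2)) * (normal_density 0 (sqrt 2) t * \<bar>t - 0\<bar> ^ k)))
     = (\<lambda>t. (1 + \<bar>t\<bar>) ^ D * exp (- t\<^sup>2 / 4))"
  proof
    fix t :: real
    have "(1 + \<bar>t\<bar>) ^ D = (\<Sum>k\<le>D. real (D choose k) * \<bar>t\<bar> ^ k)"
      using binomial_ring[of "\<bar>t\<bar>" 1 D] by (simp add: add.commute)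
    moreover have "sqrt (2 * pi * (sqrt 2)\<^sup>2) * normal_density 0 (sqrt 2) t = exp (- t\<^sup>2 / 4)"
      by (simp add: normal_density_def)
    moreover have "b * (s * (e * x)) = b * x * (s * e)" for b s e x :: real by (simp only: mult_ac)
    ultimately show "(\<Sum>k\<le>D. real (D choose k) * ((sqrt (2 * pi * (sqrt 2)\<^sup>2)) * (normal_density 0 (sqrt 2) t * \<bar>t - 0\<bar> ^ k))) = (1 + \<bar>t\<bar>) ^ D * exp (- t\<^sup>2 / 4)"
      by (simp only: sum_distrib_right diff_0_right)
  qed
  finally show ?thesis .
qed

subsection \<open>The rate of convergence\<close>

text \<open>The four parts of the final error, in order: the expansion near the origin, the decay
  estimate times the length of the band, the Gaussian tail of the series, and the smoothing term
  \<open>m / T\<close>.\<close>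

lemma rate_limits:
  fixes R R' \<epsilon> c1 \<delta> :: real and d :: nat
  assumes "R < real d / 2" "R < R'" "\<epsilon> > 0" "c1 > 0" "\<delta> > 0"
  shows "(\<lambda>n. real n powr R * (1 / sqrt (real n)) ^ d) \<longlonglongrightarrow> 0"
    and "(\<lambda>n. real n powr R * (real n powr R' * exp (- c1 * real n powr \<epsilon>))) \<longlonglongrightarrow> 0"
    and "(\<lambda>n. real n powr R * exp (- \<delta>\<^sup>2 * real n / 4)) \<longlonglongrightarrow> 0"
    and "(\<lambda>n. real n powr R * (1 / real n powr R')) \<longlonglongrightarrow> 0"
proof -
  have "(\<lambda>n. real n powr (R - real d / 2)) \<longlonglongrightarrow> 0"
    using assms(1) by real_asymp
  moreover have "\<forall>\<^sub>F n in sequentially. real n powr (R - real d / 2) = real n powr R * (1 / sqrt (real n)) ^ d"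
    using eventually_ge_at_top[of 1]
  proof eventually_elim
    case (elim n)
    then show ?case using nat_powr_half[OF elim, of d] powr_add[of "real n" R "- real d / 2"] by simp
  qed
  ultimately show "(\<lambda>n. real n powr R * (1 / sqrt (real n)) ^ d) \<longlonglongrightarrow> 0"
    by (rule Lim_transform_eventually)
  show "(\<lambda>n. real n powr R * (real n powr R' * exp (- c1 * real n powr \<epsilon>))) \<longlonglongrightarrow> 0"
    using assms by real_asymp
  show "(\<lambda>n. real n powr R * exp (- \<delta>\<^sup>2 * real n / 4)) \<longlonglongrightarrow> 0"
    using assms by real_asymp
  show "(\<lambda>n. real n powr R * (1 / real n powr R')) \<longlonglongrightarrow> 0"
    using assms by real_asymp
qed

lemma set_integral_le_integral_nonneg:
  fixes f :: "real \<Rightarrow> real"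
  assumes "integrable lborel f" "\<And>x. f x \<ge> 0" "A \<in> sets lborel"
  shows "(LBINT x:A. f x) \<le> integral\<^sup>L lborel f"
  unfolding set_lebesgue_integral_def
  using assms by (intro integral_mono integrable_mult_indicator) (auto simp: indicator_def)

text \<open>The laws \<open>\<nu> n\<close> are known only through their characteristic functions,
  so the analysis is independent of any probability space. The bound \<open>b n\<close> does not
  involve \<open>x\<close>, which is the uniformity.\<close>

lemma edgeworth_rate:
  fixes d :: nat and a p :: "nat \<Rightarrow> real" and \<beta> R :: real and \<nu> :: "nat \<Rightarrow> real measure"
  defines "\<mu> \<equiv> step_law d a p"
  assumes d: "d \<ge> 2" and \<Omega>: "(a, p) \<in> Omega d" and \<beta>: "\<beta> > 0" and dio: "diophantine d \<beta> a"
    and R: "2 * (R - 1/2) * \<beta> < 1"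
    and \<nu>: "\<And>n. n \<ge> 1 \<Longrightarrow> real_distribution (\<nu> n)"
    and char_\<nu>: "\<And>n t. n \<ge> 1 \<Longrightarrow> char (\<nu> n) t = char \<mu> (t / (std_dev \<mu> * sqrt (real n))) ^ n"
  obtains b where "b \<longlonglongrightarrow> 0"
    "\<And>n x. n \<ge> 1 \<Longrightarrow> real n powr R * \<bar>cdf (\<nu> n) x - edgeworth \<mu> (d - 1) n x\<bar> \<le> b n"
proof -
  define r where "r = d - 1"
  define \<sigma> where "\<sigma> = std_dev \<mu>"
  have d1: "d \<ge> 1" and Suc_r: "Suc r = d" using d by (auto simp: r_def)
  obtain j where j: "j \<in> {2..d+1}" "a j \<noteq> a 1" using diophantine_imp_differs[OF dio d1] .
  have \<sigma>: "\<sigma> > 0" unfolding \<sigma>_def \<mu>_def by (rule Omega_std_dev_pos[OF \<Omega> j])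
  have p: "(\<Sum>i=1..d+1. p i) = 1" "(\<Sum>i=1..d+1. p i * a i) = 0" using \<Omega> by (auto simp: Omega_def)
  obtain P \<delta> C1 where P0: "\<And>k. k \<notin> {1..r} \<Longrightarrow> P k = 0" and \<delta>: "\<delta> > 0" and C1: "C1 > 0"
    and P: "\<And>n t. n \<ge> 1 \<Longrightarrow> \<bar>t\<bar> \<le> \<delta> * sqrt (real n) \<Longrightarrow>
       norm (char \<mu> (t / (\<sigma> * sqrt (real n))) ^ n - fourier_stieltjes (edgeworth_of P r n) t)
       \<le> C1 * (1 / sqrt (real n)) ^ Suc r * (\<bar>t\<bar> * (1 + \<bar>t\<bar>) ^ (3 * r + 2)) * exp (- t\<^sup>2 / 4)"
    unfolding \<sigma>_def \<mu>_def
  proof (rule edgeworth_char_bound[OF p Omega_law(4)[OF \<Omega>] \<sigma>[unfolded \<sigma>_def \<mu>_def] Omega_law(2)[OF \<Omega>], of r], goal_cases)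
    case (1 P \<delta> C)
    show ?case by (rule 1(1); (rule 1(2-4) | (rule 1(5); assumption)); assumption)
  qed
  have exp: "edgeworth_expansion \<mu> r P"
    using P by (intro edgeworth_expansionI[OF \<delta>, where C=C1 and w="\<lambda>t. (\<bar>t\<bar> * (1 + \<bar>t\<bar>) ^ (3 * r + 2)) * exp (- t\<^sup>2 / 4)"])
       (simp add: \<sigma>_def mult.assoc)
  have edge: "edgeworth \<mu> (d - 1) = edgeworth_of P r"
    unfolding edgeworth_def r_def[symmetric] by (subst edgeworth_polys_eqI[OF exp P0]) auto
  obtain m where m: "m > 0" "\<And>n z. n \<ge> 1 \<Longrightarrow> \<bar>gauss_poly (edgeworth_density_poly P r n) z\<bar> \<le> m"
    using edgeworth_density_bounded[of P r] by blast
  obtain C2 D2 where C2: "C2 > 0" "\<And>n t. n \<ge> 1 \<Longrightarrow>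
    norm (fourier_stieltjes (edgeworth_of P r n) t) \<le> C2 * (1 + \<bar>t\<bar>) ^ D2 * exp (- t\<^sup>2 / 2)"
    using edgeworth_transform_bound[of P r] by blast
  obtain c where c: "c > 0" "\<And>s n. norm (char \<mu> s) ^ n \<le> exp (- c * real n * (dioph_dist d a s)\<^sup>2)"
    using Omega_char_decay[OF \<Omega> d1] unfolding \<mu>_def by blast
  have "\<delta> / \<sigma> > 0" using \<delta> \<sigma> by simp
  then obtain K where K: "K > 0" "\<And>s. \<bar>s\<bar> \<ge> \<delta> / \<sigma> \<Longrightarrow> dioph_dist d a s \<ge> K * \<bar>s\<bar> powr (- \<beta>)"
    using diophantine_lower_bound[OF dio d1] by blast
  define C where "C = esseen_constant"
  have C: "C > 0" unfolding C_def by (rule esseen_constant_pos)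
  have "R < 1/2 + 1 / (2 * \<beta>)" using R \<beta> by (simp add: field_simps)
  moreover have "1/2 < 1/2 + 1 / (2 * \<beta>)" using \<beta> by simp
  ultimately obtain R' where R': "R < R'" "1/2 < R'" "R' < 1/2 + 1 / (2 * \<beta>)"
    using dense[of "max R (1/2)" "1/2 + 1 / (2 * \<beta>)"] by auto
  define \<epsilon> where "\<epsilon> = 1 - 2 * (R' - 1/2) * \<beta>"
  have \<epsilon>: "\<epsilon> > 0" using R'(3) \<beta> by (simp add: \<epsilon>_def field_simps)
  have Rd: "R < real d / 2"
  proof -
    have "real (d - 1) = real d - 1" using d by simp
    moreover have "1 \<le> real (d - 1) * \<beta>" using \<beta> by (intro diophantine_exponent[OF dio d]) simp
    ultimately have "1 / \<beta> \<le> real d - 1" using \<beta> by (simp only: divide_le_eq if_True)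
    moreover have "1 / (2 * \<beta>) = (1 / \<beta>) / 2" by simp
    ultimately show ?thesis using \<open>R < 1/2 + 1 / (2 * \<beta>)\<close> by linarith
  qed
  \<comment> \<open>The power of \<open>\<sigma>\<close> comes from raising the bound
    \<open>n powr (R' - 1/2) / \<sigma>\<close> on the frequency to the power
    \<open>- 2 * \<beta>\<close>.\<close>
  define c1 where "c1 = c * K\<^sup>2 * \<sigma> powr (2 * \<beta>)"
  have c1: "c1 > 0" using c K \<sigma> by (simp add: c1_def)
  define w where "w t = (1 + \<bar>t\<bar>) ^ (3 * r + 2) * exp (- t\<^sup>2 / 4)" for t :: real
  \<comment> \<open>Of \<open>exp (- t\<^sup>2 / 2)\<close> one half stays here for integrability;
    the other half is at most \<open>exp (- \<delta>\<^sup>2 * n / 4)\<close> in the outer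
    range.\<close>
  define v where "v t = (1 + \<bar>t\<bar>) ^ D2 * exp (- t\<^sup>2 / 4)" for t :: real
  have w: "integrable lborel w" "\<And>t. w t \<ge> 0" and v: "integrable lborel v" "\<And>t. v t \<ge> 0"
    unfolding w_def v_def by (rule polynomial_gauss_integrable, simp)+
  define E where "E n = exp (- c1 * real n powr \<epsilon>)" for n
  \<comment> \<open>Outside \<open>\<delta> * sqrt n\<close> one has
    \<open>\<bar>t\<bar> \<ge> \<delta>\<close>, so dividing by \<open>\<delta>\<close> is enough to
    supply the factor \<open>\<bar>t\<bar>\<close>. Adding both regimes gives one bound valid on the
    whole band.\<close>
  define B where "B n t = C1 * (1 / sqrt (real n)) ^ d * w t + (E n + C2 * exp (- \<delta>\<^sup>2 * real n / 4) * v t) / \<delta>" for n t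
  define S where "S n = C1 * (1 / sqrt (real n)) ^ d * integral\<^sup>L lborel w
     + (2 * real n powr R' * E n + C2 * exp (- \<delta>\<^sup>2 * real n / 4) * integral\<^sup>L lborel v) / \<delta>" for n
  have decay: "norm (char \<mu> (t / (\<sigma> * sqrt (real n))) ^ n) \<le> E n"
    if n: "n \<ge> 1" and t: "\<bar>t\<bar> \<le> real n powr R'" "\<bar>t\<bar> > \<delta> * sqrt (real n)" for n t
  proof -
    define s where "s = t / (\<sigma> * sqrt (real n))"
    have sn: "sqrt (real n) > 0" "real n > 0" using n by auto
    have s_abs: "\<bar>s\<bar> = \<bar>t\<bar> / (\<sigma> * sqrt (real n))" using \<sigma> sn by (simp add: s_def abs_mult)
    have s1: "\<bar>s\<bar> \<ge> \<delta> / \<sigma>" unfolding s_abs using t(2) \<sigma> sn by (simp add: field_simps)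
    have s0: "\<bar>s\<bar> > 0" using s1 \<open>\<delta> / \<sigma> > 0\<close> by linarith
    have "\<bar>s\<bar> \<le> real n powr R' / (\<sigma> * sqrt (real n))" unfolding s_abs using t(1) \<sigma> sn by (intro divide_right_mono) auto
    also have "\<dots> = real n powr (R' - 1/2) / \<sigma>" 
      unfolding powr_diff using sn by (simp add: powr_half_sqrt mult.commute)
    finally have s2: "\<bar>s\<bar> \<le> real n powr (R' - 1/2) / \<sigma>" .
    have "K\<^sup>2 * (\<sigma> powr (2 * \<beta>) * real n powr (- (2 * (R' - 1/2) * \<beta>))) = (K * (real n powr (R' - 1/2) / \<sigma>) powr (- \<beta>))\<^sup>2"
    proof -
      have "((real n powr (R' - 1/2) / \<sigma>) powr (- \<beta>))\<^sup>2 = (real n powr (R' - 1/2) / \<sigma>) powr (- \<beta> * 2)"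
        using powr_powr[of "real n powr (R' - 1/2) / \<sigma>" "- \<beta>" 2] sn \<sigma> by (simp add: powr_numeral)
      also have "\<dots> = \<sigma> powr (2 * \<beta>) * real n powr (- (2 * (R' - 1/2) * \<beta>))"
        using sn \<sigma> by (simp add: powr_divide powr_powr powr_minus field_simps)
      finally show ?thesis by (simp add: power_mult_distrib)
    qed
    also have "\<dots> \<le> (K * \<bar>s\<bar> powr (- \<beta>))\<^sup>2"
      using s2 s0 \<beta> K(1) by (intro power_mono mult_left_mono powr_mono2') auto
    also have "\<dots> \<le> (dioph_dist d a s)\<^sup>2"
      using K(2)[OF s1] K(1) by (intro power_mono) auto
    finally have "c * real n * (K\<^sup>2 * (\<sigma> powr (2 * \<beta>) * real n powr (- (2 * (R' - 1/2) * \<beta>)))) \<le> c * real n * (dioph_dist d a s)\<^sup>2"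
      using c(1) by (intro mult_left_mono) auto
    also have "c * real n * (K\<^sup>2 * (\<sigma> powr (2 * \<beta>) * real n powr (- (2 * (R' - 1/2) * \<beta>)))) = c1 * real n powr \<epsilon>"
    proof -
      have "real n powr \<epsilon> = real n powr 1 * real n powr (- (2 * (R' - 1/2) * \<beta>))"
        by (simp only: \<epsilon>_def diff_conv_add_uminus powr_add)
      then show ?thesis using sn by (simp only: c1_def powr_one mult_ac)
    qed
    finally have "exp (- c * real n * (dioph_dist d a s)\<^sup>2) \<le> E n" by (simp add: E_def)
    then show ?thesis using c(2)[of s n] by (simp add: norm_power s_def)
  qed
  have bound: "\<bar>cdf (\<nu> n) x - edgeworth_of P r n x\<bar> \<le> C * (S n + m / real n powr R')" if n: "n \<ge> 1" for n x
  proof -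
    let ?T = "real n powr R'"
    have T: "?T > 0" using n by simp
    have E0: "E n \<ge> 0" by (simp add: E_def)
    have i1: "integrable lborel (\<lambda>t. C1 * (1 / sqrt (real n)) ^ d * w t + C2 * exp (- \<delta>\<^sup>2 * real n / 4) / \<delta> * v t)"
      by (intro Bochner_Integration.integrable_add integrable_mult_right w v)
    have i2: "set_integrable lborel {-?T..?T} (\<lambda>t. E n / \<delta>)"
      unfolding set_integrable_def using T by simp
    have B_eq: "B n = (\<lambda>t. (C1 * (1 / sqrt (real n)) ^ d * w t + C2 * exp (- \<delta>\<^sup>2 * real n / 4) / \<delta> * v t) + E n / \<delta>)"
      unfolding B_def by (simp add: add_divide_distrib add_ac)
    have i1': "set_integrable lborel {-?T..?T} (\<lambda>t. C1 * (1 / sqrt (real n)) ^ d * w t + C2 * exp (- \<delta>\<^sup>2 * real n / 4) / \<delta> * v t)"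
      unfolding set_integrable_def by (rule integrable_mult_indicator[OF _ i1]) simp
    have Bint: "set_integrable lborel {-?T..?T} (B n)" unfolding B_eq by (rule set_integral_add(1)[OF i1' i2])
    have e1: "(LBINT t:{-?T..?T}. B n t) = (LBINT t:{-?T..?T}. C1 * (1 / sqrt (real n)) ^ d * w t + C2 * exp (- \<delta>\<^sup>2 * real n / 4) / \<delta> * v t) + (LBINT t:{-?T..?T}. E n / \<delta>)"
      unfolding B_eq by (rule set_integral_add(2)[OF i1' i2])
    have e2: "(LBINT t:{-?T..?T}. E n / \<delta>) = 2 * ?T * E n / \<delta>"
      using T by (simp add: set_lebesgue_integral_def)
    have e3: "(LBINT t:{-?T..?T}. C1 * (1 / sqrt (real n)) ^ d * w t + C2 * exp (- \<delta>\<^sup>2 * real n / 4) / \<delta> * v t)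
       \<le> integral\<^sup>L lborel (\<lambda>t. C1 * (1 / sqrt (real n)) ^ d * w t + C2 * exp (- \<delta>\<^sup>2 * real n / 4) / \<delta> * v t)"
      using C1 C2(1) \<delta> w(2) v(2) by (intro set_integral_le_integral_nonneg i1) auto
    have e4: "integral\<^sup>L lborel (\<lambda>t. C1 * (1 / sqrt (real n)) ^ d * w t + C2 * exp (- \<delta>\<^sup>2 * real n / 4) / \<delta> * v t)
       = C1 * (1 / sqrt (real n)) ^ d * integral\<^sup>L lborel w + C2 * exp (- \<delta>\<^sup>2 * real n / 4) / \<delta> * integral\<^sup>L lborel v"
      by (subst Bochner_Integration.integral_add[OF integrable_mult_right[OF w(1)] integrable_mult_right[OF v(1)]])
         (simp only: integral_mult_right_zero)
    have BS: "(LBINT t:{-?T..?T}. B n t) \<le> S n"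
      using e3 unfolding e1 e2 e4 S_def by (simp add: add_divide_distrib)
    have B0: "B n t \<ge> 0" for t
      using C1 C2(1) \<delta> w(2)[of t] v(2)[of t] E0 by (simp add: B_def)
    have char_bound: "norm (char (\<nu> n) t - (CLBINT z. iexp (t * z) * of_real (gauss_poly (edgeworth_density_poly P r n) z))) \<le> \<bar>t\<bar> * B n t"
      if t: "\<bar>t\<bar> \<le> ?T" for t
    proof -
      let ?f = "char \<mu> (t / (\<sigma> * sqrt (real n))) ^ n" and ?g = "fourier_stieltjes (edgeworth_of P r n) t"
      have eq: "char (\<nu> n) t - (CLBINT z. iexp (t * z) * of_real (gauss_poly (edgeworth_density_poly P r n) z)) = ?f - ?g"
        unfolding char_\<nu>[OF n] \<sigma>_def fourier_stieltjes_eq_gauss_fourier gauss_fourier_def ..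
      show ?thesis
      proof (cases "\<bar>t\<bar> \<le> \<delta> * sqrt (real n)")
        case True
        have "norm (?f - ?g) \<le> \<bar>t\<bar> * (C1 * (1 / sqrt (real n)) ^ d * w t)"
          using P[OF n True] unfolding Suc_r by (simp add: w_def mult_ac)
        also have "\<dots> \<le> \<bar>t\<bar> * B n t"
          using E0 C2(1) \<delta> v(2)[of t] by (intro mult_left_mono) (auto simp: B_def)
        finally show ?thesis unfolding eq .
      next
        case False
        have "1 * 1 \<le> sqrt (real n)" using n by simp
        then have "\<delta> * 1 \<le> \<delta> * sqrt (real n)" using \<delta> by (intro mult_left_mono) auto
        then have t\<delta>: "\<delta> \<le> \<bar>t\<bar>" using False by linarith
        have "(\<delta> * sqrt (real n))\<^sup>2 \<le> \<bar>t\<bar>\<^sup>2" using False \<delta> by (intro power_mono) auto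
        then have "exp (- t\<^sup>2 / 4) \<le> exp (- \<delta>\<^sup>2 * real n / 4)" by (simp add: power_mult_distrib)
        then have "C2 * (1 + \<bar>t\<bar>) ^ D2 * (exp (- t\<^sup>2 / 4) * exp (- t\<^sup>2 / 4)) \<le> C2 * (1 + \<bar>t\<bar>) ^ D2 * (exp (- \<delta>\<^sup>2 * real n / 4) * exp (- t\<^sup>2 / 4))"
          using C2(1) by (intro mult_left_mono mult_right_mono) auto
        also have "exp (- t\<^sup>2 / 4) * exp (- t\<^sup>2 / 4) = exp (- t\<^sup>2 / 2)" by (simp flip: exp_add)
        finally have g: "norm ?g \<le> C2 * exp (- \<delta>\<^sup>2 * real n / 4) * v t"
          using C2(2)[OF n, of t] by (simp add: v_def mult_ac)
        have f: "norm ?f \<le> E n" using decay[OF n t] False by simp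
        have "norm (?f - ?g) \<le> 1 * (E n + C2 * exp (- \<delta>\<^sup>2 * real n / 4) * v t)"
          unfolding mult_1 by (rule order_trans[OF norm_triangle_ineq4 add_mono[OF f g]])
        also have "\<dots> \<le> (\<bar>t\<bar> / \<delta>) * (E n + C2 * exp (- \<delta>\<^sup>2 * real n / 4) * v t)"
          using t\<delta> \<delta> E0 C2(1) v(2)[of t] by (intro mult_right_mono) auto
        also have "\<dots> \<le> \<bar>t\<bar> * B n t"
          using C1 w(2)[of t] by (simp add: B_def distrib_left add_divide_distrib)
        finally show ?thesis unfolding eq .
      qed
    qed
    have "\<bar>cdf (\<nu> n) x - edgeworth_of P r n x\<bar> \<le> C * ((LBINT t:{-?T..?T}. B n t) + m / ?T)"
      unfolding C_def
      by (rule esseen_smoothing[OF \<nu>[OF n] gauss_poly_integrable edgeworth_of_eq_integral m(2)[OF n] m(1) T Bint B0 char_bound])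
    also have "\<dots> \<le> C * (S n + m / ?T)" using BS C by (intro mult_left_mono add_right_mono) auto
    finally show ?thesis .
  qed
  show thesis
  proof (rule that)
    let ?b = "\<lambda>n. real n powr R * (C * (S n + m / real n powr R'))"
    note lims = rate_limits[OF Rd R'(1) \<epsilon> c1 \<delta>]
    have eq: "?b = (\<lambda>n. C * C1 * integral\<^sup>L lborel w * (real n powr R * (1 / sqrt (real n)) ^ d)
        + C * 2 / \<delta> * (real n powr R * (real n powr R' * exp (- c1 * real n powr \<epsilon>)))
        + C * C2 * integral\<^sup>L lborel v / \<delta> * (real n powr R * exp (- \<delta>\<^sup>2 * real n / 4))
        + C * m * (real n powr R * (1 / real n powr R')))"
      by (rule ext) (simp add: S_def E_def add_divide_distrib distrib_left mult_ac)
    have "?b \<longlonglongrightarrow> C * C1 * integral\<^sup>L lborel w * 0 + C * 2 / \<delta> * 0 + C * C2 * integral\<^sup>L lborel v / \<delta> * 0 + C * m * 0"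
      unfolding eq by (intro tendsto_intros lims)
    then show "?b \<longlonglongrightarrow> 0" by simp
    show "real n powr R * \<bar>cdf (\<nu> n) x - edgeworth \<mu> (d - 1) n x\<bar> \<le> ?b n" if "n \<ge> 1" for n x
      unfolding edge by (intro mult_left_mono bound that) auto
  qed
qed

theorem theorem1:
  fixes d :: nat and a p :: "nat \<Rightarrow> real" and \<beta> R :: real
    and M :: "'a measure" and X :: "nat \<Rightarrow> 'a \<Rightarrow> real"
  assumes "d \<ge> 2" and "(a, p) \<in> Omega d"
    and "\<beta> > 0" and "diophantine d \<beta> a"
    and "2 * (R - 1/2) * \<beta> < 1"
    and "prob_space M"
    and "prob_space.indep_vars M (\<lambda>_. borel) X {1..}"
    and "\<And>i. i \<ge> 1 \<Longrightarrow> distr M borel (X i) = step_law d a p"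
  shows "uniform_limit UNIV
           (\<lambda>n z. real n powr R *
              (measure M {\<omega> \<in> space M.
                 (\<Sum>i=1..n. X i \<omega>) / (std_dev (step_law d a p) * sqrt (real n)) \<le> z}
               - edgeworth (step_law d a p) (d - 1) n z))
           (\<lambda>z. 0) sequentially"
proof -
  interpret prob_space M by fact
  let ?\<mu> = "step_law d a p"
  let ?Y = "\<lambda>n \<omega>. (\<Sum>i=1..n. X i \<omega>) / (std_dev ?\<mu> * sqrt (real n))"
  define \<nu> where "\<nu> n = distr M borel (?Y n)" for n
  have rv: "random_variable borel (X i)" if "i \<ge> 1" for i
    using assms(7) that by (auto simp: indep_vars_def)
  have sum_rv [measurable]: "(\<lambda>\<omega>. \<Sum>i=1..n. X i \<omega>) \<in> borel_measurable M" for n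
    by (intro borel_measurable_sum rv) auto
  have Y_rv: "?Y n \<in> borel_measurable M" for n by measurable
  have \<nu>: "real_distribution (\<nu> n)" for n
    unfolding \<nu>_def using Y_rv by (rule real_distribution_distr)
  have char_\<nu>: "char (\<nu> n) t = char ?\<mu> (t / (std_dev ?\<mu> * sqrt (real n))) ^ n" for n t
  proof -
    \<comment> \<open>Normalising the sum only rescales the argument; independence then factors the
      characteristic function.\<close>
    have "char (\<nu> n) t = char (distr M borel (\<lambda>\<omega>. \<Sum>i=1..n. X i \<omega>)) (t / (std_dev ?\<mu> * sqrt (real n)))"
      unfolding \<nu>_def char_def using sum_rv[of n] Y_rv[of n] by (simp add: integral_distr)
    also have "\<dots> = (\<Prod>i=1..n. char (distr M borel (X i)) (t / (std_dev ?\<mu> * sqrt (real n))))"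
      by (rule char_distr_sum) (rule indep_vars_subset[OF assms(7)], auto)
    also have "\<dots> = (\<Prod>i=1..n. char ?\<mu> (t / (std_dev ?\<mu> * sqrt (real n))))"
      by (intro prod.cong refl) (simp add: assms(8))
    finally show ?thesis by simp
  qed
  obtain b where b: "b \<longlonglongrightarrow> 0"
    "\<And>n x. n \<ge> 1 \<Longrightarrow> real n powr R * \<bar>cdf (\<nu> n) x - edgeworth ?\<mu> (d - 1) n x\<bar> \<le> b n"
    using edgeworth_rate[OF assms(1-5) \<nu> char_\<nu>] by blast
  have cdf: "cdf (\<nu> n) z = measure M {\<omega> \<in> space M. ?Y n \<omega> \<le> z}" for n z
    unfolding \<nu>_def cdf_def using Y_rv[of n]
    by (subst measure_distr) (auto intro!: arg_cong[where f="measure M"])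
  show ?thesis
  proof (rule uniform_limitI)
    fix e :: real assume "e > 0"
    then have "\<forall>\<^sub>F n in sequentially. b n < e" by (rule order_tendstoD(2)[OF b(1)])
    then show "\<forall>\<^sub>F n in sequentially. \<forall>z\<in>UNIV. dist (real n powr R * (measure M {\<omega> \<in> space M. ?Y n \<omega> \<le> z}
               - edgeworth ?\<mu> (d - 1) n z)) 0 < e"
      using eventually_ge_at_top[of 1]
    proof eventually_elim
      case (elim n)
      then show ?case using b(2)[of n] by (auto simp: cdf dist_real_def abs_mult intro: order.strict_trans1)
    qed
  qed
qed

end
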